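(* Fix $\beta>0$. Let $\epsilon>0$ and $s>1+\epsilon$. There is a constant $C_{\epsilon,s}$, depending only on $\epsilon$, $s$ (and $\beta$), such that for every $f\in H^1(\mathbb R)$ with $F=f\circ T\in H^s(\mathbb T)$, every $k\in\mathbb R$ and every integer $n>1$ the following hold. 1. Uniformly for $\delta\ge0$, $$\|(\mathcal C_{\mathbb R,k}-\mathcal C_{\mathbb R,k,n})f\|_{H^1(\mathbb R+i\delta)}\le(1+|k|)\,\|\mathcal R_nf-f\|_{H^1(\mathbb R)}\le C_{\epsilon,s}(1+|k|)\,n^{1+\epsilon-s}\,\|F\|_{H^s(\mathbb T)}.$$ 2. Uniformly for $\delta\ge0$, $$\|(\mathcal C_{\mathbb R,k}-\mathcal C_{\mathbb R,k,n})f\|_{L^2(\mathbb R+i\delta)}\le\|\mathcal R_nf-f\|_{L^2(\mathbb R)}\le C_{\epsilon,s}\,n^{1+\epsilon-s}\,\|F\|_{H^s(\mathbb T)}.$$ 3. For every $\delta>0$ and either choice of sign, $$\sup_{x\in\mathbb R}\left|\mathcal C_{\mathbb R,k}f(x\pm i\delta)-\mathcal C_{\mathbb R,k,n}f(x\pm i\delta)\right|\le C_{\epsilon,s}(1+|k|)\,n^{1+\epsilon-s}\,\|F\|_{H^s(\mathbb T)}.$$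
   Context: The oscillatory Cauchy operator is $\mathcal C_{\mathbb R,k}f(z)=\frac1{2\pi i}\int_{\mathbb R}\frac{e^{-ikx}f(x)}{x-z}\,dx$ for $z\in\mathbb C\setminus\mathbb R$, with boundary values $\mathcal C^{\pm}_{\mathbb R,k}f(x)=\lim_{\epsilon\to0^+}\mathcal C_{\mathbb R,k}f(x\pm i\epsilon)$. Its approximation is $\mathcal C_{\mathbb R,k,n}f(z)=\mathcal C_{\mathbb R,k}\mathcal R_nf(z)$, with boundary values $\mathcal C^\pm_{\mathbb R,k,n}f=\mathcal C^\pm_{\mathbb R,k}\mathcal R_nf$. For $X=H^1$ or $L^2$, $\|g\|_{X(\mathbb R+i\delta)}$ is the $X(\mathbb R)$ norm of $x\mapsto g(x+i\delta)$; for $\delta=0$ this is the norm of the boundary value from above ($\mathcal C^+$). $\mathbb T=[0,2\pi)$ is the periodic interval. With $\hat F_k=\frac1{2\pi}\int_0^{2\pi}e^{-ik\theta}F(\theta)\,d\theta$, $H^s(\mathbb T)$ is the space of $F\in L^2(\mathbb T)$ with $\|F\|_{H^s(\mathbb T)}=\big(\sum_{k\in\mathbb Z}(1+|k|)^{2s}|\hat F_k|^2\big)^{1/2}<\infty$. With $\mathcal F f(k)=\int_{\mathbb R}e^{-ikx}f(x)\,dx$, $H^1(\mathbb R)$ is the space of $f\in L^2(\mathbb R)$ with $\|f\|_{H^1(\mathbb R)}=\big(\int_{\mathbb R}(1+|k|)^{2}|\mathcal F f(k)|^2dk\big)^{1/2}<\infty$; its elements are identified with their continuous representatives, which vanish at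 infinity. For $\beta>0$ let $M_\beta(z)=\frac{z-i\beta}{z+i\beta}$, $M_\beta^{-1}(z)=\frac{\beta}{i}\frac{z+1}{z-1}$, and $T(\theta)=M_\beta^{-1}(e^{i\theta})$, a bijection from $(0,2\pi)$ to $\mathbb R$; $F(\theta)=f(T(\theta))$ for $\theta\in(0,2\pi)$ and $F(0)=F(2\pi)=0$. For $n\in\mathbb N$ let $\theta_\ell=2\pi\ell/n$ ($\ell=0,\dots,n-1$), $n_+=\lfloor n/2\rfloor$, $n_-=\lfloor(n-1)/2\rfloor$, $\tilde F_k=\frac1n\sum_{\ell=0}^{n-1}e^{-ik\theta_\ell}F(\theta_\ell)$, and $\mathcal I_nF(\theta)=\sum_{k=-n_-}^{n_+}e^{ik\theta}\tilde F_k$. The rational interpolant of $f$ is $\mathcal R_nf(x)=\mathcal I_nF(T^{-1}(x))=\sum_{k=-n_-}^{n_+}\tilde F_k\,M_\beta(x)^k$. *)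

theory Defs
  imports "HOL-Analysis.Analysis"
begin

section \<open>The spaces \<open>L\<^sup>2(\<real>)\<close> and \<open>H\<^sup>1(\<real>)\<close>\<close>

definition L2_fun :: "(real \<Rightarrow> complex) \<Rightarrow> bool" where
  "L2_fun f \<longleftrightarrow> f \<in> borel_measurable lborel \<and> integrable lborel (\<lambda>x. (cmod (f x))\<^sup>2)"

definition L2_norm :: "(real \<Rightarrow> complex) \<Rightarrow> real" where
  "L2_norm f = sqrt (LINT x|lborel. (cmod (f x))\<^sup>2)"

text \<open>On \<open>L\<^sup>2(\<real>)\<close> the integral \<open>\<integral> e\<^bsup>-i\<xi>x\<^esup> f(x) dx\<close> need not converge absolutely; as usual it
  denotes the \<open>L\<^sup>2\<close> limit of the truncated integrals.  The limit is stated with the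
  nonnegative integral, so that it carries no hidden integrability assumption.\<close>

definition is_fourier_transform :: "(real \<Rightarrow> complex) \<Rightarrow> (real \<Rightarrow> complex) \<Rightarrow> bool" where
  "is_fourier_transform f g \<longleftrightarrow> L2_fun g \<and>
     ((\<lambda>R::real. \<integral>\<^sup>+\<xi>. ennreal ((cmod (g \<xi> -
          (LINT x:{-R..R}|lborel. exp (- \<i> * complex_of_real \<xi> * complex_of_real x) * f x)))\<^sup>2)
        \<partial>lborel) \<longlongrightarrow> 0) at_top"

text \<open>For \<open>L2_fun f\<close> a transform exists and is unique up to null sets (Plancherel), so that the
  choice below affects none of the integrals it enters.\<close>

definition fourier_L2 :: "(real \<Rightarrow> complex) \<Rightarrow> real \<Rightarrow> complex" where
  "fourier_L2 f = (SOME g. is_fourier_transform f g)"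

text \<open>Elements are functions, not classes; continuity of the representative is not part of
  the predicate.\<close>

definition H1_fun :: "(real \<Rightarrow> complex) \<Rightarrow> bool" where
  "H1_fun f \<longleftrightarrow> L2_fun f \<and>
     integrable lborel (\<lambda>\<xi>. (1 + \<bar>\<xi>\<bar>)\<^sup>2 * (cmod (fourier_L2 f \<xi>))\<^sup>2)"

definition H1_norm :: "(real \<Rightarrow> complex) \<Rightarrow> real" where
  "H1_norm f = sqrt (LINT \<xi>|lborel. (1 + \<bar>\<xi>\<bar>)\<^sup>2 * (cmod (fourier_L2 f \<xi>))\<^sup>2)"


section \<open>The spaces \<open>H\<^sup>s\<close> on the circle\<close>

definition fourier_coeff :: "(real \<Rightarrow> complex) \<Rightarrow> int \<Rightarrow> complex" where
  "fourier_coeff F k =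
     complex_of_real (1 / (2 * pi)) *
     (LINT \<theta>:{0..<2*pi}|lborel. exp (- \<i> * of_int k * complex_of_real \<theta>) * F \<theta>)"

definition Hs_circle_fun :: "real \<Rightarrow> (real \<Rightarrow> complex) \<Rightarrow> bool" where
  "Hs_circle_fun s F \<longleftrightarrow>
     set_borel_measurable lborel {0..<2*pi} F \<and>
     set_integrable lborel {0..<2*pi} (\<lambda>\<theta>. (cmod (F \<theta>))\<^sup>2) \<and>
     (\<lambda>k::int. (1 + \<bar>real_of_int k\<bar>) powr (2 * s) * (cmod (fourier_coeff F k))\<^sup>2) summable_on UNIV"

definition Hs_circle_norm :: "real \<Rightarrow> (real \<Rightarrow> complex) \<Rightarrow> real" where
  "Hs_circle_norm s F =
     sqrt (\<Sum>\<^sub>\<infinity>k::int. (1 + \<bar>real_of_int k\<bar>) powr (2 * s) * (cmod (fourier_coeff F k))\<^sup>2)"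


section \<open>The Moebius map and the rational interpolant\<close>

definition moebius :: "real \<Rightarrow> complex \<Rightarrow> complex" where
  "moebius \<beta> z = (z - \<i> * complex_of_real \<beta>) / (z + \<i> * complex_of_real \<beta>)"

definition moebius_inv :: "real \<Rightarrow> complex \<Rightarrow> complex" where
  "moebius_inv \<beta> z = complex_of_real \<beta> / \<i> * ((z + 1) / (z - 1))"

text \<open>On the unit circle minus \<open>1\<close> the inverse map is real valued (see \<open>of_real_circle_to_line\<close>),
  so taking the real part loses nothing.\<close>

definition circle_to_line :: "real \<Rightarrow> real \<Rightarrow> real" where
  "circle_to_line \<beta> \<theta> = Re (moebius_inv \<beta> (exp (\<i> * complex_of_real \<theta>)))"

definition pullback :: "real \<Rightarrow> (real \<Rightarrow> complex) \<Rightarrow> real \<Rightarrow> complex" where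
  "pullback \<beta> f \<theta> = (if 0 < \<theta> \<and> \<theta> < 2 * pi then f (circle_to_line \<beta> \<theta>) else 0)"

definition disc_fourier_coeff :: "nat \<Rightarrow> (real \<Rightarrow> complex) \<Rightarrow> int \<Rightarrow> complex" where
  "disc_fourier_coeff n F k =
     1 / of_nat n *
     (\<Sum>l<n. exp (- \<i> * of_int k * complex_of_real (2 * pi * real l / real n))
             * F (2 * pi * real l / real n))"

definition trig_interp :: "nat \<Rightarrow> (real \<Rightarrow> complex) \<Rightarrow> real \<Rightarrow> complex" where
  "trig_interp n F \<theta> =
     (\<Sum>k\<in>{- int ((n - 1) div 2)..int (n div 2)}.
        exp (\<i> * of_int k * complex_of_real \<theta>) * disc_fourier_coeff n F k)"

definition rat_interp :: "real \<Rightarrow> nat \<Rightarrow> (real \<Rightarrow> complex) \<Rightarrow> real \<Rightarrow> complex" where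
  "rat_interp \<beta> n f x =
     (\<Sum>k\<in>{- int ((n - 1) div 2)..int (n div 2)}.
        disc_fourier_coeff n (pullback \<beta> f) k * moebius \<beta> (complex_of_real x) powi k)"

lemma exp_i_neq_1:
  assumes "0 < \<theta>" "\<theta> < 2 * pi"
  shows "exp (\<i> * complex_of_real \<theta>) \<noteq> 1"
proof
  assume "exp (\<i> * complex_of_real \<theta>) = 1"
  then obtain m :: int where m: "\<theta> = of_int (2 * m) * pi"
    by (auto simp: exp_eq_1)
  with assms have "0 < m" "m < 1"
    by (auto simp: zero_less_mult_iff)
  then show False by simp
qed

lemma of_real_circle_to_line:
  assumes "0 < \<theta>" "\<theta> < 2 * pi"
  shows "complex_of_real (circle_to_line \<beta> \<theta>) = moebius_inv \<beta> (exp (\<i> * complex_of_real \<theta>))"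
proof -
  define w where "w = exp (\<i> * complex_of_real \<theta>)"
  have w1: "w \<noteq> 1" using exp_i_neq_1[OF assms] by (simp add: w_def)
  have ww: "w * cnj w = 1"
    using complex_norm_square[of w] by (simp add: w_def norm_exp_i_times)
  have "w \<noteq> 0" by (simp add: w_def)
  with ww have cw: "cnj w = 1 / w" by (simp add: field_simps)
  have "cnj (moebius_inv \<beta> w) = moebius_inv \<beta> w"
    using w1 \<open>w \<noteq> 0\<close> by (simp add: moebius_inv_def cw divide_simps) (simp add: algebra_simps)
  then have "moebius_inv \<beta> w \<in> \<real>" by (simp add: Reals_cnj_iff)
  then show ?thesis by (simp add: circle_to_line_def w_def)
qed

lemma moebius_circle_to_line:
  assumes "\<beta> > 0" "0 < \<theta>" "\<theta> < 2 * pi"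
  shows "moebius \<beta> (complex_of_real (circle_to_line \<beta> \<theta>)) = exp (\<i> * complex_of_real \<theta>)"
  using exp_i_neq_1[OF assms(2,3)] assms(1)
  unfolding of_real_circle_to_line[OF assms(2,3)] moebius_def moebius_inv_def
  by (simp add: divide_simps) (simp add: algebra_simps)

lemma rat_interp_circle_to_line:
  assumes "\<beta> > 0" "0 < \<theta>" "\<theta> < 2 * pi"
  shows "rat_interp \<beta> n f (circle_to_line \<beta> \<theta>) = trig_interp n (pullback \<beta> f) \<theta>"
  unfolding rat_interp_def trig_interp_def moebius_circle_to_line[OF assms]
  by (intro sum.cong refl) (simp add: exp_power_int mult_ac)


section \<open>The oscillatory Cauchy operator\<close>

definition osc_cauchy :: "real \<Rightarrow> (real \<Rightarrow> complex) \<Rightarrow> complex \<Rightarrow> complex" where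
  "osc_cauchy k f z =
     1 / (2 * complex_of_real pi * \<i>) *
     (LINT x|lborel. exp (- \<i> * complex_of_real k * complex_of_real x) * f x
                     / (complex_of_real x - z))"

definition osc_cauchy_plus :: "real \<Rightarrow> (real \<Rightarrow> complex) \<Rightarrow> real \<Rightarrow> complex" where
  "osc_cauchy_plus k f x =
     Lim (at_right 0) (\<lambda>e::real. osc_cauchy k f (complex_of_real x + \<i> * complex_of_real e))"

definition osc_cauchy_approx :: "real \<Rightarrow> real \<Rightarrow> nat \<Rightarrow> (real \<Rightarrow> complex) \<Rightarrow> complex \<Rightarrow> complex" where
  "osc_cauchy_approx \<beta> k n f = osc_cauchy k (rat_interp \<beta> n f)"

definition osc_cauchy_approx_plus :: "real \<Rightarrow> real \<Rightarrow> nat \<Rightarrow> (real \<Rightarrow> complex) \<Rightarrow> real \<Rightarrow> complex" where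
  "osc_cauchy_approx_plus \<beta> k n f = osc_cauchy_plus k (rat_interp \<beta> n f)"

text \<open>The error on the horizontal line at height \<open>\<delta>\<close>; for \<open>\<delta> = 0\<close> this is the boundary value
  from above.\<close>

definition osc_cauchy_error ::
    "real \<Rightarrow> real \<Rightarrow> nat \<Rightarrow> (real \<Rightarrow> complex) \<Rightarrow> real \<Rightarrow> real \<Rightarrow> complex" where
  "osc_cauchy_error \<beta> k n f \<delta> x =
     (if \<delta> = 0 then osc_cauchy_plus k f x - osc_cauchy_approx_plus \<beta> k n f x
      else osc_cauchy k f (complex_of_real x + \<i> * complex_of_real \<delta>)
           - osc_cauchy_approx \<beta> k n f (complex_of_real x + \<i> * complex_of_real \<delta>))"

end

theory Submission
  imports Defs "HOL-Probability.Sinc_Integral"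
begin

text \<open>On the Fourier side, \<open>C\<^sub>k g\<close> on the line at height \<open>\<delta>\<close> has the transform
  \<open>1\<^bsub>\<xi>>0\<^esub> e\<^bsup>-\<delta>\<xi>\<^esup> G(\<xi> + k)\<close>, where \<open>G\<close> is the transform of \<open>g\<close>; since
  \<open>1 + |\<xi>| \<le> (1 + |k|)(1 + |\<xi> + k|)\<close>, the operator is bounded on \<open>L\<^sup>2\<close> and, up to the factor \<open>1 + |k|\<close>,
  on \<open>H\<^sup>1\<close>, uniformly in \<open>\<delta>\<close>, and \<open>G\<close> being integrable gives the uniform bound.

  For the interpolation error, write \<open>M\<close> for the Moebius map and \<open>f = \<Sum> c\<^sub>m M\<^sup>m\<close>. Interpolation replaces
  \<open>M\<^sup>m\<close> by \<open>M\<^sup>r\<close> with \<open>r\<close> the representative of \<open>m\<close> modulo \<open>n\<close> among the retained modes, so the error is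
  \<open>\<Sum> c\<^sub>m (M\<^sup>r - M\<^sup>m)\<close> over the other modes. On the line, \<open>||M\<^sup>r - M\<^sup>m||\<^sup>2 = 4\<pi>\<beta>|r - m|\<close>, and the powers of \<open>M\<close> are
  orthogonal for the weight \<open>|M'|\<close>, which controls the derivative of the error. Finite sums are estimated
  first; the \<open>H\<^sup>1\<close> bound passes to the limit by Fatou's lemma.\<close>

section \<open>The Plancherel inequality\<close>

text \<open>The estimates rest on two inequalities, \<open>plancherel_le\<close> and
  \<open>sq_norm_inv_ft_le\<close>, whose constants 2 pi and 1/(2 pi) multiply to 1; hence the
  constant 1 in the L2 bound. Identifying transforms takes more: \<open>fourier_L2\<close> is an
  arbitrary choice among L2 limits, so inversion for integrable L2 functions is proved by testing
  against intervals. Integrability of the transform of an H1 function makes the inverse integral and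
  the boundary values exist at every point.

  Without the weight |M'| the differences M^r - M^m are not orthogonal, and their norms can grow
  like |m|^(1/2). Summing them by Cauchy-Schwarz against |m|^(-1/2-\<epsilon>) costs
  |m|^(1+\<epsilon>) per coefficient, hence the exponent 1 + \<epsilon> - s; the derivative, where
  orthogonality is available, would allow 1 - s. A last obstacle is the node at angle 0, where F is
  0 by convention: the Fourier series takes the value 0 there because it is the limit at infinity of
  the square-integrable f.\<close>

lemma has_bochner_integral_exp_halfline:
  fixes w :: complex
  assumes "Re w < 0"
  shows "has_bochner_integral lborel (\<lambda>x. indicator {0<..} x *\<^sub>R exp (w * complex_of_real x)) (- 1 / w)"
proof -
  have w0: "w \<noteq> 0" using assms by auto
  have "set_integrable lborel {0<..} (\<lambda>x. exp (- (x * - Re w)))"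
    by (rule integrable_I0i_exp_mscale) (use assms in simp)
  then have int: "integrable lborel (\<lambda>x. indicator {0<..} x *\<^sub>R exp (w * complex_of_real x))"
    unfolding set_integrable_def
    by (rule Bochner_Integration.integrable_bound) (auto simp: norm_exp_eq_Re mult_ac)
  have lim: "((\<lambda>x::real. exp (w * complex_of_real x)) \<longlongrightarrow> 0) at_top"
  proof (rule tendsto_norm_zero_cancel)
    have "((\<lambda>x. exp (Re w * x)) \<longlongrightarrow> 0) at_top"
      using assms by (auto intro!: exp_at_bot[THEN filterlim_compose] filterlim_tendsto_neg_mult_at_bot[OF tendsto_const] filterlim_ident)
    then show "((\<lambda>x. norm (exp (w * complex_of_real x))) \<longlongrightarrow> 0) at_top"
      by (simp add: norm_exp_eq_Re)
  qed
  have "(LBINT x=ereal 0..\<infinity>. exp (w * complex_of_real x)) = 0 - 1 / w"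
  proof (rule interval_integral_FTC_integrable[where F="\<lambda>x. exp (w * complex_of_real x) / w"])
    show "((\<lambda>x. exp (w * complex_of_real x) / w) has_vector_derivative exp (w * complex_of_real x)) (at x)" for x
      using w0 by (auto intro!: derivative_eq_intros has_vector_derivative_real_field simp: field_simps)
    show "set_integrable lborel (einterval (ereal 0) \<infinity>) (\<lambda>x. exp (w * complex_of_real x))"
      using int by (simp add: set_integrable_def zero_ereal_def[symmetric] einterval_def greaterThan_def)
    show "(((\<lambda>x. exp (w * complex_of_real x) / w) \<circ> real_of_ereal) \<longlongrightarrow> 0) (at_left \<infinity>)"
      unfolding ereal_tendsto_simps using tendsto_divide[OF lim tendsto_const[of w]] w0 by simp
    have "isCont (\<lambda>x. exp (w * complex_of_real x) / w) 0" using w0 by (intro continuous_intros) auto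
    then have "((\<lambda>x. exp (w * complex_of_real x) / w) \<longlongrightarrow> 1 / w) (at_right 0)"
      by (auto simp: isCont_def intro: filterlim_mono[OF _ order_refl at_le])
    then show "(((\<lambda>x. exp (w * complex_of_real x) / w) \<circ> real_of_ereal) \<longlongrightarrow> 1 / w) (at_right (ereal 0))"
      unfolding ereal_tendsto_simps .
  qed (auto intro!: continuous_intros)
  then have "(LINT x|lborel. indicator {0<..} x *\<^sub>R exp (w * complex_of_real x)) = - 1 / w"
    by (simp add: zero_ereal_def[symmetric] interval_lebesgue_integral_0_infty set_lebesgue_integral_def)
  with int show ?thesis by (simp add: has_bochner_integral_iff)
qed

text \<open>The two half-lines contribute -1/a and -1/b, the negative one after reflection. The
  result is the Poisson kernel up to normalisation, the transform of the damping factor that makes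
  the multiple integrals in the proof of Plancherel converge absolutely.\<close>

lemma has_bochner_integral_exp_abs:
  fixes \<epsilon> u :: real
  assumes "\<epsilon> > 0"
  shows "has_bochner_integral lborel (\<lambda>\<xi>. exp (- \<epsilon> * \<bar>\<xi>\<bar>) *\<^sub>R exp (- \<i> * complex_of_real \<xi> * complex_of_real u))
           (complex_of_real (2 * \<epsilon> / (\<epsilon>\<^sup>2 + u\<^sup>2)))"
proof -
  define h where "h w = (\<lambda>x. indicator {0<..} x *\<^sub>R exp (w * complex_of_real x))" for w
  define a where "a = - complex_of_real \<epsilon> - \<i> * complex_of_real u"
  define b where "b = - complex_of_real \<epsilon> + \<i> * complex_of_real u"
  have ra: "Re a < 0" "Re b < 0" using assms by (auto simp: a_def b_def)
  have A: "has_bochner_integral lborel (h a) (- 1 / a)"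
    unfolding h_def by (rule has_bochner_integral_exp_halfline) (fact ra)
  have "has_bochner_integral lborel (h b) (- 1 / b)"
    unfolding h_def by (rule has_bochner_integral_exp_halfline) (fact ra)
  then have B: "has_bochner_integral lborel (\<lambda>x. h b (- x)) (- 1 / b)"
    using lborel_has_bochner_integral_real_affine_iff[of "-1" "h b" "- 1 / b" 0] by simp
  have AB: "has_bochner_integral lborel (\<lambda>x. h a x + h b (- x)) (- 1 / a + - 1 / b)"
    by (rule has_bochner_integral_add[OF A B])
  have "- 1 / a + - 1 / b = complex_of_real (2 * \<epsilon> / (\<epsilon>\<^sup>2 + u\<^sup>2))"
  proof -
    have nz: "a \<noteq> 0" "b \<noteq> 0" using ra by auto
    have "- 1 / a + - 1 / b = - (a + b) / (a * b)" using nz by (simp add: field_simps)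
    also have "a + b = - complex_of_real (2 * \<epsilon>)" by (simp add: a_def b_def)
    also have "a * b = complex_of_real (\<epsilon>\<^sup>2 + u\<^sup>2)"
      by (simp add: a_def b_def algebra_simps power2_eq_square)
    finally show ?thesis by simp
  qed
  with AB have AB': "has_bochner_integral lborel (\<lambda>x. h a x + h b (- x)) (complex_of_real (2 * \<epsilon> / (\<epsilon>\<^sup>2 + u\<^sup>2)))" 
    by simp
  \<comment> \<open>At 0 both indicators vanish while the right side is 1, so the functions differ
    at that single point.\<close>
  have "AE x in lborel. h a x + h b (- x) = exp (- \<epsilon> * \<bar>x\<bar>) *\<^sub>R exp (- \<i> * complex_of_real x * complex_of_real u)"
    using AE_lborel_singleton[of 0]
  proof eventually_elim
    case (elim x)
    then show ?case
      by (cases "x > 0") (auto simp: h_def a_def b_def scaleR_conv_of_real exp_of_real[symmetric] exp_add[symmetric] algebra_simps)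
  qed
  moreover have "(\<lambda>x. h a x + h b (- x)) \<in> borel_measurable lborel" unfolding h_def by measurable
  ultimately show ?thesis
    by (intro has_bochner_integral_cong_AE[THEN iffD1, OF _ _ _ AB']) auto
qed

text \<open>The substitution t = (x - y)/\<epsilon> reduces it to the integral of 1/(1 + t^2). The
  mass does not depend on \<epsilon>, which makes the Plancherel bound uniform in the damping; the
  same integral gives the L2 norm of the Cauchy kernel and the total weight on the circle.\<close>

lemma nn_integral_poisson_kernel:
  fixes \<epsilon> x :: real
  assumes "\<epsilon> > 0"
  shows "(\<integral>\<^sup>+y. ennreal (2 * \<epsilon> / (\<epsilon>\<^sup>2 + (x - y)\<^sup>2)) \<partial>lborel) = ennreal (2 * pi)"
proof -
  have "set_integrable lborel (einterval (-\<infinity>) \<infinity>) (\<lambda>x. inverse (1 + x^2) :: real)"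
    by (rule integrable_inverse_1_plus_square)
  then have "integrable lborel (\<lambda>x::real. inverse (1 + x^2))" by (simp add: set_integrable_def)
  moreover have "(LINT x|lborel. inverse (1 + x^2) :: real) = pi"
    using LBINT_inverse_1_plus_square by (simp add: interval_lebesgue_integral_def set_lebesgue_integral_def)
  ultimately have *: "(\<integral>\<^sup>+x. ennreal (inverse (1 + x^2)) \<partial>lborel) = ennreal pi"
    by (subst nn_integral_eq_integral) (auto simp: add_nonneg_nonneg)
  have e: "- 1 / \<epsilon> \<noteq> 0" using assms by auto
  have "ennreal pi = ennreal (1 / \<epsilon>) * (\<integral>\<^sup>+y. ennreal (inverse (1 + (x / \<epsilon> + - 1 / \<epsilon> * y)^2)) \<partial>lborel)"
    using assms nn_integral_real_affine[of "\<lambda>x. ennreal (inverse (1 + x^2))" "- 1 / \<epsilon>" "x / \<epsilon>"] *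
    by simp
  then have "ennreal 2 * (ennreal (1 / \<epsilon>) * (\<integral>\<^sup>+y. ennreal (inverse (1 + (x / \<epsilon> + - 1 / \<epsilon> * y)^2)) \<partial>lborel)) 
     = ennreal (2 * pi)"
    by (simp add: ennreal_mult)
  then have "(\<integral>\<^sup>+y. ennreal 2 * (ennreal (1 / \<epsilon>) * ennreal (inverse (1 + (x / \<epsilon> + - 1 / \<epsilon> * y)^2))) \<partial>lborel) = ennreal (2 * pi)"
    by (subst nn_integral_cmult, simp)+ simp
  moreover have "ennreal 2 * (ennreal (1 / \<epsilon>) * ennreal (inverse (1 + (x / \<epsilon> + - 1 / \<epsilon> * y)^2))) =
     ennreal (2 * \<epsilon> / (\<epsilon>\<^sup>2 + (x - y)\<^sup>2))" for y
  proof -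
    have 1: "x / \<epsilon> + - 1 / \<epsilon> * y = (x - y) / \<epsilon>" by (simp add: diff_divide_distrib)
    have 2: "2 * (1 / \<epsilon> * inverse (1 + ((x - y) / \<epsilon>)^2)) = 2 * \<epsilon> / (\<epsilon>\<^sup>2 + (x - y)\<^sup>2)"
    proof -
      have "1 + ((x - y) / \<epsilon>)^2 = (\<epsilon>\<^sup>2 + (x - y)\<^sup>2) / \<epsilon>\<^sup>2" using assms by (simp add: field_simps)
      then show ?thesis using assms by (simp add: field_simps power2_eq_square)
    qed
    show ?thesis unfolding 1 2[symmetric] using assms
      by (simp add: ennreal_mult[symmetric] del: ennreal_numeral)
  qed
  ultimately show ?thesis by simp
qed

text \<open>Domination by a product of integrable functions of one variable each; every exchange of
  Bochner integrals below verifies Fubini's hypothesis through it.\<close>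

lemma integrable_lborel_pair_bound:
  fixes g :: "real \<times> real \<Rightarrow> complex"
  assumes u: "integrable lborel u" and v: "integrable lborel v"
    and g[measurable]: "g \<in> borel_measurable (lborel \<Otimes>\<^sub>M lborel)"
    and le: "\<And>x y. norm (g (x, y)) \<le> u x * (v y :: real)"
  shows "integrable (lborel \<Otimes>\<^sub>M lborel) g"
proof (rule integrableI_bounded)
  have [measurable]: "u \<in> borel_measurable borel" "v \<in> borel_measurable borel" using u v by auto
  have "(\<integral>\<^sup>+p. ennreal (norm (g p)) \<partial>(lborel \<Otimes>\<^sub>M lborel)) \<le> (\<integral>\<^sup>+p. ennreal \<bar>u (fst p)\<bar> * ennreal \<bar>v (snd p)\<bar> \<partial>(lborel \<Otimes>\<^sub>M lborel))"
  proof (rule nn_integral_mono)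
    fix p :: "real \<times> real"
    obtain x y where p: "p = (x, y)" by force
    have "norm (g p) \<le> \<bar>u (fst p)\<bar> * \<bar>v (snd p)\<bar>"
      using le[of x y] by (simp add: p abs_mult[symmetric])
    then show "ennreal (norm (g p)) \<le> ennreal \<bar>u (fst p)\<bar> * ennreal \<bar>v (snd p)\<bar>"
      by (simp add: ennreal_mult[symmetric] ennreal_leI)
  qed
  also have "\<dots> = (\<integral>\<^sup>+x. \<integral>\<^sup>+y. ennreal \<bar>u x\<bar> * ennreal \<bar>v y\<bar> \<partial>lborel \<partial>lborel)"
    by (subst lborel.nn_integral_fst[symmetric]) auto
  also have "\<dots> = (\<integral>\<^sup>+x. ennreal \<bar>u x\<bar> \<partial>lborel) * (\<integral>\<^sup>+y. ennreal \<bar>v y\<bar> \<partial>lborel)"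
    by (simp add: nn_integral_cmult nn_integral_multc)
  also have "\<dots> < \<infinity>"
    using u v by (auto simp: integrable_iff_bounded ennreal_mult_less_top)
  finally show "(\<integral>\<^sup>+p. ennreal (norm (g p)) \<partial>(lborel \<Otimes>\<^sub>M lborel)) < \<infinity>" .
qed fact

text \<open>The squared L2 norm as an extended nonnegative number: bounds and limits can be stated
  before integrability is known, and Fatou's lemma applies directly.\<close>

definition sq_norm :: "(real \<Rightarrow> complex) \<Rightarrow> ennreal" where
  "sq_norm f = (\<integral>\<^sup>+x. ennreal ((cmod (f x))\<^sup>2) \<partial>lborel)"

definition ft :: "(real \<Rightarrow> complex) \<Rightarrow> real \<Rightarrow> complex" where
  "ft f \<xi> = (LINT x|lborel. exp (- \<i> * complex_of_real \<xi> * complex_of_real x) * f x)"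

lemma norm_exp_ii_mult [simp]: "cmod (exp (- (\<i> * complex_of_real x * complex_of_real y))) = 1"
  "cmod (exp (\<i> * complex_of_real x * complex_of_real y)) = 1"
  by (simp_all add: norm_exp_eq_Re)

lemma borel_measurable_cnj_comp [measurable (raw)]:
  "f \<in> borel_measurable M \<Longrightarrow> (\<lambda>x. cnj (f x)) \<in> borel_measurable M"
  by (rule measurable_compose[OF _ borel_measurable_continuous_onI]) (auto intro: continuous_intros)

lemma ft_measurable [measurable]:
  assumes [measurable]: "f \<in> borel_measurable borel"
  shows "ft f \<in> borel_measurable borel"
  unfolding ft_def[abs_def] by measurable

lemma integrable_exp_mult:
  assumes "integrable lborel f"
  shows "integrable lborel (\<lambda>x. exp (- \<i> * complex_of_real \<xi> * complex_of_real x) * f x)"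
  by (rule Bochner_Integration.integrable_bound[OF assms]) (use assms in \<open>auto simp: norm_mult\<close>)

lemma norm_ft_le:
  assumes "integrable lborel f"
  shows "cmod (ft f \<xi>) \<le> (LINT x|lborel. cmod (f x))"
proof -
  have "cmod (ft f \<xi>) \<le> (LINT x|lborel. cmod (exp (- \<i> * complex_of_real \<xi> * complex_of_real x) * f x))"
    unfolding ft_def by (rule integral_norm_bound)
  then show ?thesis by (simp add: norm_mult)
qed

lemma integrable_exp_neg_abs:
  assumes "(\<epsilon>::real) > 0"
  shows "integrable lborel (\<lambda>\<xi>. exp (- \<epsilon> * \<bar>\<xi>\<bar>))"
  using has_bochner_integral_exp_abs[OF assms, of 0, THEN integrable.intros]
  by (auto dest: integrable_norm)

text \<open>Writing the squared modulus as the transform times its conjugate and expanding both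
  gives a triple integral. The factor exp(-\<epsilon>|\<xi>|) makes it absolutely convergent, and
  integrating over \<xi> first leaves the Poisson kernel at x - y.\<close>

lemma ft_weighted_energy:
  assumes f: "integrable lborel f" and e: "\<epsilon> > 0"
  shows "(LINT \<xi>|lborel. complex_of_real (exp (- \<epsilon> * \<bar>\<xi>\<bar>)) * (ft f \<xi> * cnj (ft f \<xi>))) =
         (LINT x|lborel. f x * (LINT y|lborel. cnj (f y) * complex_of_real (2 * \<epsilon> / (\<epsilon>\<^sup>2 + (x - y)\<^sup>2))))"
proof -
  define E where "E \<xi> x = exp (- \<i> * complex_of_real \<xi> * complex_of_real x)" for \<xi> x
  define W where "W \<xi> = complex_of_real (exp (- \<epsilon> * \<bar>\<xi>\<bar>))" for \<xi>
  have [measurable]: "f \<in> borel_measurable borel" using f by auto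
  have [measurable]: "W \<in> borel_measurable borel" unfolding W_def by measurable
  have [measurable]: "(\<lambda>p. E (fst p) (snd p)) \<in> borel_measurable (borel \<Otimes>\<^sub>M borel)"
    unfolding E_def by measurable
  have [measurable]: "(\<lambda>x. E (u x) (v x)) \<in> borel_measurable M"
    if [measurable]: "u \<in> borel_measurable M" "v \<in> borel_measurable M" for u v M
    unfolding E_def by measurable
  have nE [simp]: "cmod (E \<xi> x) = 1" for \<xi> x by (simp add: E_def)
  have nW: "cmod (W \<xi>) = exp (- \<epsilon> * \<bar>\<xi>\<bar>)" for \<xi> by (simp add: W_def norm_exp_eq_Re)
  let ?L = "LINT x|lborel. cmod (f x)"
  have int1: "integrable lborel (\<lambda>\<xi>. exp (- \<epsilon> * \<bar>\<xi>\<bar>) * ?L)"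
    using integrable_exp_neg_abs[OF e] by simp
  have intf: "integrable lborel (\<lambda>x. cmod (f x))" using f by (rule integrable_norm)
  have cE: "cnj (E \<xi> y) = exp (\<i> * complex_of_real \<xi> * complex_of_real y)" for \<xi> y
    by (simp add: E_def exp_cnj)
  have EE: "E \<xi> x * cnj (E \<xi> y) = exp (- \<i> * complex_of_real \<xi> * complex_of_real (x - y))" for \<xi> x y
    unfolding cE by (simp add: E_def exp_add[symmetric] algebra_simps)
  have cft: "cnj (ft f \<xi>) = (LINT y|lborel. cnj (E \<xi> y) * cnj (f y))" for \<xi>
    unfolding ft_def E_def[symmetric] by (simp flip: Bochner_Integration.integral_cnj)
  have "(LINT \<xi>|lborel. W \<xi> * (ft f \<xi> * cnj (ft f \<xi>))) = (LINT \<xi>|lborel. LINT x|lborel. W \<xi> * cnj (ft f \<xi>) * (E \<xi> x * f x))"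
    by (intro Bochner_Integration.integral_cong refl, simp only: integral_mult_right_zero) (simp add: ft_def E_def mult_ac)
  also have "\<dots> = (LINT x|lborel. LINT \<xi>|lborel. W \<xi> * cnj (ft f \<xi>) * (E \<xi> x * f x))"
  proof (rule lborel_pair.Fubini_integral[symmetric])
    show "integrable (lborel \<Otimes>\<^sub>M lborel) (\<lambda>(\<xi>, x). W \<xi> * cnj (ft f \<xi>) * (E \<xi> x * f x))"
      by (rule integrable_lborel_pair_bound[OF int1 intf])
         (measurable, auto simp: norm_mult nW intro!: mult_right_mono mult_left_mono norm_ft_le[OF f])
  qed
  also have "\<dots> = (LINT x|lborel. f x * (LINT y|lborel. cnj (f y) * complex_of_real (2 * \<epsilon> / (\<epsilon>\<^sup>2 + (x - y)\<^sup>2))))"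
  proof (intro Bochner_Integration.integral_cong refl)
    fix x
    have "(LINT \<xi>|lborel. W \<xi> * cnj (ft f \<xi>) * (E \<xi> x * f x)) = f x * (LINT \<xi>|lborel. LINT y|lborel. W \<xi> * E \<xi> x * cnj (E \<xi> y) * cnj (f y))"
      by (simp only: mult.assoc[of _ _ "cnj (f _)"] integral_mult_right_zero integral_mult_left_zero cft[symmetric])
         (simp only: integral_mult_right_zero[symmetric] mult_ac)
    also have "(LINT \<xi>|lborel. LINT y|lborel. W \<xi> * E \<xi> x * cnj (E \<xi> y) * cnj (f y)) = (LINT y|lborel. LINT \<xi>|lborel. W \<xi> * E \<xi> x * cnj (E \<xi> y) * cnj (f y))"
    proof (rule lborel_pair.Fubini_integral[symmetric])
      show "integrable (lborel \<Otimes>\<^sub>M lborel) (\<lambda>(\<xi>, y). W \<xi> * E \<xi> x * cnj (E \<xi> y) * cnj (f y))"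
        by (rule integrable_lborel_pair_bound[OF integrable_exp_neg_abs[OF e] intf])
           (measurable, auto simp: norm_mult nW)
    qed
    also have "\<dots> = (LINT y|lborel. cnj (f y) * complex_of_real (2 * \<epsilon> / (\<epsilon>\<^sup>2 + (x - y)\<^sup>2)))"
    proof (intro Bochner_Integration.integral_cong refl)
      fix y
      have "(LINT \<xi>|lborel. W \<xi> * E \<xi> x * cnj (E \<xi> y) * cnj (f y)) = cnj (f y) * (LINT \<xi>|lborel. W \<xi> * (E \<xi> x * cnj (E \<xi> y)))"
        by (simp only: integral_mult_right_zero[symmetric] mult_ac)
      also have "(LINT \<xi>|lborel. W \<xi> * (E \<xi> x * cnj (E \<xi> y))) = complex_of_real (2 * \<epsilon> / (\<epsilon>\<^sup>2 + (x - y)\<^sup>2))"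
        unfolding EE W_def using has_bochner_integral_exp_abs[OF e, of "x - y", THEN has_bochner_integral_integral_eq]
        by (simp add: scaleR_conv_of_real)
      finally show "(LINT \<xi>|lborel. W \<xi> * E \<xi> x * cnj (E \<xi> y) * cnj (f y)) = cnj (f y) * complex_of_real (2 * \<epsilon> / (\<epsilon>\<^sup>2 + (x - y)\<^sup>2))" .
    qed
    finally show "(LINT \<xi>|lborel. W \<xi> * cnj (ft f \<xi>) * (E \<xi> x * f x)) = f x * (LINT y|lborel. cnj (f y) * complex_of_real (2 * \<epsilon> / (\<epsilon>\<^sup>2 + (x - y)\<^sup>2)))" .
  qed
  finally show ?thesis unfolding W_def .
qed

text \<open>Fatou's lemma in the shape needed for passing to limits: a bound that holds eventually
  is inherited by the almost everywhere limit.\<close>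

lemma nn_integral_limit_le:
  fixes u :: "nat \<Rightarrow> 'a \<Rightarrow> ennreal"
  assumes [measurable]: "\<And>n. u n \<in> borel_measurable M"
    and lim: "AE x in M. (\<lambda>n. u n x) \<longlonglongrightarrow> v x"
    and le: "\<forall>\<^sub>F n in sequentially. (\<integral>\<^sup>+x. u n x \<partial>M) \<le> B"
  shows "(\<integral>\<^sup>+x. v x \<partial>M) \<le> B"
proof -
  have "(\<integral>\<^sup>+x. v x \<partial>M) = (\<integral>\<^sup>+x. liminf (\<lambda>n. u n x) \<partial>M)"
    using lim by (intro nn_integral_cong_AE) (auto elim!: eventually_mono dest!: lim_imp_Liminf[OF sequentially_bot])
  also have "\<dots> \<le> liminf (\<lambda>n. integral\<^sup>N M (u n))" by (rule nn_integral_liminf) measurable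
  also have "\<dots> \<le> liminf (\<lambda>n. B)" by (rule Liminf_mono) (fact le)
  also have "\<dots> = B" by (simp add: Liminf_const)
  finally show ?thesis .
qed

text \<open>For a non-integrable function the Bochner integral is 0 by convention, so the bound
  persists in that case.\<close>

lemma norm_integral_le_nn_integral:
  fixes f :: "'a \<Rightarrow> 'b :: {banach, second_countable_topology}"
  shows "ennreal (norm (integral\<^sup>L M f)) \<le> (\<integral>\<^sup>+x. ennreal (norm (f x)) \<partial>M)"
  by (cases "integrable M f") (auto simp: integral_norm_bound_ennreal not_integrable_integral_eq)

text \<open>Schur's test for the Poisson kernel: |f(x)||f(y)| is at most half the sum of the
  squares, and the kernel has mass 2 pi in either variable, so each half contributes pi times the
  squared norm.\<close>

lemma sq_norm_ft_weighted_le: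
  assumes f: "integrable lborel f" and e: "\<epsilon> > 0"
  shows "(\<integral>\<^sup>+\<xi>. ennreal (exp (- \<epsilon> * \<bar>\<xi>\<bar>) * (cmod (ft f \<xi>))\<^sup>2) \<partial>lborel) \<le> ennreal (2 * pi) * sq_norm f"
proof -
  have [measurable]: "f \<in> borel_measurable borel" using f by auto
  let ?L = "LINT x|lborel. cmod (f x)"
  define K where "K u = 2 * \<epsilon> / (\<epsilon>\<^sup>2 + u\<^sup>2)" for u :: real
  have [measurable]: "K \<in> borel_measurable borel" unfolding K_def by measurable
  have K0: "K u \<ge> 0" for u unfolding K_def using e by (intro divide_nonneg_nonneg) auto
  have Ksym: "K (x - y) = K (y - x)" for x y by (simp add: K_def power2_commute)
  have KI: "(\<integral>\<^sup>+y. ennreal (K (x - y)) \<partial>lborel) = ennreal (2 * pi)" for x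
    unfolding K_def by (rule nn_integral_poisson_kernel[OF e])
  have int: "integrable lborel (\<lambda>\<xi>. exp (- \<epsilon> * \<bar>\<xi>\<bar>) * (cmod (ft f \<xi>))\<^sup>2)"
    by (rule Bochner_Integration.integrable_bound[OF integrable_mult_left[OF integrable_exp_neg_abs[OF e], of "?L\<^sup>2"]])
       (auto simp: abs_mult intro!: mult_left_mono power_mono norm_ft_le[OF f])
  define I where "I = (LINT \<xi>|lborel. exp (- \<epsilon> * \<bar>\<xi>\<bar>) * (cmod (ft f \<xi>))\<^sup>2)"
  have I0: "I \<ge> 0" unfolding I_def by (intro integral_nonneg_AE) auto
  have "complex_of_real I = (LINT \<xi>|lborel. complex_of_real (exp (- \<epsilon> * \<bar>\<xi>\<bar>)) * (ft f \<xi> * cnj (ft f \<xi>)))"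
    unfolding I_def integral_complex_of_real[symmetric] complex_norm_square[symmetric] of_real_mult[symmetric] ..
  also have "\<dots> = (LINT x|lborel. f x * (LINT y|lborel. cnj (f y) * complex_of_real (K (x - y))))"
    unfolding K_def by (rule ft_weighted_energy[OF f e])
  finally have "I = cmod (LINT x|lborel. f x * (LINT y|lborel. cnj (f y) * complex_of_real (K (x - y))))"
    using I0 by (metis norm_of_real abs_of_nonneg)
  then have "ennreal I \<le> (\<integral>\<^sup>+x. ennreal (cmod (f x * (LINT y|lborel. cnj (f y) * complex_of_real (K (x - y))))) \<partial>lborel)"
    by (simp add: norm_integral_le_nn_integral)
  also have "\<dots> \<le> (\<integral>\<^sup>+x. ennreal (cmod (f x)) * (\<integral>\<^sup>+y. ennreal (cmod (f y) * K (x - y)) \<partial>lborel) \<partial>lborel)"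
  proof (intro nn_integral_mono)
    fix x
    have "ennreal (cmod (LINT y|lborel. cnj (f y) * complex_of_real (K (x - y)))) \<le> (\<integral>\<^sup>+y. ennreal (cmod (cnj (f y) * complex_of_real (K (x - y)))) \<partial>lborel)"
      by (rule norm_integral_le_nn_integral)
    then show "ennreal (cmod (f x * (LINT y|lborel. cnj (f y) * complex_of_real (K (x - y))))) \<le> ennreal (cmod (f x)) * (\<integral>\<^sup>+y. ennreal (cmod (f y) * K (x - y)) \<partial>lborel)"
      by (simp add: norm_mult ennreal_mult K0 mult_left_mono)
  qed
  also have "\<dots> = (\<integral>\<^sup>+x. (\<integral>\<^sup>+y. ennreal (cmod (f x) * (cmod (f y) * K (x - y))) \<partial>lborel) \<partial>lborel)"
    by (intro nn_integral_cong) (simp add: nn_integral_cmult[symmetric] ennreal_mult K0)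
  also have "\<dots> \<le> (\<integral>\<^sup>+x. (\<integral>\<^sup>+y. ennreal ((cmod (f x))\<^sup>2 / 2 * K (x - y)) + ennreal ((cmod (f y))\<^sup>2 / 2 * K (x - y)) \<partial>lborel) \<partial>lborel)"
  proof (intro nn_integral_mono)
    fix x y
    have "cmod (f x) * cmod (f y) \<le> (cmod (f x))\<^sup>2 / 2 + (cmod (f y))\<^sup>2 / 2"
      using sum_squares_bound[of "cmod (f x)" "cmod (f y)"] by simp
    then have "cmod (f x) * cmod (f y) * K (x - y) \<le> ((cmod (f x))\<^sup>2 / 2 + (cmod (f y))\<^sup>2 / 2) * K (x - y)"
      by (rule mult_right_mono) (rule K0)
    then show "ennreal (cmod (f x) * (cmod (f y) * K (x - y))) \<le> ennreal ((cmod (f x))\<^sup>2 / 2 * K (x - y)) + ennreal ((cmod (f y))\<^sup>2 / 2 * K (x - y))"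
      by (simp add: ennreal_plus[symmetric] K0 ennreal_leI algebra_simps del: ennreal_plus)
  qed
  also have "\<dots> = (\<integral>\<^sup>+x. (\<integral>\<^sup>+y. ennreal ((cmod (f x))\<^sup>2 / 2 * K (x - y)) \<partial>lborel) \<partial>lborel) +
      (\<integral>\<^sup>+x. (\<integral>\<^sup>+y. ennreal ((cmod (f y))\<^sup>2 / 2 * K (x - y)) \<partial>lborel) \<partial>lborel)"
    by (simp add: nn_integral_add)
  also have "(\<integral>\<^sup>+x. (\<integral>\<^sup>+y. ennreal ((cmod (f y))\<^sup>2 / 2 * K (x - y)) \<partial>lborel) \<partial>lborel) = 
     (\<integral>\<^sup>+y. (\<integral>\<^sup>+x. ennreal ((cmod (f y))\<^sup>2 / 2 * K (x - y)) \<partial>lborel) \<partial>lborel)"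
    by (rule lborel_pair.Fubini'[symmetric]) measurable
  also have "\<dots> = (\<integral>\<^sup>+y. (\<integral>\<^sup>+x. ennreal ((cmod (f y))\<^sup>2 / 2 * K (y - x)) \<partial>lborel) \<partial>lborel)"
    by (simp add: Ksym)
  also have "(\<integral>\<^sup>+x. (\<integral>\<^sup>+y. ennreal ((cmod (f x))\<^sup>2 / 2 * K (x - y)) \<partial>lborel) \<partial>lborel) = ennreal pi * sq_norm f"
  proof -
    have "(\<integral>\<^sup>+y. ennreal ((cmod (f x))\<^sup>2 / 2 * K (x - y)) \<partial>lborel) = ennreal pi * ennreal ((cmod (f x))\<^sup>2)" for x
    proof -
      have "(\<integral>\<^sup>+y. ennreal ((cmod (f x))\<^sup>2 / 2 * K (x - y)) \<partial>lborel) = ennreal ((cmod (f x))\<^sup>2 / 2) * ennreal (2 * pi)"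
        unfolding KI[of x, symmetric]
        by (subst nn_integral_cmult[symmetric]) (auto simp: ennreal_mult[symmetric] K0 simp del: ennreal_divide_numeral)
      then show ?thesis by (simp add: ennreal_mult[symmetric] mult_ac del: ennreal_divide_numeral)
    qed
    then show ?thesis unfolding sq_norm_def by (simp add: nn_integral_cmult)
  qed
  also have "ennreal pi * sq_norm f + ennreal pi * sq_norm f = ennreal (2 * pi) * sq_norm f"
    by (metis distrib_right ennreal_plus mult_2 pi_ge_zero)
  finally show ?thesis using int unfolding I_def by (subst nn_integral_eq_integral) auto
qed

text \<open>The damping is removed along \<epsilon> = 1/(n+1) by Fatou's lemma, which yields an
  inequality rather than an identity; the later estimates are arranged to use only this
  direction.\<close>

theorem plancherel_le:
  assumes f: "integrable lborel f"
  shows "sq_norm (ft f) \<le> ennreal (2 * pi) * sq_norm f"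
  unfolding sq_norm_def[of "ft f"]
proof (rule nn_integral_limit_le)
  have [measurable]: "f \<in> borel_measurable borel" using f by auto
  show "(\<lambda>\<xi>. ennreal (exp (- (1 / Suc n) * \<bar>\<xi>\<bar>) * (cmod (ft f \<xi>))\<^sup>2)) \<in> borel_measurable lborel" for n
    by measurable
  show "AE \<xi> in lborel. (\<lambda>n. ennreal (exp (- (1 / Suc n) * \<bar>\<xi>\<bar>) * (cmod (ft f \<xi>))\<^sup>2)) \<longlonglongrightarrow> ennreal ((cmod (ft f \<xi>))\<^sup>2)"
  proof (intro AE_I2 tendsto_ennrealI)
    fix \<xi>
    have "(\<lambda>n. exp (- (1 / real (Suc n)) * \<bar>\<xi>\<bar>) * (cmod (ft f \<xi>))\<^sup>2) \<longlonglongrightarrow> exp (- 0 * \<bar>\<xi>\<bar>) * (cmod (ft f \<xi>))\<^sup>2"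
      by (intro tendsto_intros LIMSEQ_Suc[OF lim_1_over_n])
    then show "(\<lambda>n. exp (- (1 / real (Suc n)) * \<bar>\<xi>\<bar>) * (cmod (ft f \<xi>))\<^sup>2) \<longlonglongrightarrow> (cmod (ft f \<xi>))\<^sup>2" by simp
  qed
  show "\<forall>\<^sub>F n in sequentially. (\<integral>\<^sup>+\<xi>. ennreal (exp (- (1 / Suc n) * \<bar>\<xi>\<bar>) * (cmod (ft f \<xi>))\<^sup>2) \<partial>lborel) \<le> ennreal (2 * pi) * sq_norm f"
    by (intro always_eventually allI sq_norm_ft_weighted_le f) simp
qed

section \<open>Calculus of squared L2 norms and completeness of L2\<close>

lemma norm_add_power2_le: "(norm (a + b :: 'a :: real_normed_vector))\<^sup>2 \<le> 2 * (norm a)\<^sup>2 + 2 * (norm b)\<^sup>2"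
proof -
  have "(norm (a + b))\<^sup>2 \<le> (norm a + norm b)\<^sup>2" by (intro power_mono norm_triangle_ineq) auto
  also have "\<dots> \<le> 2 * (norm a)\<^sup>2 + 2 * (norm b)\<^sup>2"
    using sum_squares_bound[of "norm a" "norm b"] by (simp add: power2_sum)
  finally show ?thesis .
qed

lemma sq_norm_add_le:
  assumes [measurable]: "f \<in> borel_measurable borel" "g \<in> borel_measurable borel"
  shows "sq_norm (\<lambda>x. f x + g x) \<le> 2 * sq_norm f + 2 * sq_norm g"
proof -
  have "sq_norm (\<lambda>x. f x + g x) \<le> (\<integral>\<^sup>+x. 2 * ennreal ((cmod (f x))\<^sup>2) + 2 * ennreal ((cmod (g x))\<^sup>2) \<partial>lborel)"
    unfolding sq_norm_def
  proof (intro nn_integral_mono)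
    fix x
    have "ennreal ((cmod (f x + g x))\<^sup>2) \<le> ennreal (2 * (cmod (f x))\<^sup>2 + 2 * (cmod (g x))\<^sup>2)"
      by (intro ennreal_leI norm_add_power2_le)
    then show "ennreal ((cmod (f x + g x))\<^sup>2) \<le> 2 * ennreal ((cmod (f x))\<^sup>2) + 2 * ennreal ((cmod (g x))\<^sup>2)"
      by (simp add: ennreal_mult)
  qed
  also have "\<dots> = 2 * sq_norm f + 2 * sq_norm g"
    unfolding sq_norm_def by (simp add: nn_integral_add nn_integral_cmult)
  finally show ?thesis .
qed

lemma sq_norm_minus_commute: "sq_norm (\<lambda>x. f x - g x) = sq_norm (\<lambda>x. g x - f x)"
  by (simp add: sq_norm_def norm_minus_commute)

lemma sq_norm_triangle:
  assumes [measurable]: "f \<in> borel_measurable borel" "g \<in> borel_measurable borel" "h \<in> borel_measurable borel"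
  shows "sq_norm (\<lambda>x. f x - h x) \<le> 2 * sq_norm (\<lambda>x. f x - g x) + 2 * sq_norm (\<lambda>x. g x - h x)"
  using sq_norm_add_le[of "\<lambda>x. f x - g x" "\<lambda>x. g x - h x"] by simp

lemma sq_norm_cong_AE:
  assumes "AE x in lborel. f x = g x"
  shows "sq_norm f = sq_norm g"
  unfolding sq_norm_def using assms by (intro nn_integral_cong_AE) auto

lemma AE_eq_if_sq_norm_eq_0:
  assumes [measurable]: "f \<in> borel_measurable borel" "g \<in> borel_measurable borel"
    and "sq_norm (\<lambda>x. f x - g x) = 0"
  shows "AE x in lborel. f x = g x"
proof -
  have "AE x in lborel. ennreal ((cmod (f x - g x))\<^sup>2) = 0"
    using assms(3) unfolding sq_norm_def by (subst (asm) nn_integral_0_iff_AE) auto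
  then show ?thesis by eventually_elim simp
qed

lemma L2_fun_iff_sq_norm:
  "L2_fun f \<longleftrightarrow> f \<in> borel_measurable borel \<and> sq_norm f < \<infinity>"
  unfolding L2_fun_def sq_norm_def by (auto simp: integrable_iff_bounded)

lemma L2_fun_measurable [measurable_dest]: "L2_fun f \<Longrightarrow> f \<in> borel_measurable borel"
  by (simp add: L2_fun_iff_sq_norm)

lemma L2_norm_eq_sq_norm: "L2_norm f = sqrt (enn2real (sq_norm f))"
  if "f \<in> borel_measurable borel"
  unfolding L2_norm_def sq_norm_def using that by (subst integral_eq_nn_integral) auto

lemma L2_fun_add: "L2_fun f \<Longrightarrow> L2_fun g \<Longrightarrow> L2_fun (\<lambda>x. f x + g x)"
  using sq_norm_add_le[of f g] unfolding L2_fun_iff_sq_norm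
  by (auto intro: le_less_trans simp: ennreal_mult_less_top)

lemma L2_fun_diff: "L2_fun f \<Longrightarrow> L2_fun g \<Longrightarrow> L2_fun (\<lambda>x. f x - g x)"
  using L2_fun_add[of f "\<lambda>x. - g x"] by (simp add: L2_fun_iff_sq_norm sq_norm_def)

text \<open>The squares of the differences tend to 0 in L1, which gives almost everywhere
  convergence along a subsequence. This is how L2 limits, in particular transforms, become
  accessible pointwise.\<close>

lemma sq_norm_tendsto_imp_AE_subseq:
  assumes [measurable]: "\<And>n. u n \<in> borel_measurable borel" "v \<in> borel_measurable borel"
    and lim: "(\<lambda>n. sq_norm (\<lambda>x. v x - u n x)) \<longlonglongrightarrow> 0"
  shows "\<exists>r::nat\<Rightarrow>nat. strict_mono r \<and> (AE x in lborel. (\<lambda>n. u (r n) x) \<longlonglongrightarrow> v x)"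
proof -
  have "\<forall>\<^sub>F n in sequentially. sq_norm (\<lambda>x. v x - u n x) < \<infinity>"
    using order_tendstoD(2)[OF lim, of \<infinity>] by simp
  \<comment> \<open>Initial terms may have infinite \<open>sq_norm\<close>; shifting by
    \<open>N\<close> discards them, so that all \<open>w n\<close> are integrable.\<close>
  then obtain N where N: "\<And>n. n \<ge> N \<Longrightarrow> sq_norm (\<lambda>x. v x - u n x) < \<infinity>"
    by (auto simp: eventually_sequentially)
  define w where "w n x = (cmod (v x - u (n + N) x))\<^sup>2" for n x
  have wi: "integrable lborel (w n)" for n
    using N[of "n + N"] unfolding w_def[abs_def] sq_norm_def by (auto simp: integrable_iff_bounded)
  have "ennreal (LINT x|lborel. norm (w n x)) = sq_norm (\<lambda>x. v x - u (n + N) x)" for n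
    using nn_integral_eq_integral[OF integrable_norm[OF wi[of n]]] by (simp add: sq_norm_def w_def)
  then have "(\<lambda>n. ennreal (LINT x|lborel. norm (w n x))) \<longlonglongrightarrow> 0"
    using LIMSEQ_ignore_initial_segment[OF lim, of N] by simp
  then have "(\<lambda>n. (LINT x|lborel. norm (w n x))) \<longlonglongrightarrow> 0"
    by (subst (asm) ennreal_tendsto_0_iff) auto
  from tendsto_L1_AE_subseq[OF wi this] obtain r :: "nat \<Rightarrow> nat" where r: "strict_mono r"
    "AE x in lborel. (\<lambda>n. w (r n) x) \<longlonglongrightarrow> 0" by auto
  show ?thesis
  proof (intro exI[of _ "\<lambda>n. r n + N"] conjI)
    show "strict_mono (\<lambda>n. r n + N)" using r(1) by (auto simp: strict_mono_def)
    show "AE x in lborel. (\<lambda>n. u (r n + N) x) \<longlonglongrightarrow> v x"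
      using r(2)
    proof eventually_elim
      case (elim x)
      then have "(\<lambda>n. sqrt (w (r n) x)) \<longlonglongrightarrow> sqrt 0" by (rule tendsto_real_sqrt)
      then have "(\<lambda>n. norm (v x - u (r n + N) x)) \<longlonglongrightarrow> 0" by (simp add: w_def)
      then have "(\<lambda>n. v x - u (r n + N) x) \<longlonglongrightarrow> 0" by (rule tendsto_norm_zero_cancel)
      from tendsto_diff[OF tendsto_const[of "v x"] this] show ?case by simp
    qed
  qed
qed

text \<open>The Riesz-Fischer argument: a rapidly Cauchy subsequence converges almost everywhere
  because its increments are dominated by a geometric series, and Fatou's lemma turns the pointwise
  limit into an L2 limit of the whole sequence.\<close>

lemma L2_complete:
  fixes u :: "nat \<Rightarrow> real \<Rightarrow> complex"
  assumes [measurable]: "\<And>n. u n \<in> borel_measurable borel"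
    and cauchy: "\<And>e::real. e > 0 \<Longrightarrow> \<exists>N. \<forall>i\<ge>N. \<forall>j\<ge>N. sq_norm (\<lambda>x. u i x - u j x) \<le> ennreal e"
  shows "\<exists>g. g \<in> borel_measurable borel \<and> (\<lambda>n. sq_norm (\<lambda>x. g x - u n x)) \<longlonglongrightarrow> 0"
proof -
  \<comment> \<open>The rate 1/8 leaves room for the weight 4^m: the weighted squares still sum like
    (1/2)^m, and finiteness of their sum at a point bounds the increment there by a multiple of
    2^(-m).\<close>
  obtain M where M: "\<And>m i j. i \<ge> M m \<Longrightarrow> j \<ge> M m \<Longrightarrow> sq_norm (\<lambda>x. u i x - u j x) \<le> ennreal ((1/8) ^ m)"
    using cauchy[of "(1/8) ^ m" for m] by (metis zero_less_power zero_less_divide_1_iff zero_less_numeral)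
  \<comment> \<open>Adding all thresholds up to \<open>m\<close> makes \<open>r\<close> increasing
    and at least \<open>M m\<close>; the summand \<open>m\<close> sends it to infinity.\<close>
  define r where "r m = m + (\<Sum>i\<le>m. M i)" for m
  have rM: "r m \<ge> M m" for m unfolding r_def by (rule trans_le_add2, rule member_le_sum) auto
  have rmono: "r m \<le> r (Suc m)" for m by (simp add: r_def)
  define w where "w m x = u (r (Suc m)) x - u (r m) x" for m x
  have [measurable]: "w m \<in> borel_measurable borel" for m unfolding w_def[abs_def] by measurable
  have "sq_norm (w m) \<le> ennreal ((1/8) ^ m)" for m
    unfolding w_def[abs_def] using rM[of m] rmono[of m] by (intro M) auto
  then have wb: "(\<integral>\<^sup>+x. ennreal (4 ^ m * (cmod (w m x))\<^sup>2) \<partial>lborel) \<le> ennreal ((1/2) ^ m)" for m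
  proof -
    have "(\<integral>\<^sup>+x. ennreal (4 ^ m * (cmod (w m x))\<^sup>2) \<partial>lborel) = ennreal (4 ^ m) * sq_norm (w m)"
      unfolding sq_norm_def by (subst nn_integral_cmult[symmetric]) (auto simp: ennreal_mult)
    also have "\<dots> \<le> ennreal (4 ^ m) * ennreal ((1/8) ^ m)" by (intro mult_left_mono) (auto simp: \<open>sq_norm (w m) \<le> _\<close>)
    also have "\<dots> = ennreal ((1/2) ^ m)" by (simp add: ennreal_mult[symmetric] power_mult_distrib[symmetric])
    finally show ?thesis .
  qed
  have "(\<integral>\<^sup>+x. (\<Sum>m. ennreal (4 ^ m * (cmod (w m x))\<^sup>2)) \<partial>lborel) = (\<Sum>m. \<integral>\<^sup>+x. ennreal (4 ^ m * (cmod (w m x))\<^sup>2) \<partial>lborel)"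
    by (rule nn_integral_suminf) measurable
  also have "\<dots> \<le> (\<Sum>m. ennreal ((1/2) ^ m))" by (intro suminf_le wb) auto
  also have "\<dots> < \<infinity>" by (subst suminf_ennreal2) (auto intro!: summable_geometric)
  finally have "AE x in lborel. (\<Sum>m. ennreal (4 ^ m * (cmod (w m x))\<^sup>2)) \<noteq> \<infinity>"
    by (intro nn_integral_PInf_AE) auto
  then have conv: "AE x in lborel. convergent (\<lambda>m. u (r m) x)"
  proof eventually_elim
    case (elim x)
    define C where "C = enn2real (\<Sum>m. ennreal (4 ^ m * (cmod (w m x))\<^sup>2))"
    have C: "C \<ge> 0" "(\<Sum>m. ennreal (4 ^ m * (cmod (w m x))\<^sup>2)) = ennreal C"
      unfolding C_def by (rule enn2real_nonneg) (use elim in \<open>simp only: infinity_ennreal_def ennreal_enn2real less_top\<close>)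
    have "4 ^ m * (cmod (w m x))\<^sup>2 \<le> C" for m
    proof -
      have "ennreal (4 ^ m * (cmod (w m x))\<^sup>2) \<le> ennreal C"
        using sum_le_suminf[of "\<lambda>m. ennreal (4 ^ m * (cmod (w m x))\<^sup>2)" "{m}"] C(2) by (simp add: summableI)
      then show ?thesis using C(1) by simp
    qed
    then have "(2 ^ m * cmod (w m x))\<^sup>2 \<le> C" for m
      by (simp add: power_mult_distrib power_mult[symmetric] mult.commute[of m 2]) (simp add: power_mult)
    then have "2 ^ m * cmod (w m x) \<le> sqrt C" for m by (rule real_le_rsqrt)
    then have "cmod (w m x) \<le> sqrt C * (1/2) ^ m" for m
      by (simp add: field_simps power_divide)
    then have "summable (\<lambda>m. w m x)"
      by (intro summable_comparison_test[OF _ summable_mult[OF summable_geometric[of "1/2::real"]]]) auto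
    then have "convergent (\<lambda>n. \<Sum>m<n. w m x)" by (simp add: summable_iff_convergent)
    also have "(\<lambda>n. \<Sum>m<n. w m x) = (\<lambda>n. u (r n) x - u (r 0) x)"
      unfolding w_def using sum_lessThan_telescope[of "\<lambda>m. u (r m) x"] by auto
    finally show ?case by (simp add: convergent_diff_const_right_iff)
  qed
  define g where "g x = lim (\<lambda>m. u (r m) x)" for x
  have [measurable]: "g \<in> borel_measurable borel" unfolding g_def[abs_def] by measurable
  have g: "AE x in lborel. (\<lambda>m. u (r m) x) \<longlonglongrightarrow> g x"
    using conv by eventually_elim (simp add: g_def convergent_LIMSEQ_iff)
  have "(\<lambda>n. sq_norm (\<lambda>x. g x - u n x)) \<longlonglongrightarrow> 0"
  proof (rule order_tendstoI)
    fix a :: ennreal assume "0 < a"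
    then obtain e where e: "e > 0" "ennreal e < a"
    proof -
      obtain b where b: "0 < b" "b < a" using dense[OF \<open>0 < a\<close>] by blast
      then have "b \<noteq> \<infinity>" by auto
      then obtain e where "e \<ge> 0" "b = ennreal e" by (cases b) auto
      with b show ?thesis by (intro that[of e]) auto
    qed
    from cauchy[OF e(1)] obtain N where N: "\<And>i j. i \<ge> N \<Longrightarrow> j \<ge> N \<Longrightarrow> sq_norm (\<lambda>x. u i x - u j x) \<le> ennreal e"
      by blast
    have "filterlim r at_top sequentially"
      by (rule filterlim_at_top_mono[OF filterlim_ident]) (auto simp: r_def)
    then have rN: "\<forall>\<^sub>F m in sequentially. r m \<ge> N" by (simp add: filterlim_at_top)
    \<comment> \<open>With n fixed, the Cauchy bound for the pair \<open>r m\<close>, n passes to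
      the limit in m.\<close>
    have "sq_norm (\<lambda>x. g x - u n x) \<le> ennreal e" if n: "n \<ge> N" for n
      unfolding sq_norm_def
    proof (rule nn_integral_limit_le)
      show "AE x in lborel. (\<lambda>m. ennreal ((cmod (u (r m) x - u n x))\<^sup>2)) \<longlonglongrightarrow> ennreal ((cmod (g x - u n x))\<^sup>2)"
        using g by eventually_elim (intro tendsto_intros tendsto_ennrealI)
      show "\<forall>\<^sub>F m in sequentially. (\<integral>\<^sup>+x. ennreal ((cmod (u (r m) x - u n x))\<^sup>2) \<partial>lborel) \<le> ennreal e"
        using rN by eventually_elim (use N[OF _ n] in \<open>auto simp: sq_norm_def\<close>)
    qed measurable
    then show "\<forall>\<^sub>F n in sequentially. sq_norm (\<lambda>x. g x - u n x) < a"
      unfolding eventually_sequentially using le_less_trans[OF _ e(2)] by blast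
  qed auto
  then show ?thesis by (intro exI[of _ g]) auto
qed

section \<open>The Fourier transform of square-integrable functions\<close>

text \<open>On a bounded window the positive and negative parts of \<open>D\<close> are densities of
  finite measures that agree on all half-lines, hence coincide. The densities then agree almost
  everywhere, which for a positive and a negative part means that both vanish.\<close>

lemma AE_zero_if_interval_integrals_zero_real:
  fixes D :: "real \<Rightarrow> real"
  assumes [measurable]: "D \<in> borel_measurable borel"
    and int: "\<And>a b. a < b \<Longrightarrow> integrable lborel (\<lambda>x. indicator {a<..b} x * D x)"
    and zero: "\<And>a b. a < b \<Longrightarrow> (LINT x|lborel. indicator {a<..b} x * D x) = 0"
  shows "AE x in lborel. D x = 0"
proof -
  have "AE x in lborel. \<bar>x\<bar> < real N \<longrightarrow> D x = 0" for N :: nat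
  proof -
    define p where "p x = indicator {-real N<..real N} x * max 0 (D x)" for x
    define q where "q x = indicator {-real N<..real N} x * max 0 (- D x)" for x
    have [measurable]: "p \<in> borel_measurable borel" "q \<in> borel_measurable borel"
      unfolding p_def[abs_def] q_def[abs_def] by measurable
    have nn: "p x \<ge> 0" "q x \<ge> 0" for x by (auto simp: p_def q_def)
    have pint: "integrable lborel p" and qint: "integrable lborel q"
    proof -
      have N: "integrable lborel (\<lambda>x. indicator {-real N<..real N} x * D x)"
        using int[of "-real N" "real N"] by (cases "N = 0") auto
      show "integrable lborel p" "integrable lborel q"
        by (rule Bochner_Integration.integrable_bound[OF N]; force simp: p_def q_def split: split_indicator)+
    qed
    have em: "emeasure (density lborel (\<lambda>x. ennreal (u x))) {a<..} = ennreal (LINT x|lborel. indicator {a<..} x * u x)"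
      if [measurable]: "integrable lborel u" and "\<And>x. u x \<ge> 0" for u and a :: real
    proof -
      have [measurable]: "u \<in> borel_measurable borel" using that by auto
      have "emeasure (density lborel (\<lambda>x. ennreal (u x))) {a<..} = (\<integral>\<^sup>+x. ennreal (indicator {a<..} x * u x) \<partial>lborel)"
        by (subst emeasure_density) (auto intro!: nn_integral_cong split: split_indicator)
      also have "\<dots> = ennreal (LINT x|lborel. indicator {a<..} x * u x)"
      proof (rule nn_integral_eq_integral)
        show "integrable lborel (\<lambda>x. indicator {a<..} x * u x)"
          by (rule Bochner_Integration.integrable_bound[OF that(1)]) (auto split: split_indicator)
      qed (use that in auto)
      finally show ?thesis .
    qed
    have eq: "(LINT x|lborel. indicator {a<..} x * p x) = (LINT x|lborel. indicator {a<..} x * q x)" for a :: real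
    proof -
      have i: "integrable lborel (\<lambda>x. indicator {a<..} x * p x)" "integrable lborel (\<lambda>x. indicator {a<..} x * q x)"
        by (rule Bochner_Integration.integrable_bound[OF pint], auto split: split_indicator)
           (rule Bochner_Integration.integrable_bound[OF qint], auto split: split_indicator)
      \<comment> \<open>The window cuts the half-line down to an interval, possibly empty, over
        which the integral of \<open>D\<close> is known.\<close>
      have "(LINT x|lborel. indicator {a<..} x * p x) - (LINT x|lborel. indicator {a<..} x * q x)
         = (LINT x|lborel. indicator {max a (-real N)<..real N} x * D x)"
        by (subst Bochner_Integration.integral_diff[symmetric, OF i])
           (auto intro!: Bochner_Integration.integral_cong simp: p_def q_def split: split_indicator)
      also have "\<dots> = 0"
      proof (cases "max a (-real N) < real N")
        case True then show ?thesis by (rule zero)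
      next
        case False then have "{max a (-real N)<..real N} = {}" by (intro greaterThanAtMost_empty leI)
        then show ?thesis by (simp only:) simp
      qed
      finally show ?thesis by simp
    qed
    have "density lborel (\<lambda>x. ennreal (p x)) = density lborel (\<lambda>x. ennreal (q x))"
    proof (rule measure_eqI_lessThan)
      show "emeasure (density lborel (\<lambda>x. ennreal (p x))) {x<..} < \<infinity>" for x
        by (subst em[OF pint nn(1)]) simp
      show "emeasure (density lborel (\<lambda>x. ennreal (p x))) {x<..} = emeasure (density lborel (\<lambda>x. ennreal (q x))) {x<..}" for x
        unfolding em[OF pint nn(1)] em[OF qint nn(2)] eq ..
    qed auto
    then have "AE x in lborel. ennreal (p x) = ennreal (q x)"
      by (subst (asm) sigma_finite_measure.density_unique_iff[OF sigma_finite_lborel]) auto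
    then show ?thesis
      by eventually_elim (auto simp: nn p_def q_def max_def split: split_indicator_asm if_splits)
  qed
  then have "AE x in lborel. \<forall>N::nat. \<bar>x\<bar> < real N \<longrightarrow> D x = 0"
    unfolding AE_all_countable by blast
  then show ?thesis
    by eventually_elim (meson reals_Archimedean2)
qed

lemma AE_zero_if_interval_integrals_zero:
  fixes D :: "real \<Rightarrow> complex"
  assumes [measurable]: "D \<in> borel_measurable borel"
    and int: "\<And>a b. a < b \<Longrightarrow> integrable lborel (\<lambda>x. indicator {a<..b} x *\<^sub>R D x)"
    and zero: "\<And>a b. a < b \<Longrightarrow> (LINT x|lborel. indicator {a<..b} x *\<^sub>R D x) = 0"
  shows "AE x in lborel. D x = 0"
proof -
  have "AE x in lborel. Re (D x) = 0"
  proof (rule AE_zero_if_interval_integrals_zero_real)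
    fix a b :: real assume ab: "a < b"
    have e: "(\<lambda>x. indicator {a<..b} x * Re (D x)) = (\<lambda>x. Re (indicator {a<..b} x *\<^sub>R D x))" by auto
    show "integrable lborel (\<lambda>x. indicator {a<..b} x * Re (D x))" unfolding e by (rule integrable_Re[OF int[OF ab]])
    show "(LINT x|lborel. indicator {a<..b} x * Re (D x)) = 0" unfolding e integral_Re[OF int[OF ab]] zero[OF ab] by simp
  qed measurable
  moreover have "AE x in lborel. Im (D x) = 0"
  proof (rule AE_zero_if_interval_integrals_zero_real)
    fix a b :: real assume ab: "a < b"
    have e: "(\<lambda>x. indicator {a<..b} x * Im (D x)) = (\<lambda>x. Im (indicator {a<..b} x *\<^sub>R D x))" by auto
    show "integrable lborel (\<lambda>x. indicator {a<..b} x * Im (D x))" unfolding e by (rule integrable_Im[OF int[OF ab]])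
    show "(LINT x|lborel. indicator {a<..b} x * Im (D x)) = 0" unfolding e integral_Im[OF int[OF ab]] zero[OF ab] by simp
  qed measurable
  ultimately show ?thesis by eventually_elim (simp add: complex_eq_iff)
qed

section \<open>Truncations and the L2 limit of their transforms\<close>

definition trunc :: "real \<Rightarrow> (real \<Rightarrow> complex) \<Rightarrow> real \<Rightarrow> complex" where
  "trunc R f x = indicator {-R..R} x *\<^sub>R f x"

lemma trunc_measurable [measurable]:
  "f \<in> borel_measurable borel \<Longrightarrow> trunc R f \<in> borel_measurable borel"
  unfolding trunc_def[abs_def] by measurable

text \<open>On a set of finite measure, |f| <= 1 + |f|^2 gives integrability; truncations of an L2
  function therefore have absolutely convergent transforms.\<close>

lemma integrable_indicator_mult_L2:
  assumes "L2_fun f" "A \<in> sets lborel" "emeasure lborel A < \<infinity>"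
  shows "integrable lborel (\<lambda>x. indicator A x *\<^sub>R f x)"
proof -
  have [measurable]: "f \<in> borel_measurable borel" "A \<in> sets borel" using assms by auto
  have "integrable lborel (\<lambda>x. indicator A x + (cmod (f x))\<^sup>2)"
    using assms by (intro Bochner_Integration.integrable_add) (auto simp: L2_fun_def)
  then show ?thesis
  proof (rule Bochner_Integration.integrable_bound)
    have "cmod (f x) \<le> 1 + (cmod (f x))\<^sup>2" for x
      using sum_squares_bound[of "cmod (f x)" 1] by (simp add: power2_eq_square) (smt (verit) zero_le_square)
    then show "AE x in lborel. norm (indicator A x *\<^sub>R f x) \<le> norm (indicator A x + (cmod (f x))\<^sup>2)"
      by (auto split: split_indicator)
  qed measurable
qed

lemma integrable_trunc: "L2_fun f \<Longrightarrow> integrable lborel (trunc R f)"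
  unfolding trunc_def[abs_def] by (rule integrable_indicator_mult_L2) (auto simp: emeasure_lborel_Icc_eq)

lemma ft_trunc: "ft (trunc R f) \<xi> = (LINT x:{-R..R}|lborel. exp (- \<i> * complex_of_real \<xi> * complex_of_real x) * f x)"
  unfolding ft_def trunc_def set_lebesgue_integral_def
  by (intro Bochner_Integration.integral_cong) auto

lemma is_fourier_transform_iff:
  "is_fourier_transform f g \<longleftrightarrow> L2_fun g \<and> ((\<lambda>R. sq_norm (\<lambda>\<xi>. g \<xi> - ft (trunc R f) \<xi>)) \<longlongrightarrow> 0) at_top"
  unfolding is_fourier_transform_def sq_norm_def ft_trunc ..

lemma sq_norm_tail:
  assumes "L2_fun f"
  shows "((\<lambda>R. sq_norm (\<lambda>x. f x - trunc R f x)) \<longlongrightarrow> 0) at_top"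
proof (rule tendsto_at_topI_sequentially)
  fix X :: "nat \<Rightarrow> real" assume X: "filterlim X at_top sequentially"
  have [measurable]: "f \<in> borel_measurable borel" using assms by measurable
  have "(\<lambda>n. \<integral>\<^sup>+x. ennreal ((cmod (f x - trunc (X n) f x))\<^sup>2) \<partial>lborel) \<longlonglongrightarrow> (\<integral>\<^sup>+(x::real). ennreal 0 \<partial>lborel)"
  proof (rule nn_integral_dominated_convergence[where w="\<lambda>x. ennreal ((cmod (f x))\<^sup>2)"])
    show "AE x in lborel. ennreal ((cmod (f x - trunc (X n) f x))\<^sup>2) \<le> ennreal ((cmod (f x))\<^sup>2)" for n
      by (auto simp: trunc_def split: split_indicator)
    show "(\<integral>\<^sup>+x. ennreal ((cmod (f x))\<^sup>2) \<partial>lborel) < \<infinity>"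
      using assms by (simp add: L2_fun_iff_sq_norm sq_norm_def)
    show "AE x in lborel. (\<lambda>n. ennreal ((cmod (f x - trunc (X n) f x))\<^sup>2)) \<longlonglongrightarrow> ennreal 0"
    proof (rule AE_I2)
      fix x
      have "\<forall>\<^sub>F n in sequentially. X n \<ge> \<bar>x\<bar>" using X by (simp add: filterlim_at_top)
      then have "\<forall>\<^sub>F n in sequentially. ennreal ((cmod (f x - trunc (X n) f x))\<^sup>2) = ennreal 0"
        by eventually_elim (auto simp: trunc_def split: split_indicator)
      then show "(\<lambda>n. ennreal ((cmod (f x - trunc (X n) f x))\<^sup>2)) \<longlonglongrightarrow> ennreal 0"
        by (rule tendsto_eventually)
    qed
  qed measurable
  then show "(\<lambda>n. sq_norm (\<lambda>x. f x - trunc (X n) f x)) \<longlonglongrightarrow> 0" by (simp add: sq_norm_def)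
qed

lemma ft_diff:
  "integrable lborel f \<Longrightarrow> integrable lborel g \<Longrightarrow> ft (\<lambda>x. f x - g x) \<xi> = ft f \<xi> - ft g \<xi>"
  unfolding ft_def by (simp only: right_diff_distrib Bochner_Integration.integral_diff[OF integrable_exp_mult integrable_exp_mult])

text \<open>Plancherel applied to the difference of two truncations: the tails of f control the
  transforms, so these form a Cauchy family.\<close>

lemma sq_norm_ft_trunc_diff_le:
  assumes f: "L2_fun f"
  shows "sq_norm (\<lambda>\<xi>. ft (trunc R f) \<xi> - ft (trunc R' f) \<xi>) \<le>
    ennreal (4 * pi) * (sq_norm (\<lambda>x. f x - trunc R f x) + sq_norm (\<lambda>x. f x - trunc R' f x))"
proof -
  have [measurable]: "f \<in> borel_measurable borel" using f by measurable
  have "sq_norm (\<lambda>\<xi>. ft (trunc R f) \<xi> - ft (trunc R' f) \<xi>) = sq_norm (ft (\<lambda>x. trunc R f x - trunc R' f x))"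
    by (simp add: ft_diff[OF integrable_trunc[OF f] integrable_trunc[OF f]] sq_norm_def)
  also have "\<dots> \<le> ennreal (2 * pi) * sq_norm (\<lambda>x. trunc R f x - trunc R' f x)"
    by (intro plancherel_le Bochner_Integration.integrable_diff integrable_trunc f)
  also have "\<dots> \<le> ennreal (2 * pi) * (2 * sq_norm (\<lambda>x. trunc R f x - f x) + 2 * sq_norm (\<lambda>x. f x - trunc R' f x))"
    by (intro mult_left_mono sq_norm_triangle) auto
  also have "\<dots> = ennreal (4 * pi) * (sq_norm (\<lambda>x. f x - trunc R f x) + sq_norm (\<lambda>x. f x - trunc R' f x))"
    unfolding sq_norm_minus_commute[of "trunc R f"] distrib_left[symmetric] mult.assoc[symmetric]
    by (simp add: ennreal_mult mult_ac distrib_left)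
  finally show ?thesis .
qed

text \<open>Integer truncations give a limit by completeness; the definition asks for convergence
  along real \<open>R\<close>, which follows by comparing an arbitrary truncation with the integer
  ones.\<close>

theorem fourier_transform_exists:
  assumes f: "L2_fun f"
  shows "\<exists>g. is_fourier_transform f g"
proof -
  have [measurable]: "f \<in> borel_measurable borel" using f by measurable
  let ?t = "\<lambda>R. sq_norm (\<lambda>x. f x - trunc R f x)"
  let ?u = "\<lambda>n. ft (trunc (real n) f)"
  have tn: "(\<lambda>n. ?t (real n)) \<longlonglongrightarrow> 0"
    by (rule filterlim_compose[OF sq_norm_tail[OF f] filterlim_real_sequentially])
  have "\<exists>g. g \<in> borel_measurable borel \<and> (\<lambda>n. sq_norm (\<lambda>\<xi>. g \<xi> - ?u n \<xi>)) \<longlonglongrightarrow> 0"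
  proof (rule L2_complete)
    fix e :: real assume "e > 0"
    \<comment> \<open>Two tails of this size, multiplied by the factor 4 pi, add up to
      \<open>e\<close>.\<close>
    then have "0 < ennreal (e / (8 * pi))" by simp
    from order_tendstoD(2)[OF tn this] obtain N where N: "\<And>n. n \<ge> N \<Longrightarrow> ?t (real n) < ennreal (e / (8 * pi))"
      by (auto simp: eventually_sequentially)
    have "sq_norm (\<lambda>\<xi>. ?u i \<xi> - ?u j \<xi>) \<le> ennreal e" if "i \<ge> N" "j \<ge> N" for i j
    proof -
      have "sq_norm (\<lambda>\<xi>. ?u i \<xi> - ?u j \<xi>) \<le> ennreal (4 * pi) * (ennreal (e / (8 * pi)) + ennreal (e / (8 * pi)))"
        using N[OF that(1)] N[OF that(2)]
        by (intro order_trans[OF sq_norm_ft_trunc_diff_le[OF f]] mult_left_mono add_mono) auto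
      also have "\<dots> = ennreal e"
        using \<open>e > 0\<close> by (subst ennreal_plus[symmetric]) (auto simp: ennreal_mult[symmetric])
      finally show ?thesis .
    qed
    then show "\<exists>N. \<forall>i\<ge>N. \<forall>j\<ge>N. sq_norm (\<lambda>\<xi>. ?u i \<xi> - ?u j \<xi>) \<le> ennreal e" by blast
  qed measurable
  then obtain g where [measurable]: "g \<in> borel_measurable borel" and g: "(\<lambda>n. sq_norm (\<lambda>\<xi>. g \<xi> - ?u n \<xi>)) \<longlonglongrightarrow> 0"
    by blast
  \<comment> \<open>The integer index goes to infinity while \<open>R\<close> stays fixed, leaving a
    bound by the tail at \<open>R\<close> alone.\<close>
  have le: "sq_norm (\<lambda>\<xi>. g \<xi> - ft (trunc R f) \<xi>) \<le> ennreal (8 * pi) * ?t R" for R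
  proof (rule LIMSEQ_le_const)
    have "(\<lambda>n. 2 * sq_norm (\<lambda>\<xi>. g \<xi> - ?u n \<xi>) + 2 * (ennreal (4 * pi) * (?t (real n) + ?t R))) \<longlonglongrightarrow>
       2 * 0 + 2 * (ennreal (4 * pi) * (0 + ?t R))"
      by (intro tendsto_intros tendsto_add ennreal_tendsto_cmult g tn) auto
    then show "(\<lambda>n. 2 * sq_norm (\<lambda>\<xi>. g \<xi> - ?u n \<xi>) + 2 * (ennreal (4 * pi) * (?t (real n) + ?t R))) \<longlonglongrightarrow>
       ennreal (8 * pi) * ?t R"
      by (simp add: mult.assoc[symmetric] ennreal_mult)
    have "sq_norm (\<lambda>\<xi>. g \<xi> - ft (trunc R f) \<xi>) \<le> 2 * sq_norm (\<lambda>\<xi>. g \<xi> - ?u n \<xi>) + 2 * (ennreal (4 * pi) * (?t (real n) + ?t R))" for n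
    proof -
      have "sq_norm (\<lambda>\<xi>. g \<xi> - ft (trunc R f) \<xi>) \<le> 2 * sq_norm (\<lambda>\<xi>. g \<xi> - ?u n \<xi>) + 2 * sq_norm (\<lambda>\<xi>. ?u n \<xi> - ft (trunc R f) \<xi>)"
        by (rule sq_norm_triangle) measurable
      also have "\<dots> \<le> 2 * sq_norm (\<lambda>\<xi>. g \<xi> - ?u n \<xi>) + 2 * (ennreal (4 * pi) * (?t (real n) + ?t R))"
        using sq_norm_ft_trunc_diff_le[OF f, of "real n" R] by (rule add_left_mono[OF mult_left_mono]) simp
      finally show ?thesis .
    qed
    then show "\<exists>N. \<forall>n\<ge>N. sq_norm (\<lambda>\<xi>. g \<xi> - ft (trunc R f) \<xi>) \<le> 2 * sq_norm (\<lambda>\<xi>. g \<xi> - ?u n \<xi>) + 2 * (ennreal (4 * pi) * (?t (real n) + ?t R))"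
      by blast
  qed
  have lim: "((\<lambda>R. sq_norm (\<lambda>\<xi>. g \<xi> - ft (trunc R f) \<xi>)) \<longlongrightarrow> 0) at_top"
  proof (rule tendsto_sandwich[OF _ _ tendsto_const])
    have "((\<lambda>R. ennreal (8 * pi) * ?t R) \<longlongrightarrow> ennreal (8 * pi) * 0) at_top"
      by (intro ennreal_tendsto_cmult sq_norm_tail f) auto
    then show "((\<lambda>R. ennreal (8 * pi) * ?t R) \<longlongrightarrow> 0) at_top" by simp
  qed (use le in auto)
  \<comment> \<open>Comparison with any single truncated transform suffices; R = 0 is taken.\<close>
  have "sq_norm g < \<infinity>"
  proof -
    have "sq_norm g \<le> 2 * sq_norm (\<lambda>\<xi>. g \<xi> - ft (trunc 0 f) \<xi>) + 2 * sq_norm (ft (trunc 0 f))"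
      using sq_norm_add_le[of "\<lambda>\<xi>. g \<xi> - ft (trunc 0 f) \<xi>" "ft (trunc 0 f)"] by simp
    also have "\<dots> < \<infinity>"
    proof -
      have "?t 0 \<le> sq_norm f" unfolding sq_norm_def
        by (intro nn_integral_mono) (auto simp: trunc_def split: split_indicator)
      then have "?t 0 < \<infinity>" using f by (auto simp: L2_fun_iff_sq_norm)
      then have 1: "sq_norm (\<lambda>\<xi>. g \<xi> - ft (trunc 0 f) \<xi>) < \<infinity>"
        by (intro le_less_trans[OF le]) (auto simp: ennreal_mult_less_top)
      have "sq_norm (trunc 0 f) \<le> sq_norm f" unfolding sq_norm_def
        by (intro nn_integral_mono) (auto simp: trunc_def split: split_indicator)
      then have "sq_norm (trunc 0 f) < \<infinity>" using f by (auto simp: L2_fun_iff_sq_norm)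
      then have "sq_norm (ft (trunc 0 f)) < \<infinity>"
        by (intro le_less_trans[OF plancherel_le[OF integrable_trunc[OF f]]]) (auto simp: ennreal_mult_less_top)
      with 1 show ?thesis by (auto simp: ennreal_mult_less_top)
    qed
    finally show ?thesis .
  qed
  with lim show ?thesis
    by (intro exI[of _ g]) (auto simp: is_fourier_transform_iff L2_fun_iff_sq_norm)
qed

lemma is_fourier_transform_fourier_L2: "L2_fun f \<Longrightarrow> is_fourier_transform f (fourier_L2 f)"
  unfolding fourier_L2_def by (rule someI_ex[OF fourier_transform_exists])

lemma is_fourier_transform_seq:
  "is_fourier_transform f g \<Longrightarrow> (\<lambda>n. sq_norm (\<lambda>\<xi>. g \<xi> - ft (trunc (real n) f) \<xi>)) \<longlonglongrightarrow> 0"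
  unfolding is_fourier_transform_iff using filterlim_compose[OF _ filterlim_real_sequentially] by blast

lemma is_fourier_transform_L2 [dest]: "is_fourier_transform f g \<Longrightarrow> L2_fun g"
  by (simp add: is_fourier_transform_def)

text \<open>It identifies the arbitrary choice made by \<open>fourier_L2\<close> with a transform
  found by other means.\<close>

lemma is_fourier_transform_unique:
  assumes [measurable]: "f \<in> borel_measurable borel" and g: "is_fourier_transform f g" and h: "is_fourier_transform f h"
  shows "AE \<xi> in lborel. g \<xi> = h \<xi>"
proof (rule AE_eq_if_sq_norm_eq_0)
  show [measurable]: "g \<in> borel_measurable borel" "h \<in> borel_measurable borel"
    using g h by (auto dest!: is_fourier_transform_L2)
  let ?u = "\<lambda>n. ft (trunc (real n) f)"
  have "sq_norm (\<lambda>\<xi>. g \<xi> - h \<xi>) \<le> 2 * 0 + 2 * 0"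
  proof (rule LIMSEQ_le_const)
    show "(\<lambda>n. 2 * sq_norm (\<lambda>\<xi>. g \<xi> - ?u n \<xi>) + 2 * sq_norm (\<lambda>\<xi>. h \<xi> - ?u n \<xi>)) \<longlonglongrightarrow> 2 * 0 + 2 * 0"
      by (intro tendsto_intros tendsto_add ennreal_tendsto_cmult is_fourier_transform_seq g h) auto
    show "\<exists>N. \<forall>n\<ge>N. sq_norm (\<lambda>\<xi>. g \<xi> - h \<xi>) \<le> 2 * sq_norm (\<lambda>\<xi>. g \<xi> - ?u n \<xi>) + 2 * sq_norm (\<lambda>\<xi>. h \<xi> - ?u n \<xi>)"
      using sq_norm_triangle[of g "?u n" h for n] unfolding sq_norm_minus_commute[of h] by auto
  qed
  then show "sq_norm (\<lambda>\<xi>. g \<xi> - h \<xi>) = 0" by simp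
qed

lemma is_fourier_transform_cong_AE:
  assumes g: "is_fourier_transform f g" and [measurable]: "h \<in> borel_measurable borel" and eq: "AE \<xi> in lborel. g \<xi> = h \<xi>"
  shows "is_fourier_transform f h"
proof -
  have 1: "sq_norm g = sq_norm h" by (rule sq_norm_cong_AE[OF eq])
  have 2: "sq_norm (\<lambda>\<xi>. g \<xi> - ft (trunc R f) \<xi>) = sq_norm (\<lambda>\<xi>. h \<xi> - ft (trunc R f) \<xi>)" for R
    using eq by (intro sq_norm_cong_AE) auto
  show ?thesis using g unfolding is_fourier_transform_iff 2 L2_fun_iff_sq_norm 1 by auto
qed

text \<open>Fatou's lemma along an almost everywhere convergent subsequence of the truncated
  transforms, each bounded by \<open>plancherel_le\<close>.\<close>

lemma sq_norm_fourier_transform_le: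
  assumes f: "L2_fun f" and g: "is_fourier_transform f g"
  shows "sq_norm g \<le> ennreal (2 * pi) * sq_norm f"
proof -
  have [measurable]: "f \<in> borel_measurable borel" "g \<in> borel_measurable borel" using f g by (auto dest!: is_fourier_transform_L2)
  obtain r :: "nat \<Rightarrow> nat" where r: "AE \<xi> in lborel. (\<lambda>n. ft (trunc (real (r n)) f) \<xi>) \<longlonglongrightarrow> g \<xi>"
    using sq_norm_tendsto_imp_AE_subseq[OF _ _ is_fourier_transform_seq[OF g]] by auto
  show ?thesis unfolding sq_norm_def[of g]
  proof (rule nn_integral_limit_le)
    show "AE \<xi> in lborel. (\<lambda>n. ennreal ((cmod (ft (trunc (real (r n)) f) \<xi>))\<^sup>2)) \<longlonglongrightarrow> ennreal ((cmod (g \<xi>))\<^sup>2)"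
      using r by eventually_elim (intro tendsto_intros tendsto_ennrealI)
    have "sq_norm (ft (trunc (real (r n)) f)) \<le> ennreal (2 * pi) * sq_norm f" for n
    proof -
      have "sq_norm (trunc (real (r n)) f) \<le> sq_norm f" unfolding sq_norm_def
        by (intro nn_integral_mono) (auto simp: trunc_def split: split_indicator)
      then show ?thesis
        by (intro order_trans[OF plancherel_le[OF integrable_trunc[OF f]]] mult_left_mono) auto
    qed
    then show "\<forall>\<^sub>F n in sequentially. (\<integral>\<^sup>+\<xi>. ennreal ((cmod (ft (trunc (real (r n)) f) \<xi>))\<^sup>2) \<partial>lborel) \<le> ennreal (2 * pi) * sq_norm f"
      by (auto simp: sq_norm_def)
  qed measurable
qed

lemma is_fourier_transform_diff:
  assumes f: "L2_fun f" "is_fourier_transform f g" and f': "L2_fun f'" "is_fourier_transform f' g'"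
  shows "is_fourier_transform (\<lambda>x. f x - f' x) (\<lambda>\<xi>. g \<xi> - g' \<xi>)"
  unfolding is_fourier_transform_iff
proof (intro conjI L2_fun_diff)
  show "L2_fun g" "L2_fun g'" using f f' by auto
  have [measurable]: "f \<in> borel_measurable borel" "g \<in> borel_measurable borel"
     "f' \<in> borel_measurable borel" "g' \<in> borel_measurable borel" using f f' by (auto dest!: is_fourier_transform_L2)
  have tr: "trunc R (\<lambda>x. f x - f' x) = (\<lambda>x. trunc R f x - trunc R f' x)" for R
    by (auto simp: trunc_def scaleR_diff_right)
  have le: "sq_norm (\<lambda>\<xi>. g \<xi> - g' \<xi> - ft (trunc R (\<lambda>x. f x - f' x)) \<xi>) \<le>
     2 * sq_norm (\<lambda>\<xi>. g \<xi> - ft (trunc R f) \<xi>) + 2 * sq_norm (\<lambda>\<xi>. g' \<xi> - ft (trunc R f') \<xi>)" for R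
    using sq_norm_add_le[of "\<lambda>\<xi>. g \<xi> - ft (trunc R f) \<xi>" "\<lambda>\<xi>. ft (trunc R f') \<xi> - g' \<xi>"]
    unfolding sq_norm_minus_commute[of g'] tr
    by (simp add: ft_diff[OF integrable_trunc[OF f(1)] integrable_trunc[OF f'(1)]] algebra_simps)
  show "((\<lambda>R. sq_norm (\<lambda>\<xi>. g \<xi> - g' \<xi> - ft (trunc R (\<lambda>x. f x - f' x)) \<xi>)) \<longlongrightarrow> 0) at_top"
  proof (rule tendsto_sandwich[OF _ _ tendsto_const])
    have "((\<lambda>R. 2 * sq_norm (\<lambda>\<xi>. g \<xi> - ft (trunc R f) \<xi>) + 2 * sq_norm (\<lambda>\<xi>. g' \<xi> - ft (trunc R f') \<xi>)) \<longlongrightarrow> 2 * 0 + 2 * 0) at_top"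
      using f(2) f'(2) unfolding is_fourier_transform_iff
      by (intro tendsto_add ennreal_tendsto_cmult) auto
    then show "((\<lambda>R. 2 * sq_norm (\<lambda>\<xi>. g \<xi> - ft (trunc R f) \<xi>) + 2 * sq_norm (\<lambda>\<xi>. g' \<xi> - ft (trunc R f') \<xi>)) \<longlongrightarrow> 0) at_top"
      by simp
  qed (use le in auto)
qed

section \<open>Fourier inversion\<close>

text \<open>The Dirichlet kernel 2 sin(R c)/c; \<open>sinc\<close> absorbs the removable singularity
  at c = 0.\<close>

lemma set_integral_exp_symmetric:
  fixes c R :: real
  assumes "R \<ge> 0"
  shows "(LINT x|lborel. indicator {-R..R} x *\<^sub>R exp (\<i> * complex_of_real c * complex_of_real x)) = complex_of_real (2 * R * sinc (R * c))"
proof (cases "c = 0")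
  case True
  then show ?thesis using assms by (simp add: emeasure_lborel_Icc_eq measure_def scaleR_conv_of_real)
next
  case False
  have "(LINT x|lborel. indicator {-R..R} x *\<^sub>R exp (\<i> * complex_of_real c * complex_of_real x)) =
     exp (\<i> * complex_of_real c * complex_of_real R) / (\<i> * complex_of_real c) - exp (\<i> * complex_of_real c * complex_of_real (-R)) / (\<i> * complex_of_real c)"
  proof (rule integral_FTC_atLeastAtMost)
    show "((\<lambda>x. exp (\<i> * complex_of_real c * complex_of_real x) / (\<i> * complex_of_real c)) has_vector_derivative exp (\<i> * complex_of_real c * complex_of_real x)) (at x within {-R..R})" for x
      using False by (auto intro!: derivative_eq_intros has_vector_derivative_real_field simp: field_simps)
  qed (use assms in \<open>auto intro!: continuous_intros\<close>)
  also have "\<dots> = complex_of_real (2 * sin (R * c) / c)"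
    using False by (simp add: complex_eq_iff Re_divide Im_divide Re_exp Im_exp power2_eq_square field_simps)
  also have "\<dots> = complex_of_real (2 * R * sinc (R * c))"
    using False by simp
  finally show ?thesis .
qed

text \<open>The sine integral is odd and tends to pi/2, so scaling its argument turns it into a
  step. The difference of two such steps, divided by pi, is the indicator of an interval off its
  endpoints.\<close>

lemma tendsto_Si_scaled:
  "(\<lambda>n. Si (real n * c)) \<longlonglongrightarrow> pi / 2 * sgn c"
proof (cases "c > 0" "c = 0" rule: bool.exhaust[case_product bool.exhaust])
  case True_True then show ?thesis by simp
next
  case True_False
  have "filterlim (\<lambda>n. real n * c) at_top sequentially"
    using True_False by (intro filterlim_at_top_mult_tendsto_pos[OF tendsto_const] filterlim_real_sequentially) auto
  from filterlim_compose[OF Si_at_top this] show ?thesis using True_False by simp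
next
  case False_True then show ?thesis by (simp add: Si_def zero_ereal_def)
next
  case False_False
  then have c: "- c > 0" by auto
  have "filterlim (\<lambda>n. real n * - c) at_top sequentially"
    using c by (intro filterlim_at_top_mult_tendsto_pos[OF tendsto_const] filterlim_real_sequentially) auto
  from filterlim_compose[OF Si_at_top this] have "(\<lambda>n. Si (real n * - c)) \<longlonglongrightarrow> pi / 2" .
  moreover have "Si (real n * - c) = - Si (real n * c)" for n
  proof -
    have "Si (- (real n * - c)) = - Si (real n * - c)" using c by (intro Si_neg mult_nonneg_nonneg) auto
    then show ?thesis by simp
  qed
  ultimately have "(\<lambda>n. - (- Si (real n * c))) \<longlonglongrightarrow> - (pi / 2)" by (intro tendsto_minus) simp
  then show ?thesis using c by simp
qed

lemma nn_integral_mult_power2_le: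
  assumes [measurable]: "f \<in> borel_measurable borel" "g \<in> borel_measurable borel"
  shows "(\<integral>\<^sup>+x. ennreal (cmod (f x * g x)) \<partial>lborel)\<^sup>2 \<le> sq_norm f * sq_norm g"
  using Cauchy_Schwarz_nn_integral[of "\<lambda>x. ennreal (cmod (f x))" lborel "\<lambda>x. ennreal (cmod (g x))"]
  by (simp add: sq_norm_def norm_mult ennreal_mult ennreal_power)

lemma integrable_mult_L2:
  assumes f: "L2_fun f" and g: "L2_fun g"
  shows "integrable lborel (\<lambda>x. f x * g x)"
proof (rule integrableI_bounded)
  have [measurable]: "f \<in> borel_measurable borel" "g \<in> borel_measurable borel" using f g by auto
  show "(\<lambda>x. f x * g x) \<in> borel_measurable lborel" by measurable
  have "(\<integral>\<^sup>+x. ennreal (cmod (f x * g x)) \<partial>lborel)\<^sup>2 \<le> sq_norm f * sq_norm g"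
    by (rule nn_integral_mult_power2_le) measurable
  also have "\<dots> < \<infinity>" using f g by (auto simp: L2_fun_iff_sq_norm ennreal_mult_less_top)
  finally show "(\<integral>\<^sup>+x. ennreal (cmod (f x * g x)) \<partial>lborel) < \<infinity>"
    by (simp add: power_less_top_ennreal)
qed

text \<open>Cauchy-Schwarz: L2 convergence may be tested against a fixed L2 function. Indicators of
  intervals, the Cauchy kernel and the one-sided exponentials serve as that function below.\<close>

lemma tendsto_integral_mult_L2:
  assumes u: "\<And>n. L2_fun (u n)" and v: "L2_fun v" and g: "L2_fun g"
    and lim: "(\<lambda>n. sq_norm (\<lambda>x. v x - u n x)) \<longlonglongrightarrow> 0"
  shows "(\<lambda>n. LINT x|lborel. u n x * g x) \<longlonglongrightarrow> (LINT x|lborel. v x * g x)"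
proof -
  have [measurable]: "u n \<in> borel_measurable borel" "v \<in> borel_measurable borel" "g \<in> borel_measurable borel" for n
    using u v g by auto
  have le: "ennreal ((cmod ((LINT x|lborel. u n x * g x) - (LINT x|lborel. v x * g x)))\<^sup>2) \<le> sq_norm g * sq_norm (\<lambda>x. v x - u n x)" for n
  proof -
    have "(LINT x|lborel. u n x * g x) - (LINT x|lborel. v x * g x) = - (LINT x|lborel. (v x - u n x) * g x)"
      by (simp add: left_diff_distrib Bochner_Integration.integral_diff[OF integrable_mult_L2[OF v g] integrable_mult_L2[OF u g]])
    then have "ennreal (cmod ((LINT x|lborel. u n x * g x) - (LINT x|lborel. v x * g x))) \<le> (\<integral>\<^sup>+x. ennreal (cmod ((v x - u n x) * g x)) \<partial>lborel)"
      using norm_integral_le_nn_integral[of lborel "\<lambda>x. (v x - u n x) * g x"] by simp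
    then have "(ennreal (cmod ((LINT x|lborel. u n x * g x) - (LINT x|lborel. v x * g x))))\<^sup>2 \<le> (\<integral>\<^sup>+x. ennreal (cmod ((v x - u n x) * g x)) \<partial>lborel)\<^sup>2"
      by (rule power_mono) simp
    also have "\<dots> \<le> sq_norm (\<lambda>x. v x - u n x) * sq_norm g"
      by (rule nn_integral_mult_power2_le) measurable
    finally show ?thesis by (simp add: ennreal_power mult.commute[of "sq_norm g"])
  qed
  have "(\<lambda>n. sq_norm g * sq_norm (\<lambda>x. v x - u n x)) \<longlonglongrightarrow> sq_norm g * 0"
    using g lim by (intro ennreal_tendsto_cmult) (auto simp: L2_fun_iff_sq_norm)
  then have lim0: "(\<lambda>n. sq_norm g * sq_norm (\<lambda>x. v x - u n x)) \<longlonglongrightarrow> 0"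
    by (simp only: mult_zero_right)
  have "(\<lambda>n. ennreal ((cmod ((LINT x|lborel. u n x * g x) - (LINT x|lborel. v x * g x)))\<^sup>2)) \<longlonglongrightarrow> 0"
    by (rule tendsto_sandwich[OF _ _ tendsto_const lim0]) (use le in \<open>auto intro!: always_eventually\<close>)
  then have "(\<lambda>n. (cmod ((LINT x|lborel. u n x * g x) - (LINT x|lborel. v x * g x)))\<^sup>2) \<longlonglongrightarrow> 0"
    by (subst (asm) ennreal_tendsto_0_iff) auto
  from tendsto_real_sqrt[OF this] have "(\<lambda>n. cmod ((LINT x|lborel. u n x * g x) - (LINT x|lborel. v x * g x))) \<longlonglongrightarrow> 0"
    by simp
  then show ?thesis by (rule LIM_zero_cancel[OF tendsto_norm_zero_cancel])
qed

lemma L2_fun_ft_trunc: "L2_fun f \<Longrightarrow> L2_fun (ft (trunc R f))"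
proof -
  assume f: "L2_fun f"
  have "sq_norm (trunc R f) \<le> sq_norm f" unfolding sq_norm_def
    by (intro nn_integral_mono) (auto simp: trunc_def split: split_indicator)
  then have "sq_norm (trunc R f) < \<infinity>" using f by (auto simp: L2_fun_iff_sq_norm)
  then have "sq_norm (ft (trunc R f)) < \<infinity>"
    by (intro le_less_trans[OF plancherel_le[OF integrable_trunc[OF f]]]) (auto simp: ennreal_mult_less_top)
  then show ?thesis using f by (auto simp: L2_fun_iff_sq_norm)
qed

lemma L2_fun_indicator: "A \<in> sets lborel \<Longrightarrow> emeasure lborel A < \<infinity> \<Longrightarrow> L2_fun (\<lambda>x. complex_of_real (indicator A x))"
  unfolding L2_fun_def by (auto simp flip: indicator_inter_arith simp: power2_eq_square)

text \<open>The inverse transform as an absolutely convergent integral, which suffices because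
  transforms of H1 functions are integrable.\<close>

definition inv_ft :: "(real \<Rightarrow> complex) \<Rightarrow> real \<Rightarrow> complex" where
  "inv_ft G x = 1 / (2 * complex_of_real pi) * (LINT \<eta>|lborel. exp (\<i> * complex_of_real \<eta> * complex_of_real x) * G \<eta>)"

lemma inv_ft_eq_ft: "inv_ft G x = 1 / (2 * complex_of_real pi) * ft G (- x)"
  by (simp add: inv_ft_def ft_def mult_ac)

lemma inv_ft_measurable [measurable]:
  assumes [measurable]: "G \<in> borel_measurable borel"
  shows "inv_ft G \<in> borel_measurable borel"
  unfolding inv_ft_def[abs_def] by measurable

text \<open>The squared prefactor times the Plancherel constant is (1/(2 pi))^2 times 2 pi, the
  reciprocal of the constant in \<open>plancherel_le\<close>.\<close>

lemma sq_norm_inv_ft_le: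
  assumes G: "integrable lborel G"
  shows "sq_norm (inv_ft G) \<le> ennreal (1 / (2 * pi)) * sq_norm G"
proof -
  have [measurable]: "G \<in> borel_measurable borel" using G by auto
  have "sq_norm (inv_ft G) = (\<integral>\<^sup>+x. ennreal ((1 / (2 * pi))\<^sup>2) * ennreal ((cmod (ft G (- x)))\<^sup>2) \<partial>lborel)"
    unfolding sq_norm_def inv_ft_eq_ft by (simp add: norm_mult norm_divide ennreal_mult[symmetric] power_mult_distrib power_divide)
  also have "\<dots> = ennreal ((1 / (2 * pi))\<^sup>2) * (\<integral>\<^sup>+x. ennreal ((cmod (ft G (- x)))\<^sup>2) \<partial>lborel)"
    by (rule nn_integral_cmult) measurable
  also have "(\<integral>\<^sup>+x. ennreal ((cmod (ft G (- x)))\<^sup>2) \<partial>lborel) = sq_norm (ft G)"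
    using nn_integral_real_affine[of "\<lambda>x. ennreal ((cmod (ft G x))\<^sup>2)" "-1" 0] by (simp add: sq_norm_def)
  also have "ennreal ((1 / (2 * pi))\<^sup>2) * sq_norm (ft G) \<le> ennreal ((1 / (2 * pi))\<^sup>2) * (ennreal (2 * pi) * sq_norm G)"
    by (intro mult_left_mono plancherel_le G) simp
  also have "\<dots> = ennreal (1 / (2 * pi)) * sq_norm G"
    by (simp add: mult.assoc[symmetric] ennreal_mult[symmetric] power2_eq_square del: ennreal_numeral)
  finally show ?thesis .
qed

lemma L2_fun_inv_ft: "integrable lborel G \<Longrightarrow> L2_fun G \<Longrightarrow> L2_fun (inv_ft G)"
  using sq_norm_inv_ft_le[of G] unfolding L2_fun_iff_sq_norm
  by (auto intro: le_less_trans simp: ennreal_mult_less_top)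

text \<open>Truncation to \<open>[-n, n]\<close> amounts to convolution with the Dirichlet kernel, whose integral over
  an interval is a difference of values of the sine integral.\<close>

lemma interval_integral_ft_trunc_inv_ft:
  assumes G: "integrable lborel G" and ab: "a < b"
  shows "(LINT \<xi>|lborel. indicator {a<..b} \<xi> *\<^sub>R ft (trunc (real n) (inv_ft G)) \<xi>) =
    (LINT \<eta>|lborel. complex_of_real ((Si (real n * (\<eta> - a)) - Si (real n * (\<eta> - b))) / pi) * G \<eta>)"
proof -
  have [measurable]: "G \<in> borel_measurable borel" using G by auto
  define h where "h = inv_ft G"
  have [measurable]: "h \<in> borel_measurable borel" unfolding h_def by measurable
  let ?R = "real n"
  let ?B = "(LINT x|lborel. cmod (G x)) / (2 * pi)"
  have hB: "cmod (h x) \<le> ?B" for x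
    using norm_ft_le[OF G, of "-x"] by (simp add: h_def inv_ft_eq_ft norm_mult norm_divide divide_right_mono)
  have inab: "integrable lborel (indicator {a<..b} :: real \<Rightarrow> real)"
    using ab by (simp add: emeasure_lborel_Ioc)
  have inR: "integrable lborel (\<lambda>x. indicator {-?R..?R} x * c :: real)" for c
    by (simp add: emeasure_lborel_Icc_eq)
  define e where "e t = exp (\<i> * complex_of_real t)" for t
  have [measurable]: "e \<in> borel_measurable borel" unfolding e_def[abs_def] by measurable
  have ne [simp]: "cmod (e t) = 1" for t by (simp add: e_def norm_exp_eq_Re)
  have e_add: "e (s + t) = e s * e t" for s t by (simp add: e_def exp_add[symmetric] algebra_simps)
  have ft_e: "ft f \<xi> = (LINT x|lborel. e (- (\<xi> * x)) * f x)" for f \<xi> by (simp add: ft_def e_def mult.assoc)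
  have "(LINT \<xi>|lborel. indicator {a<..b} \<xi> *\<^sub>R ft (trunc ?R h) \<xi>) =
    (LINT \<xi>|lborel. LINT x|lborel. indicator {a<..b} \<xi> *\<^sub>R (e (- (\<xi> * x)) * trunc ?R h x))"
    unfolding ft_e by simp
  \<comment> \<open>Both variables range over bounded intervals here, and \<open>h\<close> is
    bounded.\<close>
  also have "\<dots> = (LINT x|lborel. LINT \<xi>|lborel. indicator {a<..b} \<xi> *\<^sub>R (e (- (\<xi> * x)) * trunc ?R h x))"
  proof (rule lborel_pair.Fubini_integral[symmetric])
    show "integrable (lborel \<Otimes>\<^sub>M lborel) (\<lambda>(\<xi>, x). indicator {a<..b} \<xi> *\<^sub>R (e (- (\<xi> * x)) * trunc ?R h x))"
      by (rule integrable_lborel_pair_bound[OF inab inR[of ?B]])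
         (measurable, auto simp: norm_mult trunc_def hB split: split_indicator)
  qed
  also have "\<dots> = (LINT x|lborel. LINT \<eta>|lborel. 1 / (2 * complex_of_real pi) * (e (\<eta> * x) * G \<eta> * (indicator {-?R..?R} x *\<^sub>R (LINT \<xi>|lborel. indicator {a<..b} \<xi> *\<^sub>R e (- (\<xi> * x))))))"
  proof (rule Bochner_Integration.integral_cong[OF refl])
    fix x
    have "(LINT \<xi>|lborel. indicator {a<..b} \<xi> *\<^sub>R (e (- (\<xi> * x)) * trunc ?R h x)) =
      (LINT \<xi>|lborel. (indicator {a<..b} \<xi> *\<^sub>R e (- (\<xi> * x))) * trunc ?R h x)" by simp
    also have "\<dots> = (LINT \<xi>|lborel. indicator {a<..b} \<xi> *\<^sub>R e (- (\<xi> * x))) * trunc ?R h x"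
      by (rule integral_mult_left_zero)
    moreover have "trunc ?R h x = indicator {-?R..?R} x *\<^sub>R (1 / (2 * complex_of_real pi) * (LINT \<eta>|lborel. e (\<eta> * x) * G \<eta>))"
      by (simp add: trunc_def h_def inv_ft_def e_def mult_ac)
    ultimately show "(LINT \<xi>|lborel. indicator {a<..b} \<xi> *\<^sub>R (e (- (\<xi> * x)) * trunc ?R h x)) =
      (LINT \<eta>|lborel. 1 / (2 * complex_of_real pi) * (e (\<eta> * x) * G \<eta> * (indicator {-?R..?R} x *\<^sub>R (LINT \<xi>|lborel. indicator {a<..b} \<xi> *\<^sub>R e (- (\<xi> * x))))))"
      unfolding integral_mult_right_zero integral_mult_left_zero by (simp only: scaleR_conv_of_real mult_ac)
  qed
  \<comment> \<open>Now x is confined to [-n, n] and \<open>G\<close> supplies integrability in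
    \<eta>; with the \<eta> integral outside, the Dirichlet kernel is left inside.\<close>
  also have "\<dots> = (LINT \<eta>|lborel. LINT x|lborel. 1 / (2 * complex_of_real pi) * (e (\<eta> * x) * G \<eta> * (indicator {-?R..?R} x *\<^sub>R (LINT \<xi>|lborel. indicator {a<..b} \<xi> *\<^sub>R e (- (\<xi> * x))))))"
  proof (rule lborel_pair.Fubini_integral[symmetric])
    have E: "cmod (LINT \<xi>|lborel. indicator {a<..b} \<xi> *\<^sub>R e (- (\<xi> * x))) \<le> b - a" for x
    proof -
      have "cmod (LINT \<xi>|lborel. indicator {a<..b} \<xi> *\<^sub>R e (- (\<xi> * x))) \<le> (LINT \<xi>|lborel. cmod (indicator {a<..b} \<xi> *\<^sub>R e (- (\<xi> * x))))"
        by (rule integral_norm_bound)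
      then show ?thesis using ab by (simp add: measure_def emeasure_lborel_Ioc)
    qed
    define EE where "EE x = (LINT \<xi>|lborel. indicator {a<..b} \<xi> *\<^sub>R e (- (\<xi> * x)))" for x
    have [measurable]: "EE \<in> borel_measurable borel" unfolding EE_def[abs_def] by measurable
    have le: "cmod (1 / (2 * complex_of_real pi) * (e (\<eta> * x) * G \<eta> * (indicator {-?R..?R} x *\<^sub>R EE x))) \<le>
       indicator {-?R..?R} x * ((b - a) / (2 * pi)) * cmod (G \<eta>)" for x \<eta>
    proof (cases "x \<in> {-?R..?R}")
      case True
      have "cmod (EE x) * cmod (G \<eta>) \<le> (b - a) * cmod (G \<eta>)"
        using E[of x] by (intro mult_right_mono) (auto simp: EE_def)
      then show ?thesis using True by (simp add: norm_mult norm_divide divide_right_mono mult.commute)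
    qed simp
    show "integrable (lborel \<Otimes>\<^sub>M lborel) (\<lambda>(x, \<eta>). 1 / (2 * complex_of_real pi) * (e (\<eta> * x) * G \<eta> * (indicator {-?R..?R} x *\<^sub>R (LINT \<xi>|lborel. indicator {a<..b} \<xi> *\<^sub>R e (- (\<xi> * x))))))"
      unfolding EE_def[symmetric]
      by (rule integrable_lborel_pair_bound[OF inR[of "(b - a) / (2 * pi)"] integrable_norm[OF G]])
         (measurable, simp only: prod.case le)
  qed
  also have "\<dots> = (LINT \<eta>|lborel. complex_of_real ((Si (?R * (\<eta> - a)) - Si (?R * (\<eta> - b))) / pi) * G \<eta>)"
  proof (rule Bochner_Integration.integral_cong[OF refl])
    fix \<eta>
    have "(LINT x|lborel. e (\<eta> * x) * (indicator {-?R..?R} x *\<^sub>R (LINT \<xi>|lborel. indicator {a<..b} \<xi> *\<^sub>R e (- (\<xi> * x)))))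
       = (LINT x|lborel. LINT \<xi>|lborel. indicator {-?R..?R} x *\<^sub>R indicator {a<..b} \<xi> *\<^sub>R e ((\<eta> - \<xi>) * x))"
    proof (rule Bochner_Integration.integral_cong[OF refl])
      fix x
      have "e ((\<eta> - \<xi>) * x) = e (\<eta> * x) * e (- (\<xi> * x))" for \<xi>
        unfolding e_add[symmetric] by (simp add: left_diff_distrib)
      then have "(LINT \<xi>|lborel. indicator {-?R..?R} x *\<^sub>R indicator {a<..b} \<xi> *\<^sub>R e ((\<eta> - \<xi>) * x)) =
        (LINT \<xi>|lborel. (e (\<eta> * x) * complex_of_real (indicator {-?R..?R} x)) * (indicator {a<..b} \<xi> *\<^sub>R e (- (\<xi> * x))))"
        by (intro Bochner_Integration.integral_cong refl) (simp add: scaleR_conv_of_real)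
      then show "e (\<eta> * x) * (indicator {-?R..?R} x *\<^sub>R (LINT \<xi>|lborel. indicator {a<..b} \<xi> *\<^sub>R e (- (\<xi> * x)))) =
        (LINT \<xi>|lborel. indicator {-?R..?R} x *\<^sub>R indicator {a<..b} \<xi> *\<^sub>R e ((\<eta> - \<xi>) * x))"
        unfolding integral_mult_right_zero by (simp only: scaleR_conv_of_real mult_ac)
    qed
    also have "\<dots> = (LINT \<xi>|lborel. LINT x|lborel. indicator {-?R..?R} x *\<^sub>R indicator {a<..b} \<xi> *\<^sub>R e ((\<eta> - \<xi>) * x))"
    proof (rule lborel_pair.Fubini_integral[symmetric])
      show "integrable (lborel \<Otimes>\<^sub>M lborel) (\<lambda>(x, \<xi>). indicator {-?R..?R} x *\<^sub>R indicator {a<..b} \<xi> *\<^sub>R e ((\<eta> - \<xi>) * x))"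
      proof (rule integrable_lborel_pair_bound[OF inR[of 1] inab])
        have "(\<lambda>p. (\<eta> - snd p) * fst p) \<in> borel_measurable (lborel \<Otimes>\<^sub>M lborel)" by measurable
        then have [measurable]: "(\<lambda>p. e ((\<eta> - snd p) * fst p)) \<in> borel_measurable (lborel \<Otimes>\<^sub>M lborel)"
          by (rule measurable_compose) measurable
        show "(\<lambda>(x, \<xi>). indicator {-?R..?R} x *\<^sub>R indicator {a<..b} \<xi> *\<^sub>R e ((\<eta> - \<xi>) * x)) \<in> borel_measurable (lborel \<Otimes>\<^sub>M lborel)"
          unfolding split_beta' by measurable
      qed (auto split: split_indicator)
    qed
    also have "\<dots> = (LINT \<xi>|lborel. complex_of_real (indicator {a<..b} \<xi> * (2 * ?R * sinc (?R * (\<eta> - \<xi>)))))"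
    proof (rule Bochner_Integration.integral_cong[OF refl])
      fix \<xi>
      have "(LINT x|lborel. indicator {-?R..?R} x *\<^sub>R indicator {a<..b} \<xi> *\<^sub>R e ((\<eta> - \<xi>) * x)) = 
        indicator {a<..b} \<xi> *\<^sub>R (LINT x|lborel. indicator {-?R..?R} x *\<^sub>R exp (\<i> * complex_of_real (\<eta> - \<xi>) * complex_of_real x))"
        unfolding scaleR_conv_of_real integral_mult_right_zero[symmetric]
        by (intro Bochner_Integration.integral_cong refl) (simp add: e_def mult_ac)
      also have "\<dots> = complex_of_real (indicator {a<..b} \<xi> * (2 * ?R * sinc (?R * (\<eta> - \<xi>))))"
        by (subst set_integral_exp_symmetric) (simp_all add: scaleR_conv_of_real)
      finally show "(LINT x|lborel. indicator {-?R..?R} x *\<^sub>R indicator {a<..b} \<xi> *\<^sub>R e ((\<eta> - \<xi>) * x)) = complex_of_real (indicator {a<..b} \<xi> * (2 * ?R * sinc (?R * (\<eta> - \<xi>))))" .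
    qed
    also have "\<dots> = complex_of_real (LINT \<xi>|lborel. indicator {a<..b} \<xi> * (2 * ?R * sinc (?R * (\<eta> - \<xi>))))"
      by (rule integral_complex_of_real)
    also have "(LINT \<xi>|lborel. indicator {a<..b} \<xi> * (2 * ?R * sinc (?R * (\<eta> - \<xi>)))) = (LINT \<xi>|lborel. indicator {a..b} \<xi> *\<^sub>R (2 * ?R * sinc (?R * (\<eta> - \<xi>))))"
    proof (rule integral_cong_AE)
      show "AE x in lborel. indicator {a<..b} x * (2 * ?R * sinc (?R * (\<eta> - x))) = indicator {a..b} x *\<^sub>R (2 * ?R * sinc (?R * (\<eta> - x)))"
        using AE_lborel_singleton[of a] by eventually_elim (auto split: split_indicator)
      have "(\<lambda>x. sinc (?R * (\<eta> - x))) \<in> borel_measurable borel"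
        by (rule measurable_compose[OF _ borel_measurable_sinc]) measurable
      then show "(\<lambda>x. indicator {a<..b} x * (2 * ?R * sinc (?R * (\<eta> - x)))) \<in> borel_measurable lborel"
        "(\<lambda>x. indicator {a..b} x *\<^sub>R (2 * ?R * sinc (?R * (\<eta> - x)))) \<in> borel_measurable lborel"
        by measurable
    qed
    \<comment> \<open>In \<xi> the kernel has the antiderivative -2 Si(n (\<eta> - \<xi>)); the
      factor 2 combines with 1/(2 pi) to the 1/pi of the statement.\<close>
    also have "\<dots> = - 2 * Si (?R * (\<eta> - b)) - - 2 * Si (?R * (\<eta> - a))"
    proof (rule integral_FTC_atLeastAtMost)
      show "a \<le> b" using ab by simp
      have "((\<lambda>\<xi>. Si (?R * (\<eta> - \<xi>))) has_real_derivative sinc (?R * (\<eta> - x)) * (?R * (0 - 1))) (at x)" for x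
        by (rule DERIV_chain2[OF DERIV_Si]) (auto intro!: derivative_eq_intros)
      then have "((\<lambda>\<xi>. - 2 * Si (?R * (\<eta> - \<xi>))) has_real_derivative - 2 * (sinc (?R * (\<eta> - x)) * (?R * (0 - 1)))) (at x)" for x
        by (rule DERIV_cmult)
      moreover have "- 2 * (t * (?R * (0 - 1))) = 2 * ?R * t" for t :: real by simp
      ultimately have "((\<lambda>\<xi>. - 2 * Si (?R * (\<eta> - \<xi>))) has_real_derivative 2 * ?R * sinc (?R * (\<eta> - x))) (at x)" for x
        by (simp only:)
      then show "((\<lambda>\<xi>. - 2 * Si (?R * (\<eta> - \<xi>))) has_vector_derivative 2 * ?R * sinc (?R * (\<eta> - x))) (at x within {a..b})" for x
        unfolding has_real_derivative_iff_has_vector_derivative by (rule has_vector_derivative_at_within)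
      show "continuous_on {a..b} (\<lambda>\<xi>. 2 * ?R * sinc (?R * (\<eta> - \<xi>)))"
        by (intro continuous_intros)
    qed
    finally have J: "(LINT x|lborel. e (\<eta> * x) * (indicator {-?R..?R} x *\<^sub>R (LINT \<xi>|lborel. indicator {a<..b} \<xi> *\<^sub>R e (- (\<xi> * x))))) =
       complex_of_real (- 2 * Si (?R * (\<eta> - b)) - - 2 * Si (?R * (\<eta> - a)))" .
    have "(LINT x|lborel. 1 / (2 * complex_of_real pi) * (e (\<eta> * x) * G \<eta> * (indicator {-?R..?R} x *\<^sub>R (LINT \<xi>|lborel. indicator {a<..b} \<xi> *\<^sub>R e (- (\<xi> * x))))))
       = (LINT x|lborel. (1 / (2 * complex_of_real pi) * G \<eta>) * (e (\<eta> * x) * (indicator {-?R..?R} x *\<^sub>R (LINT \<xi>|lborel. indicator {a<..b} \<xi> *\<^sub>R e (- (\<xi> * x))))))"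
      by (intro Bochner_Integration.integral_cong refl) (simp only: mult_ac)
    also have "\<dots> = 1 / (2 * complex_of_real pi) * G \<eta> * complex_of_real (- 2 * Si (?R * (\<eta> - b)) - - 2 * Si (?R * (\<eta> - a)))"
      by (simp only: integral_mult_right_zero J)
    also have "\<dots> = complex_of_real ((Si (?R * (\<eta> - a)) - Si (?R * (\<eta> - b))) / pi) * G \<eta>"
      by (simp add: field_simps)
    finally show "(LINT x|lborel. 1 / (2 * complex_of_real pi) * (e (\<eta> * x) * G \<eta> * (indicator {-?R..?R} x *\<^sub>R (LINT \<xi>|lborel. indicator {a<..b} \<xi> *\<^sub>R e (- (\<xi> * x))))))
       = complex_of_real ((Si (?R * (\<eta> - a)) - Si (?R * (\<eta> - b))) / pi) * G \<eta>" .
  qed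
  finally show ?thesis unfolding h_def .
qed

text \<open>The L2 theory provides some transform \<open>H\<close> of \<open>inv_ft G\<close>, to be
  compared with \<open>G\<close> through integrals over intervals. For the truncated transforms
  these converge to the integral of \<open>H\<close> by L2 convergence, and to that of
  \<open>G\<close> because the smoothed indicators are uniformly bounded and tend to the
  indicator.\<close>

theorem fourier_inversion:
  assumes G: "integrable lborel G" "L2_fun G"
  shows "is_fourier_transform (inv_ft G) G"
proof -
  have [measurable]: "G \<in> borel_measurable borel" using G by auto
  have h: "L2_fun (inv_ft G)" by (rule L2_fun_inv_ft) fact+
  obtain H where H: "is_fourier_transform (inv_ft G) H" using fourier_transform_exists[OF h] by blast
  then have HL: "L2_fun H" by blast
  then have [measurable]: "H \<in> borel_measurable borel" by auto
  obtain B where B: "\<And>t. \<bar>Si t\<bar> \<le> B" using bounded_Si by blast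
  have "AE \<xi> in lborel. H \<xi> - G \<xi> = 0"
  proof (rule AE_zero_if_interval_integrals_zero)
    fix a b :: real assume ab: "a < b"
    have iH: "integrable lborel (\<lambda>x. indicator {a<..b} x *\<^sub>R H x)" and iG: "integrable lborel (\<lambda>x. indicator {a<..b} x *\<^sub>R G x)"
      using ab by (intro integrable_indicator_mult_L2 HL G; auto simp: emeasure_lborel_Ioc)+
    from Bochner_Integration.integrable_diff[OF iH iG]
    show "integrable lborel (\<lambda>x. indicator {a<..b} x *\<^sub>R (H x - G x))" by (simp add: scaleR_diff_right)
    have "(\<lambda>n. LINT \<xi>|lborel. ft (trunc (real n) (inv_ft G)) \<xi> * complex_of_real (indicator {a<..b} \<xi>)) \<longlonglongrightarrow>
      (LINT \<xi>|lborel. H \<xi> * complex_of_real (indicator {a<..b} \<xi>))"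
      using ab by (intro tendsto_integral_mult_L2 L2_fun_ft_trunc h HL is_fourier_transform_seq H L2_fun_indicator) (auto simp: emeasure_lborel_Ioc)
    then have 1: "(\<lambda>n. LINT \<xi>|lborel. indicator {a<..b} \<xi> *\<^sub>R ft (trunc (real n) (inv_ft G)) \<xi>) \<longlonglongrightarrow>
      (LINT \<xi>|lborel. indicator {a<..b} \<xi> *\<^sub>R H \<xi>)"
      by (simp add: scaleR_conv_of_real mult.commute)
    have "(\<lambda>n. LINT \<eta>|lborel. complex_of_real ((Si (real n * (\<eta> - a)) - Si (real n * (\<eta> - b))) / pi) * G \<eta>) \<longlonglongrightarrow>
      (LINT \<eta>|lborel. indicator {a<..b} \<eta> *\<^sub>R G \<eta>)"
    proof (rule integral_dominated_convergence[where w="\<lambda>\<eta>. (B + B) / pi * cmod (G \<eta>)"])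
      show "integrable lborel (\<lambda>\<eta>. (B + B) / pi * cmod (G \<eta>))" using G(1) by (intro integrable_mult_right integrable_norm)
      show "AE \<eta> in lborel. norm (complex_of_real ((Si (real n * (\<eta> - a)) - Si (real n * (\<eta> - b))) / pi) * G \<eta>) \<le> (B + B) / pi * cmod (G \<eta>)" for n
      proof (rule AE_I2)
        fix \<eta>
        have "\<bar>Si (real n * (\<eta> - a)) - Si (real n * (\<eta> - b))\<bar> \<le> B + B"
          using B[of "real n * (\<eta> - a)"] B[of "real n * (\<eta> - b)"] by linarith
        then show "norm (complex_of_real ((Si (real n * (\<eta> - a)) - Si (real n * (\<eta> - b))) / pi) * G \<eta>) \<le> (B + B) / pi * cmod (G \<eta>)"
          unfolding norm_mult norm_of_real by (intro mult_right_mono) (auto simp: divide_right_mono)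
      qed
      \<comment> \<open>At the two endpoints the weights tend to 1/2, so these points are
        excluded.\<close>
      show "AE \<eta> in lborel. (\<lambda>n. complex_of_real ((Si (real n * (\<eta> - a)) - Si (real n * (\<eta> - b))) / pi) * G \<eta>) \<longlonglongrightarrow> indicator {a<..b} \<eta> *\<^sub>R G \<eta>"
        using AE_lborel_singleton[of a] AE_lborel_singleton[of b]
      proof eventually_elim
        case (elim \<eta>)
        have "(\<lambda>n. complex_of_real ((Si (real n * (\<eta> - a)) - Si (real n * (\<eta> - b))) / pi) * G \<eta>) \<longlonglongrightarrow>
          complex_of_real ((pi / 2 * sgn (\<eta> - a) - pi / 2 * sgn (\<eta> - b)) / pi) * G \<eta>"
          by (intro tendsto_intros tendsto_Si_scaled) auto
        also have "complex_of_real ((pi / 2 * sgn (\<eta> - a) - pi / 2 * sgn (\<eta> - b)) / pi) * G \<eta> = indicator {a<..b} \<eta> *\<^sub>R G \<eta>"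
          using elim ab by (auto simp: indicator_def sgn_if)
        finally show ?case .
      qed
    qed measurable
    then have 2: "(\<lambda>n. LINT \<xi>|lborel. indicator {a<..b} \<xi> *\<^sub>R ft (trunc (real n) (inv_ft G)) \<xi>) \<longlonglongrightarrow>
      (LINT \<eta>|lborel. indicator {a<..b} \<eta> *\<^sub>R G \<eta>)"
      unfolding interval_integral_ft_trunc_inv_ft[OF G(1) ab] .
    from LIMSEQ_unique[OF 1 2]
    show "(LINT x|lborel. indicator {a<..b} x *\<^sub>R (H x - G x)) = 0"
      by (simp add: scaleR_diff_right Bochner_Integration.integral_diff[OF iH iG])
  qed measurable
  then show ?thesis
    by (intro is_fourier_transform_cong_AE[OF H]) auto
qed

section \<open>The oscillatory Cauchy operator\<close>

text \<open>The sign \<sigma> selects the half-line on which exp(i \<xi> w) decays; reflection by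
  \<sigma> reduces it to the positive one, so both half-planes are treated at once.\<close>

lemma has_bochner_integral_exp_signed_halfline:
  fixes w :: complex and \<sigma> :: real
  assumes \<sigma>: "\<sigma> \<in> {1, -1}" and w: "\<sigma> * Im w > 0"
  shows "has_bochner_integral lborel (\<lambda>\<xi>. indicator {\<xi>. \<sigma> * \<xi> > 0} \<xi> *\<^sub>R exp (\<i> * complex_of_real \<xi> * w)) (complex_of_real \<sigma> * \<i> / w)"
proof -
  have w0: "w \<noteq> 0" using w by auto
  have "has_bochner_integral lborel (\<lambda>x. indicator {0<..} x *\<^sub>R exp (complex_of_real \<sigma> * \<i> * w * complex_of_real x)) (- 1 / (complex_of_real \<sigma> * \<i> * w))"
    by (rule has_bochner_integral_exp_halfline) (use w in simp)
  then have "has_bochner_integral lborel (\<lambda>\<xi>. indicator {0<..} (0 + \<sigma> * \<xi>) *\<^sub>R exp (complex_of_real \<sigma> * \<i> * w * complex_of_real (0 + \<sigma> * \<xi>))) ((- 1 / (complex_of_real \<sigma> * \<i> * w)) /\<^sub>R \<bar>\<sigma>\<bar>)"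
    using \<sigma> by (subst lborel_has_bochner_integral_real_affine_iff[symmetric]) auto
  also have "(\<lambda>\<xi>. indicator {0<..} (0 + \<sigma> * \<xi>) *\<^sub>R exp (complex_of_real \<sigma> * \<i> * w * complex_of_real (0 + \<sigma> * \<xi>))) =
     (\<lambda>\<xi>. indicator {\<xi>. \<sigma> * \<xi> > 0} \<xi> *\<^sub>R exp (\<i> * complex_of_real \<xi> * w))"
    using \<sigma> by (auto simp: indicator_def mult_ac fun_eq_iff)
  also have "(- 1 / (complex_of_real \<sigma> * \<i> * w)) /\<^sub>R \<bar>\<sigma>\<bar> = complex_of_real \<sigma> * \<i> / w"
    using \<sigma> w0 by (auto simp: field_simps)
  finally show ?thesis .
qed

text \<open>With \<epsilon> = |Im z| the squared modulus is the kernel of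
  \<open>nn_integral_poisson_kernel\<close> divided by 2 \<epsilon>.\<close>

lemma L2_fun_cauchy_kernel:
  assumes "Im z \<noteq> 0"
  shows "L2_fun (\<lambda>x. exp (- \<i> * complex_of_real k * complex_of_real x) / (complex_of_real x - z))"
proof -
  define \<epsilon> where "\<epsilon> = \<bar>Im z\<bar>"
  have e: "\<epsilon> > 0" using assms by (simp add: \<epsilon>_def)
  have "(cmod (exp (- \<i> * complex_of_real k * complex_of_real x) / (complex_of_real x - z)))\<^sup>2 = 1 / (\<epsilon>\<^sup>2 + (Re z - x)\<^sup>2)" for x
    by (simp add: norm_divide power_divide cmod_power2 \<epsilon>_def power2_commute add.commute)
  then have "sq_norm (\<lambda>x. exp (- \<i> * complex_of_real k * complex_of_real x) / (complex_of_real x - z)) = (\<integral>\<^sup>+x. ennreal (1 / (2 * \<epsilon>)) * ennreal (2 * \<epsilon> / (\<epsilon>\<^sup>2 + (Re z - x)\<^sup>2)) \<partial>lborel)"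
    unfolding sq_norm_def using e by (simp add: ennreal_mult[symmetric] del: ennreal_numeral)
  also have "\<dots> = ennreal (1 / (2 * \<epsilon>)) * ennreal (2 * pi)"
    by (simp add: nn_integral_cmult nn_integral_poisson_kernel[OF e] del: ennreal_numeral)
  also have "\<dots> < \<infinity>" by (simp add: ennreal_mult_less_top)
  finally show ?thesis by (simp add: L2_fun_iff_sq_norm)
qed

text \<open>For \<open>\<sigma> Im z > 0\<close> the Cauchy kernel \<open>e\<^bsup>-ikx\<^esup>/(x - z)\<close> is, up to a constant, the Fourier transform
  of this one-sided exponential.\<close>

definition fourier_kernel :: "real \<Rightarrow> real \<Rightarrow> complex \<Rightarrow> real \<Rightarrow> complex" where
  "fourier_kernel \<sigma> k z \<xi> = indicator {\<xi>. \<sigma> * (\<xi> - k) > 0} \<xi> *\<^sub>R exp (\<i> * complex_of_real (\<xi> - k) * z)"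

lemma fourier_kernel_measurable [measurable]: "fourier_kernel \<sigma> k z \<in> borel_measurable borel"
  unfolding fourier_kernel_def[abs_def] by measurable

lemma norm_fourier_kernel_le:
  assumes "\<sigma> \<in> {1, -1}" "\<sigma> * Im z \<ge> 0"
  shows "cmod (fourier_kernel \<sigma> k z \<xi>) \<le> exp (- \<bar>Im z\<bar> * \<bar>\<xi> - k\<bar>)"
proof (cases "\<sigma> * (\<xi> - k) > 0")
  case True
  have "\<bar>Im z\<bar> * \<bar>\<xi> - k\<bar> = (\<sigma> * Im z) * (\<sigma> * (\<xi> - k))" using assms True by (auto simp: abs_if)
  also have "\<dots> = Im z * (\<xi> - k)" using assms(1) by auto
  finally show ?thesis using True by (simp add: fourier_kernel_def norm_exp_eq_Re mult.commute)
qed (simp add: fourier_kernel_def)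

lemma integrable_exp_neg_abs_shift:
  assumes "(\<epsilon>::real) > 0"
  shows "integrable lborel (\<lambda>\<xi>. exp (- \<epsilon> * \<bar>\<xi> - k\<bar>))"
  using lborel_integrable_real_affine[OF integrable_exp_neg_abs[OF assms], of 1 "-k"] by simp

lemma L2_fun_fourier_kernel:
  assumes "\<sigma> \<in> {1, -1}" "\<sigma> * Im z > 0"
  shows "L2_fun (fourier_kernel \<sigma> k z)"
  unfolding L2_fun_def
proof
  have e: "\<bar>Im z\<bar> > 0" using assms by auto
  show "integrable lborel (\<lambda>\<xi>. (cmod (fourier_kernel \<sigma> k z \<xi>))\<^sup>2)"
  proof (rule Bochner_Integration.integrable_bound[OF integrable_exp_neg_abs_shift[OF e, of k]])
    show "AE \<xi> in lborel. norm ((cmod (fourier_kernel \<sigma> k z \<xi>))\<^sup>2) \<le> norm (exp (- \<bar>Im z\<bar> * \<bar>\<xi> - k\<bar>))"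
    proof (rule AE_I2)
      fix \<xi>
      have *: "cmod (fourier_kernel \<sigma> k z \<xi>) \<le> exp (- \<bar>Im z\<bar> * \<bar>\<xi> - k\<bar>)"
        using assms by (intro norm_fourier_kernel_le) auto
      have "(cmod (fourier_kernel \<sigma> k z \<xi>))\<^sup>2 \<le> exp (- \<bar>Im z\<bar> * \<bar>\<xi> - k\<bar>) * 1"
        unfolding power2_eq_square by (intro mult_mono * order_trans[OF *]) auto
      then show "norm ((cmod (fourier_kernel \<sigma> k z \<xi>))\<^sup>2) \<le> norm (exp (- \<bar>Im z\<bar> * \<bar>\<xi> - k\<bar>))" by simp
    qed
  qed measurable
qed measurable

text \<open>The shift of \<xi> by k produces the oscillatory factor; what remains is the one-sided
  exponential integral.\<close>

lemma ft_fourier_kernel: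
  assumes \<sigma>: "\<sigma> \<in> {1, -1}" "\<sigma> * Im z > 0"
  shows "ft (fourier_kernel \<sigma> k z) x = exp (- \<i> * complex_of_real k * complex_of_real x) * (complex_of_real \<sigma> * \<i> / (z - complex_of_real x))"
proof -
  let ?h = "\<lambda>\<xi>. indicator {\<xi>. \<sigma> * \<xi> > 0} \<xi> *\<^sub>R exp (\<i> * complex_of_real \<xi> * (z - complex_of_real x))"
  have I: "has_bochner_integral lborel ?h (complex_of_real \<sigma> * \<i> / (z - complex_of_real x))"
    by (rule has_bochner_integral_exp_signed_halfline) (use assms in auto)
  have "ft (fourier_kernel \<sigma> k z) x = (LINT \<xi>|lborel. exp (- \<i> * complex_of_real k * complex_of_real x) * ?h (- k + 1 * \<xi>))"
    unfolding ft_def fourier_kernel_def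
    by (intro Bochner_Integration.integral_cong refl)
       (auto simp: indicator_def exp_add[symmetric] algebra_simps)
  also have "\<dots> = exp (- \<i> * complex_of_real k * complex_of_real x) * (LINT \<xi>|lborel. ?h (- k + 1 * \<xi>))"
    by (rule integral_mult_right_zero)
  also have "(LINT \<xi>|lborel. ?h (- k + 1 * \<xi>)) = (LINT \<xi>|lborel. ?h \<xi>)"
    using lborel_integral_real_affine[of 1 ?h "-k"] by simp
  also have "\<dots> = complex_of_real \<sigma> * \<i> / (z - complex_of_real x)"
    using I by (rule has_bochner_integral_integral_eq)
  finally show ?thesis .
qed

lemma integrable_fourier_kernel:
  assumes "\<sigma> \<in> {1, -1}" "\<sigma> * Im z > 0"
  shows "integrable lborel (fourier_kernel \<sigma> k z)"
proof (rule Bochner_Integration.integrable_bound[OF integrable_exp_neg_abs_shift])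
  show "\<bar>Im z\<bar> > 0" using assms by auto
  show "AE \<xi> in lborel. norm (fourier_kernel \<sigma> k z \<xi>) \<le> norm (exp (- \<bar>Im z\<bar> * \<bar>\<xi> - k\<bar>))"
    using norm_fourier_kernel_le[OF assms(1), of z k] assms(2) by auto
qed measurable

text \<open>Fubini for a product of integrable functions. It moves the transform from a truncated
  function to the one-sided exponential, whose transform is the Cauchy kernel up to a
  constant.\<close>

lemma ft_multiplication_formula:
  assumes f: "integrable lborel f" and g: "integrable lborel g"
  shows "(LINT \<xi>|lborel. ft f \<xi> * g \<xi>) = (LINT x|lborel. f x * ft g x)"
proof -
  have [measurable]: "f \<in> borel_measurable borel" "g \<in> borel_measurable borel" using f g by auto
  define e where "e t = exp (- \<i> * complex_of_real t)" for t
  have [measurable]: "e \<in> borel_measurable borel" unfolding e_def[abs_def] by measurable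
  have ne [simp]: "cmod (e t) = 1" for t by (simp add: e_def norm_exp_eq_Re)
  have ft_e: "ft f \<xi> = (LINT x|lborel. e (\<xi> * x) * f x)" for f \<xi> by (simp add: ft_def e_def mult.assoc)
  have "(LINT \<xi>|lborel. ft f \<xi> * g \<xi>) = (LINT \<xi>|lborel. LINT x|lborel. e (\<xi> * x) * f x * g \<xi>)"
    by (simp only: ft_e integral_mult_left_zero)
  also have "\<dots> = (LINT x|lborel. LINT \<xi>|lborel. e (\<xi> * x) * f x * g \<xi>)"
  proof (rule lborel_pair.Fubini_integral[symmetric])
    show "integrable (lborel \<Otimes>\<^sub>M lborel) (\<lambda>(\<xi>, x). e (\<xi> * x) * f x * g \<xi>)"
      by (rule integrable_lborel_pair_bound[OF integrable_norm[OF g] integrable_norm[OF f]])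
         (measurable, simp add: norm_mult mult.commute)
  qed
  also have "\<dots> = (LINT x|lborel. f x * ft g x)"
  proof (rule Bochner_Integration.integral_cong[OF refl])
    fix x
    have "(LINT \<xi>|lborel. e (\<xi> * x) * f x * g \<xi>) = (LINT \<xi>|lborel. f x * (e (x * \<xi>) * g \<xi>))"
      by (simp only: mult_ac)
    then show "(LINT \<xi>|lborel. e (\<xi> * x) * f x * g \<xi>) = f x * ft g x"
      by (simp only: integral_mult_right_zero ft_e)
  qed
  finally show ?thesis .
qed

text \<open>For truncations this is the multiplication formula. Both sides are integrals against a
  fixed L2 function, so they follow the truncations to their L2 limit.\<close>

theorem osc_cauchy_eq_fourier:
  assumes g: "L2_fun g" and gh: "is_fourier_transform g gh" and \<sigma>: "\<sigma> \<in> {1, -1}" "\<sigma> * Im z > 0"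
  shows "osc_cauchy k g z = complex_of_real \<sigma> / (2 * complex_of_real pi) * (LINT \<xi>|lborel. gh \<xi> * fourier_kernel \<sigma> k z \<xi>)"
proof -
  let ?c = "\<lambda>x. exp (- \<i> * complex_of_real k * complex_of_real x) / (complex_of_real x - z)"
  have [measurable]: "g \<in> borel_measurable borel" using g by auto
  have nz: "complex_of_real x - z \<noteq> 0" "z - complex_of_real x \<noteq> 0" for x using \<sigma> by (auto simp: complex_eq_iff)
  have tr: "L2_fun (trunc R g)" for R
  proof -
    have "sq_norm (trunc R g) \<le> sq_norm g" unfolding sq_norm_def
      by (intro nn_integral_mono) (auto simp: trunc_def split: split_indicator)
    then show ?thesis using g by (auto simp: L2_fun_iff_sq_norm)
  qed
  have 1: "(\<lambda>n. LINT x|lborel. trunc (real n) g x * ?c x) \<longlonglongrightarrow> (LINT x|lborel. g x * ?c x)"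
    using \<sigma> by (intro tendsto_integral_mult_L2 tr g L2_fun_cauchy_kernel
        filterlim_compose[OF sq_norm_tail[OF g] filterlim_real_sequentially]) auto
  have 2: "(\<lambda>n. LINT \<xi>|lborel. ft (trunc (real n) g) \<xi> * fourier_kernel \<sigma> k z \<xi>) \<longlonglongrightarrow> (LINT \<xi>|lborel. gh \<xi> * fourier_kernel \<sigma> k z \<xi>)"
    using gh by (intro tendsto_integral_mult_L2 L2_fun_ft_trunc g is_fourier_transform_L2[OF gh] L2_fun_fourier_kernel \<sigma> is_fourier_transform_seq) 
  have "(LINT \<xi>|lborel. ft (trunc (real n) g) \<xi> * fourier_kernel \<sigma> k z \<xi>) = - complex_of_real \<sigma> * \<i> * (LINT x|lborel. trunc (real n) g x * ?c x)" for n
  proof -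
    have "(LINT \<xi>|lborel. ft (trunc (real n) g) \<xi> * fourier_kernel \<sigma> k z \<xi>) = (LINT x|lborel. trunc (real n) g x * ft (fourier_kernel \<sigma> k z) x)"
      by (intro ft_multiplication_formula integrable_trunc g integrable_fourier_kernel \<sigma>)
    also have "\<dots> = (LINT x|lborel. - complex_of_real \<sigma> * \<i> * (trunc (real n) g x * ?c x))"
    proof (rule Bochner_Integration.integral_cong[OF refl])
      fix x
      have "complex_of_real \<sigma> * \<i> / (z - complex_of_real x) = - complex_of_real \<sigma> * \<i> * (1 / (complex_of_real x - z))"
        using nz[of x] by (simp add: field_simps)
      then show "trunc (real n) g x * ft (fourier_kernel \<sigma> k z) x = - complex_of_real \<sigma> * \<i> * (trunc (real n) g x * ?c x)"
        unfolding ft_fourier_kernel[OF \<sigma>] by (simp only: mult_ac) (simp add: mult_ac)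
    qed
    also have "\<dots> = - complex_of_real \<sigma> * \<i> * (LINT x|lborel. trunc (real n) g x * ?c x)"
      by (rule integral_mult_right_zero)
    finally show ?thesis .
  qed
  then have "(\<lambda>n. - complex_of_real \<sigma> * \<i> * (LINT x|lborel. trunc (real n) g x * ?c x)) \<longlonglongrightarrow> (LINT \<xi>|lborel. gh \<xi> * fourier_kernel \<sigma> k z \<xi>)"
    using 2 by simp
  from LIMSEQ_unique[OF this tendsto_mult[OF tendsto_const 1]]
  have "(LINT \<xi>|lborel. gh \<xi> * fourier_kernel \<sigma> k z \<xi>) = - complex_of_real \<sigma> * \<i> * (LINT x|lborel. g x * ?c x)" .
  \<comment> \<open>The constants match because the square of \<sigma> is 1 and -i = 1/i.\<close>
  then have "complex_of_real \<sigma> / (2 * complex_of_real pi) * (LINT \<xi>|lborel. gh \<xi> * fourier_kernel \<sigma> k z \<xi>) = 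
     1 / (2 * complex_of_real pi * \<i>) * (LINT x|lborel. g x * ?c x)"
    using \<sigma>(1) by (auto simp: field_simps)
  also have "(LINT x|lborel. g x * ?c x) = (LINT x|lborel. exp (- \<i> * complex_of_real k * complex_of_real x) * g x / (complex_of_real x - z))"
    by (simp add: mult.commute)
  finally show ?thesis by (simp only: osc_cauchy_def)
qed

lemma osc_cauchy_diff:
  assumes f: "L2_fun f" and g: "L2_fun g" and z: "Im z \<noteq> 0"
  shows "osc_cauchy k (\<lambda>x. f x - g x) z = osc_cauchy k f z - osc_cauchy k g z"
proof -
  let ?c = "\<lambda>x. exp (- \<i> * complex_of_real k * complex_of_real x) / (complex_of_real x - z)"
  have eq: "osc_cauchy k u z = 1 / (2 * complex_of_real pi * \<i>) * (LINT x|lborel. u x * ?c x)" for u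
    unfolding osc_cauchy_def by (simp add: mult.commute)
  show ?thesis
    unfolding eq left_diff_distrib right_diff_distrib[symmetric]
      Bochner_Integration.integral_diff[OF integrable_mult_L2[OF f L2_fun_cauchy_kernel[OF z]] integrable_mult_L2[OF g L2_fun_cauchy_kernel[OF z]]] ..
qed

section \<open>The H1 norm as a weighted L2 norm of the transform\<close>

definition weighted :: "(real \<Rightarrow> complex) \<Rightarrow> real \<Rightarrow> complex" where
  "weighted v \<xi> = complex_of_real (1 + \<bar>\<xi>\<bar>) * v \<xi>"

lemma weighted_measurable [measurable]:
  assumes [measurable]: "v \<in> borel_measurable borel"
  shows "weighted v \<in> borel_measurable borel"
  unfolding weighted_def[abs_def] by measurable

lemma norm_weighted_power2: "(cmod (weighted v \<xi>))\<^sup>2 = (1 + \<bar>\<xi>\<bar>)\<^sup>2 * (cmod (v \<xi>))\<^sup>2"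
  by (simp add: weighted_def norm_mult power_mult_distrib del: of_real_add)

lemma fourier_L2_measurable [measurable]: "L2_fun f \<Longrightarrow> fourier_L2 f \<in> borel_measurable borel"
  using is_fourier_transform_fourier_L2[of f] by auto

lemma H1_fun_iff: "H1_fun f \<longleftrightarrow> L2_fun f \<and> sq_norm (weighted (fourier_L2 f)) < \<infinity>"
  unfolding H1_fun_def sq_norm_def norm_weighted_power2
  by (auto simp: integrable_iff_bounded)

lemma H1_norm_eq: "L2_fun f \<Longrightarrow> H1_norm f = sqrt (enn2real (sq_norm (weighted (fourier_L2 f))))"
  unfolding H1_norm_def norm_weighted_power2[symmetric] L2_norm_def[symmetric]
  by (rule L2_norm_eq_sq_norm) measurable

lemma sq_norm_eq_L2_norm: "L2_fun f \<Longrightarrow> sq_norm f = ennreal ((L2_norm f)\<^sup>2)"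
  by (simp add: L2_norm_eq_sq_norm L2_fun_iff_sq_norm)

lemma sq_norm_weighted_eq_H1_norm: "H1_fun f \<Longrightarrow> sq_norm (weighted (fourier_L2 f)) = ennreal ((H1_norm f)\<^sup>2)"
  by (simp add: H1_norm_eq H1_fun_iff)

lemma L2_norm_nonneg [simp]: "L2_norm f \<ge> 0" and H1_norm_nonneg [simp]: "H1_norm f \<ge> 0"
  unfolding L2_norm_def H1_norm_def by (auto intro!: integral_nonneg_AE)

lemma ennreal_power2_le_imp_le:
  assumes "(a::ennreal)\<^sup>2 \<le> (ennreal r)\<^sup>2" "r \<ge> 0"
  shows "a \<le> ennreal r"
proof (cases a rule: ennreal_cases)
  case (real t)
  have t: "(ennreal t)\<^sup>2 = ennreal (t\<^sup>2)" by (rule ennreal_power) fact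
  have r: "(ennreal r)\<^sup>2 = ennreal (r\<^sup>2)" by (rule ennreal_power) fact
  have "ennreal (t\<^sup>2) \<le> ennreal (r\<^sup>2)" using assms(1) unfolding \<open>a = ennreal t\<close> t r .
  then have "t\<^sup>2 \<le> r\<^sup>2" by (subst (asm) ennreal_le_iff) auto
  then have "t \<le> r" using assms(2) by (rule power2_le_imp_le)
  then show ?thesis unfolding \<open>a = ennreal t\<close> by (rule ennreal_leI)
next
  case top
  have "(top::ennreal)\<^sup>2 = top" by (simp add: power2_eq_square)
  moreover have "(ennreal r)\<^sup>2 \<noteq> top" using assms(2) by (simp only: ennreal_power ennreal_neq_top) simp
  ultimately have False using assms(1) unfolding top by (metis top_unique)
  then show ?thesis ..
qed

text \<open>Cauchy-Schwarz against 1/(1 + |\<xi>|), whose square is at most 1/(1 + \<xi>^2) and so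
  has integral at most pi.\<close>

lemma nn_integral_fourier_L2_le:
  assumes "H1_fun f"
  shows "(\<integral>\<^sup>+\<xi>. ennreal (cmod (fourier_L2 f \<xi>)) \<partial>lborel) \<le> ennreal (sqrt pi * H1_norm f)"
proof -
  have f: "L2_fun f" using assms by (simp add: H1_fun_def)
  have [measurable]: "fourier_L2 f \<in> borel_measurable borel" using f by measurable
  let ?v = "\<lambda>\<xi>. complex_of_real (1 / (1 + \<bar>\<xi>\<bar>))"
  have "sq_norm ?v \<le> (\<integral>\<^sup>+\<xi>. ennreal (1 / 2) * ennreal (2 * 1 / (1\<^sup>2 + (0 - \<xi>)\<^sup>2)) \<partial>lborel)"
    unfolding sq_norm_def
  proof (intro nn_integral_mono)
    fix \<xi> :: real
    have "(1 / (1 + \<bar>\<xi>\<bar>))\<^sup>2 \<le> 1 / (1 + \<xi>\<^sup>2)"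
      unfolding power_divide power_one by (rule divide_left_mono) (auto simp: power2_sum add_pos_nonneg intro!: mult_pos_pos)
    then have "(cmod (?v \<xi>))\<^sup>2 \<le> 1 / 2 * (2 * 1 / (1\<^sup>2 + (0 - \<xi>)\<^sup>2))"
      unfolding norm_of_real by simp
    then have "ennreal ((cmod (?v \<xi>))\<^sup>2) \<le> ennreal (1 / 2 * (2 * 1 / (1\<^sup>2 + (0 - \<xi>)\<^sup>2)))"
      by (rule ennreal_leI)
    also have "\<dots> = ennreal (1 / 2) * ennreal (2 * 1 / (1\<^sup>2 + (0 - \<xi>)\<^sup>2))"
      by (rule ennreal_mult) auto
    finally show "ennreal ((cmod (?v \<xi>))\<^sup>2) \<le> ennreal (1 / 2) * ennreal (2 * 1 / (1\<^sup>2 + (0 - \<xi>)\<^sup>2))" .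
  qed
  also have "\<dots> = ennreal (1 / 2) * ennreal (2 * pi)"
    using nn_integral_poisson_kernel[of 1 0] by (subst nn_integral_cmult) auto
  also have "\<dots> = ennreal (1 / 2 * (2 * pi))" by (rule ennreal_mult[symmetric]) auto
  also have "\<dots> = ennreal pi" by simp
  finally have v: "sq_norm ?v \<le> ennreal pi" .
  have "(\<integral>\<^sup>+\<xi>. ennreal (cmod (fourier_L2 f \<xi>)) \<partial>lborel) = (\<integral>\<^sup>+\<xi>. ennreal (cmod (?v \<xi> * weighted (fourier_L2 f) \<xi>)) \<partial>lborel)"
    unfolding weighted_def
  proof (intro nn_integral_cong)
    fix \<xi> :: real
    have "1 + \<bar>\<xi>\<bar> \<noteq> 0" by linarith
    then have "?v \<xi> * complex_of_real (1 + \<bar>\<xi>\<bar>) = 1" unfolding of_real_mult[symmetric] by simp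
    then have "?v \<xi> * (complex_of_real (1 + \<bar>\<xi>\<bar>) * fourier_L2 f \<xi>) = fourier_L2 f \<xi>" by (simp only: mult.assoc[symmetric] mult_1)
    then show "ennreal (cmod (fourier_L2 f \<xi>)) = ennreal (cmod (?v \<xi> * (complex_of_real (1 + \<bar>\<xi>\<bar>) * fourier_L2 f \<xi>)))" by (simp only:)
  qed
  then have "(\<integral>\<^sup>+\<xi>. ennreal (cmod (fourier_L2 f \<xi>)) \<partial>lborel)\<^sup>2 \<le> sq_norm ?v * sq_norm (weighted (fourier_L2 f))"
    by (simp only:) (intro nn_integral_mult_power2_le; measurable)
  also have "\<dots> \<le> ennreal pi * ennreal ((H1_norm f)\<^sup>2)"
    unfolding sq_norm_weighted_eq_H1_norm[OF assms] by (rule mult_right_mono[OF v]) simp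
  also have "\<dots> = (ennreal (sqrt pi * H1_norm f))\<^sup>2"
    by (simp add: ennreal_power ennreal_mult[symmetric] power_mult_distrib)
  finally show ?thesis
    by (rule ennreal_power2_le_imp_le) simp
qed

lemma integrable_fourier_L2:
  assumes "H1_fun f"
  shows "integrable lborel (fourier_L2 f)"
proof (rule integrableI_bounded)
  show "fourier_L2 f \<in> borel_measurable lborel" using assms by (auto simp: H1_fun_def)
  show "(\<integral>\<^sup>+\<xi>. ennreal (cmod (fourier_L2 f \<xi>)) \<partial>lborel) < \<infinity>"
    by (rule le_less_trans[OF nn_integral_fourier_L2_le[OF assms]]) simp
qed

text \<open>The one-sided exponential is bounded by 1, so the L1 norm of the transform bounds the
  Cauchy integral in either half-plane. A shift in frequency does not change that norm, which makes
  the bound uniform in k.\<close>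

lemma norm_osc_cauchy_le_H1_norm:
  assumes g: "H1_fun g" and z: "Im z \<noteq> 0"
  shows "cmod (osc_cauchy k g z) \<le> H1_norm g"
proof -
  have gL: "L2_fun g" using g by (simp add: H1_fun_def)
  define \<sigma> where "\<sigma> = sgn (Im z)"
  have \<sigma>: "\<sigma> \<in> {1, -1}" "\<sigma> * Im z > 0" using z by (auto simp: \<sigma>_def sgn_if)
  have "ennreal (cmod (LINT \<xi>|lborel. fourier_L2 g \<xi> * fourier_kernel \<sigma> k z \<xi>)) \<le> (\<integral>\<^sup>+\<xi>. ennreal (cmod (fourier_L2 g \<xi> * fourier_kernel \<sigma> k z \<xi>)) \<partial>lborel)"
    by (rule norm_integral_le_nn_integral)
  also have "\<dots> \<le> (\<integral>\<^sup>+\<xi>. ennreal (cmod (fourier_L2 g \<xi>)) \<partial>lborel)"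
  proof (intro nn_integral_mono ennreal_leI)
    fix \<xi>
    have "cmod (fourier_kernel \<sigma> k z \<xi>) \<le> 1"
      by (rule order_trans[OF norm_fourier_kernel_le]) (use \<sigma> in auto)
    then show "cmod (fourier_L2 g \<xi> * fourier_kernel \<sigma> k z \<xi>) \<le> cmod (fourier_L2 g \<xi>)"
      by (simp add: norm_mult mult_left_le)
  qed
  also have "\<dots> \<le> ennreal (sqrt pi * H1_norm g)" by (rule nn_integral_fourier_L2_le[OF g])
  finally have le: "cmod (LINT \<xi>|lborel. fourier_L2 g \<xi> * fourier_kernel \<sigma> k z \<xi>) \<le> sqrt pi * H1_norm g"
    by simp
  have "1 * pi \<le> (4 * pi) * pi" using pi_gt3 by (intro mult_right_mono) auto
  then have sp: "sqrt pi \<le> 2 * pi" by (intro real_le_lsqrt) (auto simp: power2_eq_square)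
  have "cmod (osc_cauchy k g z) = cmod (LINT \<xi>|lborel. fourier_L2 g \<xi> * fourier_kernel \<sigma> k z \<xi>) / (2 * pi)"
    unfolding osc_cauchy_eq_fourier[OF gL is_fourier_transform_fourier_L2[OF gL] \<sigma>]
    using \<sigma>(1) by (auto simp: norm_mult norm_divide)
  also have "\<dots> \<le> (2 * pi * H1_norm g) / (2 * pi)"
    by (intro divide_right_mono order_trans[OF le] mult_right_mono sp) auto
  finally show ?thesis by simp
qed

text \<open>The transform of \<open>C\<^sub>k g\<close> on the line at height \<open>\<delta>\<close>.\<close>

definition shifted_transform :: "real \<Rightarrow> (real \<Rightarrow> complex) \<Rightarrow> real \<Rightarrow> real \<Rightarrow> complex" where
  "shifted_transform k g \<delta> \<xi> = (indicator {0<..} \<xi> * exp (- \<delta> * \<xi>)) *\<^sub>R fourier_L2 g (\<xi> + k)"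

lemma osc_cauchy_eq_inv_ft:
  assumes g: "L2_fun g" and \<delta>: "\<delta> > 0"
  shows "osc_cauchy k g (complex_of_real x + \<i> * complex_of_real \<delta>) = inv_ft (shifted_transform k g \<delta>) x"
proof -
  let ?z = "complex_of_real x + \<i> * complex_of_real \<delta>"
  have "osc_cauchy k g ?z = complex_of_real 1 / (2 * complex_of_real pi) * (LINT \<xi>|lborel. fourier_L2 g \<xi> * fourier_kernel 1 k ?z \<xi>)"
    using \<delta> by (intro osc_cauchy_eq_fourier is_fourier_transform_fourier_L2 g) auto
  also have "(LINT \<xi>|lborel. fourier_L2 g \<xi> * fourier_kernel 1 k ?z \<xi>) = (LINT \<xi>|lborel. fourier_L2 g (k + 1 * \<xi>) * fourier_kernel 1 k ?z (k + 1 * \<xi>))"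
    using lborel_integral_real_affine[of 1 "\<lambda>\<xi>. fourier_L2 g \<xi> * fourier_kernel 1 k ?z \<xi>" k] by simp
  also have "\<dots> = (LINT \<xi>|lborel. exp (\<i> * complex_of_real \<xi> * complex_of_real x) * shifted_transform k g \<delta> \<xi>)"
  proof (rule Bochner_Integration.integral_cong[OF refl])
    fix \<xi>
    have "exp (\<i> * complex_of_real \<xi> * ?z) = exp (\<i> * complex_of_real \<xi> * complex_of_real x) * complex_of_real (exp (- \<delta> * \<xi>))"
      unfolding exp_of_real[symmetric] exp_add[symmetric] by (simp add: algebra_simps)
    then show "fourier_L2 g (k + 1 * \<xi>) * fourier_kernel 1 k ?z (k + 1 * \<xi>) = exp (\<i> * complex_of_real \<xi> * complex_of_real x) * shifted_transform k g \<delta> \<xi>"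
      by (auto simp: fourier_kernel_def shifted_transform_def scaleR_conv_of_real indicator_def add.commute)
  qed
  finally show ?thesis by (simp add: inv_ft_def)
qed

text \<open>The transform of an H1 function is integrable and, shifted by k, dominates all the
  integrands, so the boundary value exists at every x rather than almost everywhere.\<close>

lemma tendsto_osc_cauchy_boundary:
  assumes g: "H1_fun g"
  shows "((\<lambda>e. osc_cauchy k g (complex_of_real x + \<i> * complex_of_real e)) \<longlongrightarrow> inv_ft (shifted_transform k g 0) x) (at_right 0)"
  unfolding tendsto_at_iff_sequentially
proof (intro allI impI)
  fix X :: "nat \<Rightarrow> real" assume X: "\<forall>i. X i \<in> {0<..} - {0}" "X \<longlonglongrightarrow> 0"
  have gL: "L2_fun g" using g by (simp add: H1_fun_def)
  have [measurable]: "fourier_L2 g \<in> borel_measurable borel" using gL by measurable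
  have i: "integrable lborel (\<lambda>\<xi>. cmod (fourier_L2 g (\<xi> + k)))"
    using lborel_integrable_real_affine[OF integrable_norm[OF integrable_fourier_L2[OF g]], of 1 k] by (simp add: add.commute)
  have "(\<lambda>n. inv_ft (shifted_transform k g (X n)) x) \<longlonglongrightarrow> inv_ft (shifted_transform k g 0) x"
    unfolding inv_ft_def
  proof (intro tendsto_intros, rule integral_dominated_convergence[OF _ _ i])
    show "AE \<eta> in lborel. norm (exp (\<i> * complex_of_real \<eta> * complex_of_real x) * shifted_transform k g (X n) \<eta>) \<le> cmod (fourier_L2 g (\<eta> + k))" for n
      using X(1) by (auto simp: norm_mult shifted_transform_def less_imp_le mult_left_le_one_le split: split_indicator)
    show "AE \<eta> in lborel. (\<lambda>n. exp (\<i> * complex_of_real \<eta> * complex_of_real x) * shifted_transform k g (X n) \<eta>) \<longlonglongrightarrow> exp (\<i> * complex_of_real \<eta> * complex_of_real x) * shifted_transform k g 0 \<eta>"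
      unfolding shifted_transform_def by (intro AE_I2 tendsto_intros X(2))
  qed (unfold shifted_transform_def, measurable)
  moreover have "osc_cauchy k g (complex_of_real x + \<i> * complex_of_real (X n)) = inv_ft (shifted_transform k g (X n)) x" for n
    using X(1) by (intro osc_cauchy_eq_inv_ft gL) auto
  ultimately show "((\<lambda>e. osc_cauchy k g (complex_of_real x + \<i> * complex_of_real e)) \<circ> X) \<longlonglongrightarrow> inv_ft (shifted_transform k g 0) x"
    by (simp add: comp_def)
qed

lemma osc_cauchy_plus_eqI:
  "((\<lambda>e. osc_cauchy k g (complex_of_real x + \<i> * complex_of_real e)) \<longlongrightarrow> l) (at_right 0) \<Longrightarrow> osc_cauchy_plus k g x = l"
  unfolding osc_cauchy_plus_def by (rule tendsto_Lim[OF trivial_limit_at_right_real])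

text \<open>The minus sign arises because the error is taken for f minus its interpolant, while the
  estimates concern the interpolant minus f.\<close>

theorem osc_cauchy_error_eq_inv_ft:
  assumes f: "H1_fun f" and r: "H1_fun (\<lambda>x. rat_interp \<beta> n f x - f x)" and \<delta>: "\<delta> \<ge> 0"
  shows "osc_cauchy_error \<beta> k n f \<delta> = inv_ft (\<lambda>\<xi>. - shifted_transform k (\<lambda>x. rat_interp \<beta> n f x - f x) \<delta> \<xi>)"
proof
  fix x
  define g where "g = (\<lambda>x. rat_interp \<beta> n f x - f x)"
  have fL: "L2_fun f" using f by (simp add: H1_fun_def)
  have gL: "L2_fun g" using r by (simp add: H1_fun_def g_def)
  have g: "H1_fun g" using r by (simp add: g_def)
  have rg: "rat_interp \<beta> n f = (\<lambda>x. g x - - f x)" by (simp add: g_def)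
  have rL: "L2_fun (rat_interp \<beta> n f)" unfolding rg using L2_fun_add[OF gL fL] by simp
  have eq: "osc_cauchy k g (complex_of_real x + \<i> * complex_of_real e) = 
     osc_cauchy k (rat_interp \<beta> n f) (complex_of_real x + \<i> * complex_of_real e) - osc_cauchy k f (complex_of_real x + \<i> * complex_of_real e)"
    if "e > 0" for e
    unfolding g_def using that by (intro osc_cauchy_diff fL rL) auto
  have min: "inv_ft (\<lambda>\<xi>. - G \<xi>) x = - inv_ft G x" for G
    by (simp add: inv_ft_def)
  have "osc_cauchy_error \<beta> k n f \<delta> x = - inv_ft (shifted_transform k g \<delta>) x"
  proof (cases "\<delta> = 0")
    case False
    then have d: "\<delta> > 0" using \<delta> by simp
    show ?thesis using False eq[OF d] osc_cauchy_eq_inv_ft[OF gL d, of k x]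
      by (simp add: osc_cauchy_error_def osc_cauchy_approx_def)
  next
    case True
    let ?z = "\<lambda>e. complex_of_real x + \<i> * complex_of_real e"
    have 1: "osc_cauchy_plus k f x = inv_ft (shifted_transform k f 0) x"
      by (rule osc_cauchy_plus_eqI[OF tendsto_osc_cauchy_boundary[OF f]])
    \<comment> \<open>Membership in H1 is at hand for f and for \<open>g\<close>, so the boundary
      value of the interpolant is obtained from their sum.\<close>
    have "((\<lambda>e. osc_cauchy k g (?z e) + osc_cauchy k f (?z e)) \<longlongrightarrow> inv_ft (shifted_transform k g 0) x + inv_ft (shifted_transform k f 0) x) (at_right 0)"
      by (intro tendsto_add tendsto_osc_cauchy_boundary f g)
    moreover have "\<forall>\<^sub>F e in at_right 0. osc_cauchy k g (?z e) + osc_cauchy k f (?z e) = osc_cauchy k (rat_interp \<beta> n f) (?z e)"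
      using eq by (auto simp: eventually_at_right_less intro!: eventually_mono[OF eventually_at_right_less[of 0]])
    ultimately have "((\<lambda>e. osc_cauchy k (rat_interp \<beta> n f) (?z e)) \<longlongrightarrow> inv_ft (shifted_transform k g 0) x + inv_ft (shifted_transform k f 0) x) (at_right 0)"
      by (rule Lim_transform_eventually)
    then have 2: "osc_cauchy_plus k (rat_interp \<beta> n f) x = inv_ft (shifted_transform k g 0) x + inv_ft (shifted_transform k f 0) x"
      by (rule osc_cauchy_plus_eqI)
    show ?thesis using True by (simp add: osc_cauchy_error_def osc_cauchy_approx_plus_def 1 2)
  qed
  then show "osc_cauchy_error \<beta> k n f \<delta> x = inv_ft (\<lambda>\<xi>. - shifted_transform k (\<lambda>x. rat_interp \<beta> n f x - f x) \<delta> \<xi>) x"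
    by (simp add: min g_def)
qed

theorem inv_ft_bounds:
  assumes g: "H1_fun g" and [measurable]: "G \<in> borel_measurable borel"
    and le: "\<And>\<xi>. cmod (G \<xi>) \<le> cmod (fourier_L2 g (\<xi> + k))"
  shows "L2_fun (inv_ft G)" "L2_norm (inv_ft G) \<le> L2_norm g"
    "H1_fun (inv_ft G)" "H1_norm (inv_ft G) \<le> (1 + \<bar>k\<bar>) * H1_norm g"
proof -
  have gL: "L2_fun g" using g by (simp add: H1_fun_def)
  have ft: "is_fourier_transform g (fourier_L2 g)" by (rule is_fourier_transform_fourier_L2[OF gL])
  have [measurable]: "fourier_L2 g \<in> borel_measurable borel" using gL by measurable
  have "integrable lborel (\<lambda>\<xi>. fourier_L2 g (\<xi> + k))"
    using lborel_integrable_real_affine[OF integrable_fourier_L2[OF g], of 1 k] by (simp add: add.commute)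
  then have Gi: "integrable lborel G"
    by (rule Bochner_Integration.integrable_bound) (use le in auto)
  have shift: "(\<integral>\<^sup>+\<xi>. u (\<xi> + k) \<partial>lborel) = (\<integral>\<^sup>+\<xi>. u \<xi> \<partial>lborel)" if [measurable]: "u \<in> borel_measurable borel" for u :: "real \<Rightarrow> ennreal"
    using nn_integral_real_affine[of u 1 k] by (simp add: add.commute)
  have "sq_norm G \<le> (\<integral>\<^sup>+\<xi>. ennreal ((cmod (fourier_L2 g (\<xi> + k)))\<^sup>2) \<partial>lborel)"
    unfolding sq_norm_def by (intro nn_integral_mono ennreal_leI power_mono le) auto
  also have "\<dots> = sq_norm (fourier_L2 g)"
    unfolding sq_norm_def by (rule shift) measurable
  finally have GG: "sq_norm G \<le> sq_norm (fourier_L2 g)" .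
  then have GL: "L2_fun G" using is_fourier_transform_L2[OF ft] by (auto simp: L2_fun_iff_sq_norm)
  show hL: "L2_fun (inv_ft G)" by (rule L2_fun_inv_ft[OF Gi GL])
  have "sq_norm (inv_ft G) \<le> ennreal (1 / (2 * pi)) * sq_norm G" by (rule sq_norm_inv_ft_le[OF Gi])
  also have "\<dots> \<le> ennreal (1 / (2 * pi)) * (ennreal (2 * pi) * sq_norm g)"
    by (intro mult_left_mono order_trans[OF GG] sq_norm_fourier_transform_le[OF gL ft]) auto
  also have "\<dots> = sq_norm g"
    by (simp add: mult.assoc[symmetric] ennreal_mult[symmetric] del: ennreal_numeral)
  finally have "ennreal ((L2_norm (inv_ft G))\<^sup>2) \<le> ennreal ((L2_norm g)\<^sup>2)"
    by (simp add: sq_norm_eq_L2_norm hL gL)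
  then show "L2_norm (inv_ft G) \<le> L2_norm g" by (simp add: power_mono_iff)
  have AE: "AE \<xi> in lborel. fourier_L2 (inv_ft G) \<xi> = G \<xi>"
    by (rule is_fourier_transform_unique[OF _ is_fourier_transform_fourier_L2[OF hL] fourier_inversion[OF Gi GL]]) measurable
  have "sq_norm (weighted (fourier_L2 (inv_ft G))) = sq_norm (weighted G)"
    using AE by (intro sq_norm_cong_AE) (auto simp: weighted_def)
  also have "\<dots> \<le> (\<integral>\<^sup>+\<xi>. ennreal ((1 + \<bar>k\<bar>)\<^sup>2) * ennreal ((cmod (weighted (fourier_L2 g) (\<xi> + k)))\<^sup>2) \<partial>lborel)"
    unfolding sq_norm_def
  proof (intro nn_integral_mono)
    fix \<xi>
    have "1 + \<bar>\<xi>\<bar> \<le> (1 + \<bar>k\<bar>) * (1 + \<bar>\<xi> + k\<bar>)"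
    proof -
      have "\<bar>\<xi>\<bar> \<le> \<bar>k\<bar> + \<bar>\<xi> + k\<bar>" by linarith
      moreover have "0 \<le> \<bar>k\<bar> * \<bar>\<xi> + k\<bar>" by simp
      ultimately show ?thesis unfolding distrib_right distrib_left by linarith
    qed
    then have "(1 + \<bar>\<xi>\<bar>) * cmod (G \<xi>) \<le> ((1 + \<bar>k\<bar>) * (1 + \<bar>\<xi> + k\<bar>)) * cmod (fourier_L2 g (\<xi> + k))"
      by (intro mult_mono le) auto
    then have "((1 + \<bar>\<xi>\<bar>) * cmod (G \<xi>))\<^sup>2 \<le> (((1 + \<bar>k\<bar>) * (1 + \<bar>\<xi> + k\<bar>)) * cmod (fourier_L2 g (\<xi> + k)))\<^sup>2"
      by (rule power_mono) auto
    then show "ennreal ((cmod (weighted G \<xi>))\<^sup>2) \<le> ennreal ((1 + \<bar>k\<bar>)\<^sup>2) * ennreal ((cmod (weighted (fourier_L2 g) (\<xi> + k)))\<^sup>2)"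
      unfolding norm_weighted_power2 by (simp add: ennreal_mult[symmetric] ennreal_leI power_mult_distrib mult_ac)
  qed
  also have "\<dots> = ennreal ((1 + \<bar>k\<bar>)\<^sup>2) * sq_norm (weighted (fourier_L2 g))"
    using shift[of "\<lambda>\<xi>. ennreal ((cmod (weighted (fourier_L2 g) \<xi>))\<^sup>2)"]
    by (subst nn_integral_cmult) (auto simp: sq_norm_def)
  finally have W: "sq_norm (weighted (fourier_L2 (inv_ft G))) \<le> ennreal ((1 + \<bar>k\<bar>)\<^sup>2) * sq_norm (weighted (fourier_L2 g))" .
  moreover have "ennreal ((1 + \<bar>k\<bar>)\<^sup>2) * sq_norm (weighted (fourier_L2 g)) < \<infinity>"
    using g by (auto simp: H1_fun_iff ennreal_mult_less_top)
  ultimately show h: "H1_fun (inv_ft G)" using hL by (auto simp: H1_fun_iff)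
  from W have "ennreal ((H1_norm (inv_ft G))\<^sup>2) \<le> ennreal (((1 + \<bar>k\<bar>) * H1_norm g)\<^sup>2)"
    by (simp add: sq_norm_weighted_eq_H1_norm h g ennreal_mult[symmetric] power_mult_distrib)
  then have "(H1_norm (inv_ft G))\<^sup>2 \<le> ((1 + \<bar>k\<bar>) * H1_norm g)\<^sup>2" by simp
  then show "H1_norm (inv_ft G) \<le> (1 + \<bar>k\<bar>) * H1_norm g"
    by (rule power2_le_imp_le) simp
qed

section \<open>Derivatives and limits in \<open>H\<^sup>1\<close>\<close>

text \<open>Integration by parts on [-R, R]; the boundary terms are kept, to be removed when R tends
  to infinity.\<close>

lemma ft_trunc_derivative:
  assumes deriv: "\<And>x. (p has_vector_derivative p' x) (at x)" and cont: "continuous_on UNIV p'"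
    and R: "R \<ge> 0"
  shows "ft (trunc R p') \<xi> = exp (- \<i> * complex_of_real \<xi> * complex_of_real R) * p R
     - exp (- \<i> * complex_of_real \<xi> * complex_of_real (- R)) * p (- R) + \<i> * complex_of_real \<xi> * ft (trunc R p) \<xi>"
proof -
  let ?e = "\<lambda>x. exp (- \<i> * complex_of_real \<xi> * complex_of_real x)"
  have contp: "continuous_on UNIV p"
    using deriv by (intro continuous_at_imp_continuous_on ballI has_vector_derivative_continuous)
  have i1: "integrable lborel (\<lambda>x. indicator {-R..R} x *\<^sub>R (?e x * p' x))"
    and i2: "integrable lborel (\<lambda>x. indicator {-R..R} x *\<^sub>R (\<i> * complex_of_real \<xi> * (?e x * p x)))"
    unfolding set_integrable_def[symmetric]
    by (rule borel_integrable_atLeastAtMost', intro continuous_intros continuous_on_subset[OF cont] continuous_on_subset[OF contp]; simp)+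
  have "(LINT x|lborel. indicator {-R..R} x *\<^sub>R (?e x * p' x - \<i> * complex_of_real \<xi> * (?e x * p x))) = ?e R * p R - ?e (- R) * p (- R)"
  proof (rule integral_FTC_atLeastAtMost)
    show "((\<lambda>x. ?e x * p x) has_vector_derivative ?e x * p' x - \<i> * complex_of_real \<xi> * (?e x * p x)) (at x within {-R..R})" for x
    proof -
      have "(?e has_vector_derivative ?e x * (- \<i> * complex_of_real \<xi>)) (at x)"
        by (auto intro!: derivative_eq_intros has_vector_derivative_real_field)
      from has_vector_derivative_mult[OF this deriv]
      have "((\<lambda>x. ?e x * p x) has_vector_derivative ?e x * p' x - \<i> * complex_of_real \<xi> * (?e x * p x)) (at x)"
        by (simp add: algebra_simps)
      then show ?thesis by (rule has_vector_derivative_at_within)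
    qed
    show "continuous_on {-R..R} (\<lambda>x. ?e x * p' x - \<i> * complex_of_real \<xi> * (?e x * p x))"
      by (intro continuous_intros continuous_on_subset[OF cont] continuous_on_subset[OF contp]) auto
  qed (use R in auto)
  also have "(LINT x|lborel. indicator {-R..R} x *\<^sub>R (?e x * p' x - \<i> * complex_of_real \<xi> * (?e x * p x))) =
     (LINT x|lborel. indicator {-R..R} x *\<^sub>R (?e x * p' x)) - (LINT x|lborel. indicator {-R..R} x *\<^sub>R (\<i> * complex_of_real \<xi> * (?e x * p x)))"
    unfolding scaleR_diff_right by (rule Bochner_Integration.integral_diff[OF i1 i2])
  also have "(LINT x|lborel. indicator {-R..R} x *\<^sub>R (?e x * p' x)) = ft (trunc R p') \<xi>"
    unfolding ft_trunc set_lebesgue_integral_def ..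
  also have "(LINT x|lborel. indicator {-R..R} x *\<^sub>R (\<i> * complex_of_real \<xi> * (?e x * p x))) = (LINT x|lborel. \<i> * complex_of_real \<xi> * (indicator {-R..R} x *\<^sub>R (?e x * p x)))"
    by simp
  also have "\<dots> = \<i> * complex_of_real \<xi> * ft (trunc R p) \<xi>"
    unfolding integral_mult_right_zero ft_trunc set_lebesgue_integral_def ..
  finally show ?thesis by (simp add: algebra_simps)
qed

text \<open>The truncated transforms converge pointwise only almost everywhere along subsequences.
  The second subsequence is taken inside the first, so that both transforms converge along the same
  radii; the boundary terms die because p vanishes at both ends.\<close>

lemma fourier_transform_derivative_AE:
  assumes deriv: "\<And>x. (p has_vector_derivative p' x) (at x)" and cont: "continuous_on UNIV p'"
    and p: "L2_fun p" "is_fourier_transform p ph" and p': "L2_fun p'" "is_fourier_transform p' qh"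
    and top: "(p \<longlongrightarrow> 0) at_top" and bot: "(p \<longlongrightarrow> 0) at_bot"
  shows "AE \<xi> in lborel. qh \<xi> = \<i> * complex_of_real \<xi> * ph \<xi>"
proof -
  have [measurable]: "p \<in> borel_measurable borel" "p' \<in> borel_measurable borel" "ph \<in> borel_measurable borel" "qh \<in> borel_measurable borel"
    using p p' by (auto dest!: is_fourier_transform_L2)
  obtain r1 :: "nat \<Rightarrow> nat" where r1: "strict_mono r1" "AE \<xi> in lborel. (\<lambda>n. ft (trunc (real (r1 n)) p) \<xi>) \<longlonglongrightarrow> ph \<xi>"
    using sq_norm_tendsto_imp_AE_subseq[OF _ _ is_fourier_transform_seq[OF p(2)]] by auto
  have "(\<lambda>n. sq_norm (\<lambda>\<xi>. qh \<xi> - ft (trunc (real (r1 n)) p') \<xi>)) \<longlonglongrightarrow> 0"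
    using LIMSEQ_subseq_LIMSEQ[OF is_fourier_transform_seq[OF p'(2)] r1(1)] by (simp add: comp_def)
  then obtain r2 :: "nat \<Rightarrow> nat" where r2: "strict_mono r2" "AE \<xi> in lborel. (\<lambda>n. ft (trunc (real (r1 (r2 n))) p') \<xi>) \<longlonglongrightarrow> qh \<xi>"
    using sq_norm_tendsto_imp_AE_subseq[of "\<lambda>n. ft (trunc (real (r1 n)) p')" qh] by auto
  have rr: "filterlim (\<lambda>n. real (r1 (r2 n))) at_top sequentially"
    by (intro filterlim_compose[OF filterlim_real_sequentially] filterlim_compose[OF filterlim_subseq[OF r1(1)]] filterlim_subseq r2)
  from r1(2) r2(2) show ?thesis
  proof eventually_elim
    case (elim \<xi>)
    let ?r = "\<lambda>n. real (r1 (r2 n))"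
    let ?b1 = "\<lambda>n. exp (- \<i> * complex_of_real \<xi> * complex_of_real (?r n)) * p (?r n)"
    let ?b2 = "\<lambda>n. exp (- \<i> * complex_of_real \<xi> * complex_of_real (- ?r n)) * p (- ?r n)"
    have ne: "cmod (exp (- \<i> * complex_of_real \<xi> * complex_of_real x)) = 1" for x by (simp add: norm_exp_eq_Re)
    have t1: "(\<lambda>n. p (?r n)) \<longlonglongrightarrow> 0" by (rule filterlim_compose[OF top rr])
    have t2: "(\<lambda>n. p (- ?r n)) \<longlonglongrightarrow> 0"
      using filterlim_compose[OF bot filterlim_compose[OF filterlim_uminus_at_bot_at_top rr]] .
    have b1: "?b1 \<longlonglongrightarrow> 0" using tendsto_norm_zero[OF t1] by (intro tendsto_norm_zero_cancel[of ?b1]) (simp only: norm_mult ne mult_1)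
    have b2: "?b2 \<longlonglongrightarrow> 0" using tendsto_norm_zero[OF t2] by (intro tendsto_norm_zero_cancel[of ?b2]) (simp only: norm_mult ne mult_1)
    have t3: "(\<lambda>n. ft (trunc (?r n) p) \<xi>) \<longlonglongrightarrow> ph \<xi>"
      using LIMSEQ_subseq_LIMSEQ[OF elim(1) r2(1)] by (simp add: comp_def)
    have "(\<lambda>n. ?b1 n - ?b2 n + \<i> * complex_of_real \<xi> * ft (trunc (?r n) p) \<xi>) \<longlonglongrightarrow> 0 - 0 + \<i> * complex_of_real \<xi> * ph \<xi>"
      by (intro tendsto_intros b1 b2 t3)
    then have "(\<lambda>n. ft (trunc (?r n) p') \<xi>) \<longlonglongrightarrow> \<i> * complex_of_real \<xi> * ph \<xi>"
      using ft_trunc_derivative[OF deriv cont] by simp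
    from LIMSEQ_unique[OF elim(2) this] show ?case .
  qed
qed

text \<open>From (1 + |\<xi>|)^2 <= 2 + 2 \<xi>^2, as \<xi> times the transform of p has the modulus
  of the transform of p'. The constant is 2 times the Plancherel constant 2 pi.\<close>

theorem sq_norm_weighted_le_derivative:
  assumes deriv: "\<And>x. (p has_vector_derivative p' x) (at x)" and cont: "continuous_on UNIV p'"
    and p: "L2_fun p" and p': "L2_fun p'"
    and top: "(p \<longlongrightarrow> 0) at_top" and bot: "(p \<longlongrightarrow> 0) at_bot"
  shows "sq_norm (weighted (fourier_L2 p)) \<le> ennreal (4 * pi) * (sq_norm p + sq_norm p')"
proof -
  let ?ph = "fourier_L2 p" and ?qh = "fourier_L2 p'"
  note ft = is_fourier_transform_fourier_L2[OF p] is_fourier_transform_fourier_L2[OF p']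
  have [measurable]: "?ph \<in> borel_measurable borel" "?qh \<in> borel_measurable borel" using p p' by measurable
  have "sq_norm (weighted ?ph) \<le> (\<integral>\<^sup>+\<xi>. 2 * ennreal ((cmod (?ph \<xi>))\<^sup>2) + 2 * ennreal ((cmod (?qh \<xi>))\<^sup>2) \<partial>lborel)"
    unfolding sq_norm_def
  proof (rule nn_integral_mono_AE)
    show "AE \<xi> in lborel. ennreal ((cmod (weighted ?ph \<xi>))\<^sup>2) \<le> 2 * ennreal ((cmod (?ph \<xi>))\<^sup>2) + 2 * ennreal ((cmod (?qh \<xi>))\<^sup>2)"
      using fourier_transform_derivative_AE[OF deriv cont p ft(1) p' ft(2) top bot]
    proof eventually_elim
      case (elim \<xi>)
      have "(1 + \<bar>\<xi>\<bar>)\<^sup>2 \<le> 2 + 2 * \<xi>\<^sup>2"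
        using sum_squares_bound[of 1 "\<bar>\<xi>\<bar>"] by (simp add: power2_sum)
      then have "(1 + \<bar>\<xi>\<bar>)\<^sup>2 * (cmod (?ph \<xi>))\<^sup>2 \<le> (2 + 2 * \<xi>\<^sup>2) * (cmod (?ph \<xi>))\<^sup>2"
        by (rule mult_right_mono) simp
      also have "\<dots> = 2 * (cmod (?ph \<xi>))\<^sup>2 + 2 * (cmod (?qh \<xi>))\<^sup>2"
        by (simp add: elim norm_mult power_mult_distrib algebra_simps)
      finally have "ennreal ((cmod (weighted ?ph \<xi>))\<^sup>2) \<le> ennreal (2 * (cmod (?ph \<xi>))\<^sup>2 + 2 * (cmod (?qh \<xi>))\<^sup>2)"
        unfolding norm_weighted_power2 by (rule ennreal_leI)
      then show ?case by (simp add: ennreal_mult)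
    qed
  qed
  also have "\<dots> = 2 * sq_norm ?ph + 2 * sq_norm ?qh"
    unfolding sq_norm_def by (simp add: nn_integral_add nn_integral_cmult)
  also have "\<dots> \<le> 2 * (ennreal (2 * pi) * sq_norm p) + 2 * (ennreal (2 * pi) * sq_norm p')"
    by (intro add_mono mult_left_mono sq_norm_fourier_transform_le p p' ft) auto
  also have "\<dots> = ennreal (4 * pi) * (sq_norm p + sq_norm p')"
    by (simp add: mult.assoc[symmetric] ennreal_mult distrib_left)
  finally show ?thesis .
qed

text \<open>Lower semicontinuity of the H1 norm under L2 convergence: the transforms converge in L2
  by Plancherel, hence almost everywhere along a subsequence.\<close>

theorem sq_norm_weighted_limit_le:
  assumes p: "\<And>n. L2_fun (p n)" and g: "L2_fun g"
    and lim: "(\<lambda>n. sq_norm (\<lambda>x. g x - p n x)) \<longlonglongrightarrow> 0"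
    and le: "\<forall>\<^sub>F n in sequentially. sq_norm (weighted (fourier_L2 (p n))) \<le> B"
  shows "sq_norm (weighted (fourier_L2 g)) \<le> B"
proof -
  have [measurable]: "fourier_L2 (p n) \<in> borel_measurable borel" "fourier_L2 g \<in> borel_measurable borel" for n
    using p g by auto
  have le2: "sq_norm (\<lambda>\<xi>. fourier_L2 g \<xi> - fourier_L2 (p n) \<xi>) \<le> ennreal (2 * pi) * sq_norm (\<lambda>x. g x - p n x)" for n
    by (intro sq_norm_fourier_transform_le L2_fun_diff is_fourier_transform_diff is_fourier_transform_fourier_L2 p g)
  have lim2: "(\<lambda>n. ennreal (2 * pi) * sq_norm (\<lambda>x. g x - p n x)) \<longlonglongrightarrow> 0"
    using ennreal_tendsto_cmult[OF _ lim, of "ennreal (2 * pi)"] by simp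
  have "(\<lambda>n. sq_norm (\<lambda>\<xi>. fourier_L2 g \<xi> - fourier_L2 (p n) \<xi>)) \<longlonglongrightarrow> 0"
    by (rule tendsto_sandwich[OF _ _ tendsto_const lim2]) (auto intro!: always_eventually le2)
  then obtain r :: "nat \<Rightarrow> nat" where r: "strict_mono r" "AE \<xi> in lborel. (\<lambda>n. fourier_L2 (p (r n)) \<xi>) \<longlonglongrightarrow> fourier_L2 g \<xi>"
    using sq_norm_tendsto_imp_AE_subseq[of "\<lambda>n. fourier_L2 (p n)" "fourier_L2 g"] by auto
  show ?thesis unfolding sq_norm_def[of "weighted (fourier_L2 g)"]
  proof (rule nn_integral_limit_le)
    show "AE \<xi> in lborel. (\<lambda>n. ennreal ((cmod (weighted (fourier_L2 (p (r n))) \<xi>))\<^sup>2)) \<longlonglongrightarrow> ennreal ((cmod (weighted (fourier_L2 g) \<xi>))\<^sup>2)"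
      using r(2) unfolding weighted_def by eventually_elim (intro tendsto_intros tendsto_ennrealI)
    show "\<forall>\<^sub>F n in sequentially. (\<integral>\<^sup>+\<xi>. ennreal ((cmod (weighted (fourier_L2 (p (r n))) \<xi>))\<^sup>2) \<partial>lborel) \<le> B"
      using eventually_subseq[OF r(1) le] by (simp add: sq_norm_def)
  qed measurable
qed

section \<open>Powers of the Moebius map\<close>

definition moebius_pow :: "real \<Rightarrow> int \<Rightarrow> real \<Rightarrow> complex" where
  "moebius_pow \<beta> m x = moebius \<beta> (complex_of_real x) powi m"

text \<open>This is |M'| on the line, the derivative of the angle corresponding to x; it is also the
  unnormalised Poisson kernel of height \<beta> centred at 0, which gives its mass 2 pi.\<close>

definition circle_weight :: "real \<Rightarrow> real \<Rightarrow> real" where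
  "circle_weight \<beta> x = 2 * \<beta> / (\<beta>\<^sup>2 + x\<^sup>2)"

lemma moebius_denominators_nonzero:
  assumes "\<beta> > 0"
  shows "complex_of_real x + \<i> * complex_of_real \<beta> \<noteq> 0" "complex_of_real x - \<i> * complex_of_real \<beta> \<noteq> 0"
  using assms by (auto simp: complex_eq_iff)

lemma norm_moebius [simp]:
  assumes "\<beta> > 0"
  shows "cmod (moebius \<beta> (complex_of_real x)) = 1"
proof -
  have "cnj (complex_of_real x - \<i> * complex_of_real \<beta>) = complex_of_real x + \<i> * complex_of_real \<beta>" by simp
  then have "cmod (complex_of_real x - \<i> * complex_of_real \<beta>) = cmod (complex_of_real x + \<i> * complex_of_real \<beta>)"
    by (metis complex_mod_cnj)
  then show ?thesis using moebius_denominators_nonzero[OF assms] by (simp add: moebius_def norm_divide)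
qed

lemma moebius_nonzero [simp]:
  assumes "\<beta> > 0"
  shows "moebius \<beta> (complex_of_real x) \<noteq> 0"
  using norm_moebius[OF assms, of x] by (metis norm_zero zero_neq_one)

lemma norm_moebius_pow [simp]: "\<beta> > 0 \<Longrightarrow> cmod (moebius_pow \<beta> m x) = 1"
  by (simp add: moebius_pow_def norm_power_int)

lemma moebius_pow_0 [simp]: "moebius_pow \<beta> 0 x = 1"
  by (simp add: moebius_pow_def)

lemma moebius_pow_add: "\<beta> > 0 \<Longrightarrow> moebius_pow \<beta> (m + l) x = moebius_pow \<beta> m x * moebius_pow \<beta> l x"
  by (simp add: moebius_pow_def power_int_add)

lemma cnj_moebius_pow:
  assumes "\<beta> > 0"
  shows "cnj (moebius_pow \<beta> m x) = moebius_pow \<beta> (- m) x"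
proof -
  have "moebius_pow \<beta> m x * cnj (moebius_pow \<beta> m x) = 1"
    using complex_norm_square[of "moebius_pow \<beta> m x"] assms by simp
  moreover have "moebius_pow \<beta> m x * moebius_pow \<beta> (- m) x = 1"
    using moebius_pow_add[OF assms, of m "-m" x] by simp
  moreover have "moebius_pow \<beta> m x \<noteq> 0" using norm_moebius_pow[OF assms, of m x] by (metis norm_zero zero_neq_one)
  ultimately show ?thesis by (metis mult_left_cancel)
qed

text \<open>The left side is M', so the logarithmic derivative of M on the line is i times the
  weight; hence each power M^m is differentiated into i m times the weight times itself.\<close>

lemma moebius_weight:
  assumes "\<beta> > 0"
  shows "2 * \<i> * complex_of_real \<beta> / (complex_of_real x + \<i> * complex_of_real \<beta>)\<^sup>2 =
    moebius \<beta> (complex_of_real x) * (\<i> * complex_of_real (circle_weight \<beta> x))"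
proof -
  define p q where "p = complex_of_real x + \<i> * complex_of_real \<beta>" and "q = complex_of_real x - \<i> * complex_of_real \<beta>"
  have nz: "p \<noteq> 0" "q \<noteq> 0" using moebius_denominators_nonzero[OF assms, of x] by (auto simp: p_def q_def)
  have "complex_of_real (\<beta>\<^sup>2 + x\<^sup>2) = p * q" by (simp add: p_def q_def algebra_simps power2_eq_square)
  then have "complex_of_real (circle_weight \<beta> x) = 2 * complex_of_real \<beta> / (p * q)"
    unfolding circle_weight_def of_real_divide by simp
  then show ?thesis unfolding moebius_def p_def[symmetric] q_def[symmetric]
    using nz by (simp add: field_simps power2_eq_square)
qed

lemma has_vector_derivative_moebius_pow:
  assumes "\<beta> > 0"
  shows "(moebius_pow \<beta> m has_vector_derivative \<i> * of_int m * complex_of_real (circle_weight \<beta> x) * moebius_pow \<beta> m x) (at x)"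
proof -
  let ?M = "moebius \<beta>"
  have "(?M has_field_derivative 2 * \<i> * complex_of_real \<beta> / (complex_of_real x + \<i> * complex_of_real \<beta>)\<^sup>2) (at (complex_of_real x))"
    unfolding moebius_def[abs_def] using moebius_denominators_nonzero[OF assms, of x]
    by (auto intro!: derivative_eq_intros simp: power2_eq_square field_simps)
  then have "(?M has_field_derivative ?M (complex_of_real x) * (\<i> * complex_of_real (circle_weight \<beta> x))) (at (complex_of_real x))"
    by (simp only: moebius_weight[OF assms])
  from DERIV_power_int[OF this, of m]
  have "((\<lambda>z. ?M z powi m) has_field_derivative of_int m * ?M (complex_of_real x) powi (m - 1) * (?M (complex_of_real x) * (\<i> * complex_of_real (circle_weight \<beta> x)))) (at (complex_of_real x))"
    using assms by simp
  moreover have "of_int m * ?M (complex_of_real x) powi (m - 1) * (?M (complex_of_real x) * (\<i> * complex_of_real (circle_weight \<beta> x))) =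
     \<i> * of_int m * complex_of_real (circle_weight \<beta> x) * moebius_pow \<beta> m x"
    using assms by (simp add: moebius_pow_def power_int_diff)
  ultimately show ?thesis
    unfolding moebius_pow_def[abs_def] using has_vector_derivative_real_field by force
qed

lemma continuous_circle_weight: "\<beta> > 0 \<Longrightarrow> continuous_on UNIV (circle_weight \<beta>)"
  unfolding circle_weight_def[abs_def] by (intro continuous_intros) (auto simp: add_nonneg_eq_0_iff)

lemma continuous_moebius_pow: "\<beta> > 0 \<Longrightarrow> continuous_on UNIV (moebius_pow \<beta> m)"
  using has_vector_derivative_moebius_pow by (intro continuous_at_imp_continuous_on ballI has_vector_derivative_continuous)

lemma circle_weight_measurable [measurable]: "circle_weight \<beta> \<in> borel_measurable borel"
  unfolding circle_weight_def[abs_def] by measurable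

lemma moebius_pow_measurable: "\<beta> > 0 \<Longrightarrow> moebius_pow \<beta> m \<in> borel_measurable borel"
  by (rule borel_measurable_continuous_onI[OF continuous_moebius_pow])

lemma circle_weight_nonneg [simp]: "\<beta> > 0 \<Longrightarrow> circle_weight \<beta> x \<ge> 0"
  unfolding circle_weight_def by (intro divide_nonneg_nonneg) auto

lemma circle_weight_le: "\<beta> > 0 \<Longrightarrow> circle_weight \<beta> x \<le> 2 / \<beta>"
proof -
  assume "\<beta> > 0"
  then have "2 * \<beta> / (\<beta>\<^sup>2 + x\<^sup>2) \<le> 2 * \<beta> / \<beta>\<^sup>2"
    by (intro divide_left_mono) (auto intro!: mult_pos_pos add_pos_nonneg)
  also have "\<dots> = 2 / \<beta>" using \<open>\<beta> > 0\<close> by (simp add: power2_eq_square)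
  finally show ?thesis by (simp add: circle_weight_def)
qed

lemma nn_integral_circle_weight: "\<beta> > 0 \<Longrightarrow> (\<integral>\<^sup>+x. ennreal (circle_weight \<beta> x) \<partial>lborel) = ennreal (2 * pi)"
  using nn_integral_poisson_kernel[of \<beta> 0] by (simp add: circle_weight_def)

lemma has_bochner_integral_circle_weight: "\<beta> > 0 \<Longrightarrow> has_bochner_integral lborel (circle_weight \<beta>) (2 * pi)"
  by (rule has_bochner_integral_nn_integral) (auto simp: nn_integral_circle_weight)

text \<open>It turns the unweighted norm of a multiple of M - 1 into a norm weighted by
  \<open>circle_weight\<close>, where the powers of M are orthogonal.\<close>

lemma norm_moebius_diff_1:
  assumes "\<beta> > 0"
  shows "(cmod (moebius \<beta> (complex_of_real x) - 1))\<^sup>2 = 2 * \<beta> * circle_weight \<beta> x"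
proof -
  have nz: "complex_of_real x + \<i> * complex_of_real \<beta> \<noteq> 0" by (rule moebius_denominators_nonzero[OF assms])
  have "moebius \<beta> (complex_of_real x) - 1 = (- 2 * \<i> * complex_of_real \<beta>) / (complex_of_real x + \<i> * complex_of_real \<beta>)"
    using nz by (simp add: moebius_def field_simps)
  then have "(cmod (moebius \<beta> (complex_of_real x) - 1))\<^sup>2 = (2 * \<beta>)\<^sup>2 / (x\<^sup>2 + \<beta>\<^sup>2)"
    using assms by (simp add: norm_divide power_divide norm_mult cmod_power2)
  also have "\<dots> = 2 * \<beta> * circle_weight \<beta> x"
    by (simp add: circle_weight_def power2_eq_square add.commute)
  finally show ?thesis .
qed

lemma tendsto_circle_weight:
  assumes "\<beta> > 0"
  shows "(circle_weight \<beta> \<longlongrightarrow> 0) at_top" "(circle_weight \<beta> \<longlongrightarrow> 0) at_bot"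
proof -
  have sq: "filterlim (\<lambda>x::real. x\<^sup>2) at_top at_top" "filterlim (\<lambda>x::real. x\<^sup>2) at_top at_bot"
    by (auto intro: filterlim_pow_at_top filterlim_ident filterlim_pow_at_bot_even)
  have "filterlim (\<lambda>x::real. \<beta>\<^sup>2 + x\<^sup>2) at_top F" if "filterlim (\<lambda>x::real. x\<^sup>2) at_top F" for F
    by (rule filterlim_tendsto_add_at_top[OF tendsto_const that])
  then have "((\<lambda>x. 2 * \<beta> / (\<beta>\<^sup>2 + x\<^sup>2)) \<longlongrightarrow> 0) F" if "filterlim (\<lambda>x::real. x\<^sup>2) at_top F" for F
    using that by (intro tendsto_divide_0[OF tendsto_const] filterlim_at_top_imp_at_infinity) auto
  with sq show "(circle_weight \<beta> \<longlongrightarrow> 0) at_top" "(circle_weight \<beta> \<longlongrightarrow> 0) at_bot"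
    unfolding circle_weight_def[abs_def] by auto
qed

text \<open>The point at infinity corresponds to 1 on the circle. All powers share this limit, so
  differences of powers vanish at both ends of the line.\<close>

lemma tendsto_moebius_pow:
  assumes "\<beta> > 0" and F: "(circle_weight \<beta> \<longlongrightarrow> 0) F"
  shows "(moebius_pow \<beta> m \<longlongrightarrow> 1) F"
proof -
  have "((\<lambda>x. sqrt (2 * \<beta> * circle_weight \<beta> x)) \<longlongrightarrow> sqrt (2 * \<beta> * 0)) F"
    by (intro tendsto_intros F)
  then have "((\<lambda>x. cmod (moebius \<beta> (complex_of_real x) - 1)) \<longlongrightarrow> 0) F"
    unfolding norm_moebius_diff_1[OF assms(1), symmetric] by simp
  then have "((\<lambda>x. moebius \<beta> (complex_of_real x)) \<longlongrightarrow> 1) F"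
    by (rule LIM_zero_cancel[OF tendsto_norm_zero_cancel])
  then have "((\<lambda>x. moebius \<beta> (complex_of_real x) powi m) \<longlongrightarrow> 1 powi m) F"
    by (intro tendsto_intros) auto
  then show ?thesis by (simp add: moebius_pow_def[abs_def])
qed

text \<open>For m different from 0 the antiderivative M^m/(i m) has the same limit at both ends of
  the line.\<close>

lemma has_bochner_integral_moebius_pow:
  assumes "\<beta> > 0"
  shows "has_bochner_integral lborel (\<lambda>x. complex_of_real (circle_weight \<beta> x) * moebius_pow \<beta> m x) (if m = 0 then 2 * complex_of_real pi else 0)"
proof (cases "m = 0")
  case True
  have "has_bochner_integral lborel (\<lambda>x. complex_of_real (circle_weight \<beta> x)) (complex_of_real (2 * pi))"
    by (rule has_bochner_integral_of_real[OF has_bochner_integral_circle_weight[OF assms]])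
  then show ?thesis using True by simp
next
  case False
  note [measurable] = moebius_pow_measurable[OF assms]
  have i: "integrable lborel (\<lambda>x. complex_of_real (circle_weight \<beta> x) * moebius_pow \<beta> m x)"
    by (rule Bochner_Integration.integrable_bound[OF integrable.intros[OF has_bochner_integral_circle_weight[OF assms]]])
       (use assms in \<open>auto simp: norm_mult\<close>)
  let ?F = "\<lambda>x. moebius_pow \<beta> m x / (\<i> * of_int m)"
  have lim: "(?F \<longlongrightarrow> 1 / (\<i> * of_int m)) F" if "(circle_weight \<beta> \<longlongrightarrow> 0) F" for F
    using False by (intro tendsto_intros tendsto_moebius_pow assms that) auto
  have "(LBINT x=-\<infinity>..\<infinity>. complex_of_real (circle_weight \<beta> x) * moebius_pow \<beta> m x) = 1 / (\<i> * of_int m) - 1 / (\<i> * of_int m)"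
  proof (rule interval_integral_FTC_integrable[where F="?F"])
    show "(?F has_vector_derivative complex_of_real (circle_weight \<beta> x) * moebius_pow \<beta> m x) (at x)" for x
      using has_vector_derivative_divide[OF has_vector_derivative_moebius_pow[OF assms, of m x], of "\<i> * of_int m"] False
      by (simp add: field_simps)
    show "isCont (\<lambda>x. complex_of_real (circle_weight \<beta> x) * moebius_pow \<beta> m x) x" for x
      using continuous_circle_weight[OF assms] continuous_moebius_pow[OF assms, of m]
      by (intro continuous_intros) (auto simp: continuous_on_eq_continuous_at)
    show "set_integrable lborel (einterval (-\<infinity>) \<infinity>) (\<lambda>x. complex_of_real (circle_weight \<beta> x) * moebius_pow \<beta> m x)"
      using i by (simp add: set_integrable_def)
  qed (unfold ereal_tendsto_simps, auto intro!: lim tendsto_circle_weight assms)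
  then have "(LINT x|lborel. complex_of_real (circle_weight \<beta> x) * moebius_pow \<beta> m x) = 0"
    by (simp add: interval_lebesgue_integral_def set_lebesgue_integral_def)
  with i False show ?thesis by (simp add: has_bochner_integral_iff)
qed

text \<open>Parseval for finite sums: expanding the square leaves only the diagonal terms.\<close>

lemma nn_integral_trig_sum:
  assumes b: "\<beta> > 0" and A: "finite A"
  shows "(\<integral>\<^sup>+x. ennreal (circle_weight \<beta> x * (cmod (\<Sum>m\<in>A. c m * moebius_pow \<beta> m x))\<^sup>2) \<partial>lborel) = ennreal (2 * pi * (\<Sum>m\<in>A. (cmod (c m))\<^sup>2))"
proof -
  let ?Q = "\<lambda>x. \<Sum>m\<in>A. c m * moebius_pow \<beta> m x"
  note [measurable] = moebius_pow_measurable[OF b]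
  have eq: "complex_of_real (circle_weight \<beta> x * (cmod (?Q x))\<^sup>2) =
     (\<Sum>m\<in>A. \<Sum>l\<in>A. c m * cnj (c l) * (complex_of_real (circle_weight \<beta> x) * moebius_pow \<beta> (m - l) x))" for x
  proof -
    have "moebius_pow \<beta> m x * cnj (moebius_pow \<beta> l x) = moebius_pow \<beta> (m - l) x" for m l
      using moebius_pow_add[OF b, of m "- l" x] by (simp add: cnj_moebius_pow[OF b])
    then have *: "c m * moebius_pow \<beta> m x * (cnj (c l) * cnj (moebius_pow \<beta> l x)) = c m * cnj (c l) * moebius_pow \<beta> (m - l) x" for m l
      by (metis (no_types, lifting) mult.assoc mult.left_commute)
    have "complex_of_real ((cmod (?Q x))\<^sup>2) = ?Q x * cnj (?Q x)" by (rule complex_norm_square)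
    also have "\<dots> = (\<Sum>m\<in>A. \<Sum>l\<in>A. c m * cnj (c l) * moebius_pow \<beta> (m - l) x)"
      by (simp add: sum_product *)
    finally show ?thesis
      unfolding of_real_mult by (simp only: sum_distrib_left mult_ac)
  qed
  have "has_bochner_integral lborel (\<lambda>x. complex_of_real (circle_weight \<beta> x * (cmod (?Q x))\<^sup>2))
     (\<Sum>m\<in>A. \<Sum>l\<in>A. c m * cnj (c l) * (if m - l = 0 then 2 * complex_of_real pi else 0))"
    unfolding eq by (intro has_bochner_integral_sum has_bochner_integral_mult_right has_bochner_integral_moebius_pow b)
  also have "(\<Sum>m\<in>A. \<Sum>l\<in>A. c m * cnj (c l) * (if m - l = 0 then 2 * complex_of_real pi else 0)) = complex_of_real (2 * pi * (\<Sum>m\<in>A. (cmod (c m))\<^sup>2))"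
  proof -
    have "(\<Sum>l\<in>A. c m * cnj (c l) * (if m - l = 0 then 2 * complex_of_real pi else 0)) = complex_of_real (2 * pi * (cmod (c m))\<^sup>2)" if "m \<in> A" for m
    proof -
      have "(\<Sum>l\<in>A. c m * cnj (c l) * (if m - l = 0 then 2 * complex_of_real pi else 0)) = (\<Sum>l\<in>A. if m = l then c m * cnj (c m) * (2 * complex_of_real pi) else 0)"
        by (intro sum.cong) auto
      also have "\<dots> = c m * cnj (c m) * (2 * complex_of_real pi)" using A that by simp
      also have "\<dots> = complex_of_real (2 * pi * (cmod (c m))\<^sup>2)"
        unfolding complex_norm_square[symmetric] by simp
      finally show ?thesis .
    qed
    then show ?thesis by (simp add: sum_distrib_left)
  qed
  finally have "has_bochner_integral lborel (\<lambda>x. complex_of_real (circle_weight \<beta> x * (cmod (?Q x))\<^sup>2)) (complex_of_real (2 * pi * (\<Sum>m\<in>A. (cmod (c m))\<^sup>2)))" .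
  from has_bochner_integral_Re[OF this]
  have "has_bochner_integral lborel (\<lambda>x. circle_weight \<beta> x * (cmod (?Q x))\<^sup>2) (2 * pi * (\<Sum>m\<in>A. (cmod (c m))\<^sup>2))"
    by simp
  then show ?thesis
    using b by (subst nn_integral_eq_integral) (auto simp: has_bochner_integral_iff)
qed

text \<open>M^k - 1 is M - 1 times a geometric sum of k powers; |M - 1|^2 is 2 \<beta> times the
  weight, and Parseval counts the k terms with 2 pi each.\<close>

lemma sq_norm_moebius_pow_diff_aux:
  assumes b: "\<beta> > 0"
  shows "sq_norm (\<lambda>x. moebius_pow \<beta> (int k) x - 1) = ennreal (4 * pi * \<beta> * real k)"
proof -
  note [measurable] = moebius_pow_measurable[OF b]
  have "(cmod (moebius_pow \<beta> (int k) x - 1))\<^sup>2 = 2 * \<beta> * (circle_weight \<beta> x * (cmod (\<Sum>m\<in>int ` {..<k}. 1 * moebius_pow \<beta> m x))\<^sup>2)" for x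
  proof -
    have "moebius_pow \<beta> (int k) x - 1 = (moebius \<beta> (complex_of_real x) - 1) * (\<Sum>i<k. moebius \<beta> (complex_of_real x) ^ i)"
      by (simp add: moebius_pow_def power_diff_1_eq)
    also have "(\<Sum>i<k. moebius \<beta> (complex_of_real x) ^ i) = (\<Sum>m\<in>int ` {..<k}. 1 * moebius_pow \<beta> m x)"
      by (subst sum.reindex) (auto simp: moebius_pow_def inj_on_def)
    finally show ?thesis by (simp add: norm_mult power_mult_distrib norm_moebius_diff_1[OF b] mult_ac)
  qed
  then have "sq_norm (\<lambda>x. moebius_pow \<beta> (int k) x - 1) = (\<integral>\<^sup>+x. ennreal (2 * \<beta>) * ennreal (circle_weight \<beta> x * (cmod (\<Sum>m\<in>int ` {..<k}. 1 * moebius_pow \<beta> m x))\<^sup>2) \<partial>lborel)"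
    unfolding sq_norm_def using b by (simp add: ennreal_mult[symmetric] del: ennreal_numeral)
  also have "\<dots> = ennreal (2 * \<beta>) * ennreal (2 * pi * (\<Sum>m\<in>int ` {..<k}. (cmod 1)\<^sup>2))"
    by (subst nn_integral_cmult) (simp_all only: nn_integral_trig_sum[OF b finite_imageI[OF finite_lessThan]], measurable)
  also have "\<dots> = ennreal (4 * pi * \<beta> * real k)"
    using b by (subst ennreal_mult[symmetric]) (auto simp: card_image inj_on_def mult_ac)
  finally show ?thesis .
qed

lemma sq_norm_moebius_pow_diff:
  assumes b: "\<beta> > 0"
  shows "sq_norm (\<lambda>x. moebius_pow \<beta> m x - moebius_pow \<beta> l x) = ennreal (4 * pi * \<beta> * real_of_int \<bar>m - l\<bar>)"
proof -
  have *: "sq_norm (\<lambda>x. moebius_pow \<beta> m x - moebius_pow \<beta> l x) = ennreal (4 * pi * \<beta> * real_of_int \<bar>m - l\<bar>)" if "l \<le> m" for m l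
  proof -
    have "moebius_pow \<beta> m x - moebius_pow \<beta> l x = moebius_pow \<beta> l x * (moebius_pow \<beta> (int (nat (m - l))) x - 1)" for x
      using moebius_pow_add[OF b, of l "m - l" x] that by (simp add: algebra_simps)
    then have "sq_norm (\<lambda>x. moebius_pow \<beta> m x - moebius_pow \<beta> l x) = sq_norm (\<lambda>x. moebius_pow \<beta> (int (nat (m - l))) x - 1)"
      unfolding sq_norm_def using b by (simp add: norm_mult)
    then show ?thesis using that by (simp only: sq_norm_moebius_pow_diff_aux[OF b]) simp
  qed
  show ?thesis
  proof (cases "l \<le> m")
    case False
    then show ?thesis using *[of m l] by (subst sq_norm_minus_commute) (simp add: abs_minus_commute)
  qed (rule *)
qed

section \<open>Aliasing errors\<close>

definition interp_modes :: "nat \<Rightarrow> int set" where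
  "interp_modes n = {- int ((n - 1) div 2)..int (n div 2)}"

text \<open>The shift by \<open>(n - 1) div 2\<close> before and after reduction moves the residues
  0, ..., n - 1 onto the retained window, which is not centred when n is even.\<close>

definition alias_mode :: "nat \<Rightarrow> int \<Rightarrow> int" where
  "alias_mode n m = (m + int ((n - 1) div 2)) mod int n - int ((n - 1) div 2)"

lemma finite_interp_modes [simp]: "finite (interp_modes n)"
  by (simp add: interp_modes_def)

lemma alias_mode_in_modes:
  assumes "n > 0"
  shows "alias_mode n m \<in> interp_modes n"
proof -
  have "0 \<le> (m + int ((n - 1) div 2)) mod int n" "(m + int ((n - 1) div 2)) mod int n < int n" using assms by auto
  \<comment> \<open>The window has exactly n elements whatever the parity of n.\<close>
  moreover have "int n - 1 - int ((n - 1) div 2) = int (n div 2)" using assms by linarith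
  ultimately show ?thesis unfolding alias_mode_def interp_modes_def atLeastAtMost_iff by linarith
qed

lemma dvd_diff_alias_mode: "int n dvd m - alias_mode n m"
proof -
  have "m - alias_mode n m = m + int ((n - 1) div 2) - (m + int ((n - 1) div 2)) mod int n"
    by (simp add: alias_mode_def)
  then show ?thesis by (metis dvd_minus_mod)
qed

lemma alias_mode_unique:
  assumes n: "n > 0" and k: "k \<in> interp_modes n" and dvd: "int n dvd m - k"
  shows "alias_mode n m = k"
proof -
  have 0: "0 \<le> k + int ((n - 1) div 2)" "k + int ((n - 1) div 2) < int n"
    using n k by (auto simp: interp_modes_def) 
  have "(m + int ((n - 1) div 2)) mod int n = (k + int ((n - 1) div 2)) mod int n"
    using dvd by (auto simp: mod_eq_dvd_iff)
  also have "\<dots> = k + int ((n - 1) div 2)" using 0 by (rule mod_pos_pos_trivial)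
  finally show ?thesis by (simp add: alias_mode_def)
qed

lemma two_abs_interp_modes_le: "k \<in> interp_modes n \<Longrightarrow> 2 * \<bar>k\<bar> \<le> int n"
  by (auto simp: interp_modes_def abs_if)

lemma le_two_abs_notin_interp_modes:
  assumes "m \<notin> interp_modes n" "n > 0"
  shows "int n \<le> 2 * \<bar>m\<bar>"
  using assms by (auto simp: interp_modes_def abs_if)

text \<open>The nonnegative and the negative part of a finite index set each inject into the
  naturals by absolute value. The bound depends on the exponent only, which keeps the final constant
  independent of f and n.\<close>

lemma powr_sum_bound:
  assumes "a > (1::real)"
  shows "\<exists>Z\<ge>0. \<forall>A::int set. finite A \<longrightarrow> 0 \<notin> A \<longrightarrow> (\<Sum>m\<in>A. real_of_int \<bar>m\<bar> powr (- a)) \<le> Z"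
proof (intro exI[of _ "2 * (\<Sum>n. real n powr (- a))"] conjI allI impI)
  have s: "summable (\<lambda>n. real n powr (- a))" using assms by (simp add: summable_real_powr_iff)
  show "0 \<le> 2 * (\<Sum>n. real n powr (- a))" using s by (intro mult_nonneg_nonneg suminf_nonneg) auto
  fix A :: "int set" assume A: "finite A" "0 \<notin> A"
  have half: "(\<Sum>m\<in>B. real_of_int \<bar>m\<bar> powr (- a)) \<le> (\<Sum>n. real n powr (- a))"
    if "finite B" "inj_on (\<lambda>m. nat \<bar>m\<bar>) B" for B :: "int set"
  proof -
    have "(\<Sum>m\<in>B. real_of_int \<bar>m\<bar> powr (- a)) = (\<Sum>n\<in>(\<lambda>m. nat \<bar>m\<bar>) ` B. real n powr (- a))"
      using that by (simp add: sum.reindex)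
    also have "\<dots> \<le> (\<Sum>n. real n powr (- a))" using that s by (intro sum_le_suminf) auto
    finally show ?thesis .
  qed
  have "(\<Sum>m\<in>A. real_of_int \<bar>m\<bar> powr (- a)) = (\<Sum>m\<in>A \<inter> {0..}. real_of_int \<bar>m\<bar> powr (- a)) + (\<Sum>m\<in>A - {0..}. real_of_int \<bar>m\<bar> powr (- a))"
    by (rule sum.Int_Diff[OF A(1)])
  also have "\<dots> \<le> (\<Sum>n. real n powr (- a)) + (\<Sum>n. real n powr (- a))"
    using A by (intro add_mono half) (auto simp: inj_on_def)
  finally show "(\<Sum>m\<in>A. real_of_int \<bar>m\<bar> powr (- a)) \<le> 2 * (\<Sum>n. real n powr (- a))" by simp
qed

text \<open>The weights are left free: |m|^(-1-2\<epsilon>) is used for the error itself, |m|^(-2s)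
  for the aliased part of its derivative.\<close>

lemma weighted_Cauchy_Schwarz:
  fixes c :: "'a \<Rightarrow> complex" and a :: "'a \<Rightarrow> real"
  assumes "\<And>m. m \<in> A \<Longrightarrow> a m > 0"
  shows "(cmod (\<Sum>m\<in>A. c m))\<^sup>2 \<le> (\<Sum>m\<in>A. a m) * (\<Sum>m\<in>A. (cmod (c m))\<^sup>2 / a m)"
proof -
  have "(cmod (\<Sum>m\<in>A. c m))\<^sup>2 \<le> (\<Sum>m\<in>A. cmod (c m))\<^sup>2"
    by (intro power_mono norm_sum) simp
  also have "(\<Sum>m\<in>A. cmod (c m)) = (\<Sum>m\<in>A. sqrt (a m) * (cmod (c m) / sqrt (a m)))"
  proof (rule sum.cong[OF refl])
    fix m assume "m \<in> A"
    then have "sqrt (a m) \<noteq> 0" using assms[of m] by auto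
    then show "cmod (c m) = sqrt (a m) * (cmod (c m) / sqrt (a m))" by simp
  qed
  also have "(\<dots>)\<^sup>2 \<le> (\<Sum>m\<in>A. (sqrt (a m))\<^sup>2) * (\<Sum>m\<in>A. (cmod (c m) / sqrt (a m))\<^sup>2)"
    by (rule Cauchy_Schwarz_ineq_sum)
  also have "\<dots> = (\<Sum>m\<in>A. a m) * (\<Sum>m\<in>A. (cmod (c m))\<^sup>2 / a m)"
    using assms by (intro arg_cong2[where f="(*)"] sum.cong refl) (auto simp: power_divide less_imp_le)
  finally show ?thesis .
qed

text \<open>The interpolation error of \<open>\<Sum>\<^bsub>m\<in>A\<^esub> c\<^sub>m M\<^sup>m\<close>.\<close>

definition alias_error :: "real \<Rightarrow> nat \<Rightarrow> int set \<Rightarrow> (int \<Rightarrow> complex) \<Rightarrow> real \<Rightarrow> complex" where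
  "alias_error \<beta> n A c x = (\<Sum>m\<in>A. c m * (moebius_pow \<beta> (alias_mode n m) x - moebius_pow \<beta> m x))"

text \<open>The common factor, i times the weight, is pulled out, leaving two sums of powers of M to
  which Parseval applies.\<close>

definition alias_error_deriv :: "real \<Rightarrow> nat \<Rightarrow> int set \<Rightarrow> (int \<Rightarrow> complex) \<Rightarrow> real \<Rightarrow> complex" where
  "alias_error_deriv \<beta> n A c x = \<i> * complex_of_real (circle_weight \<beta> x) *
     ((\<Sum>m\<in>A. c m * of_int (alias_mode n m) * moebius_pow \<beta> (alias_mode n m) x) - (\<Sum>m\<in>A. c m * of_int m * moebius_pow \<beta> m x))"

lemma alias_error_properties:
  assumes b: "\<beta> > 0"
  shows "(alias_error \<beta> n A c has_vector_derivative alias_error_deriv \<beta> n A c x) (at x)"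
    "continuous_on UNIV (alias_error_deriv \<beta> n A c)"
    "continuous_on UNIV (alias_error \<beta> n A c)"
    "(alias_error \<beta> n A c \<longlongrightarrow> 0) at_top" "(alias_error \<beta> n A c \<longlongrightarrow> 0) at_bot"
proof -
  have e: "alias_error_deriv \<beta> n A c x = (\<Sum>m\<in>A. c m * (\<i> * of_int (alias_mode n m) * complex_of_real (circle_weight \<beta> x) * moebius_pow \<beta> (alias_mode n m) x
      - \<i> * of_int m * complex_of_real (circle_weight \<beta> x) * moebius_pow \<beta> m x))" for x
    unfolding alias_error_deriv_def right_diff_distrib sum_distrib_left sum_subtractf by (simp only: mult_ac)
  show d: "(alias_error \<beta> n A c has_vector_derivative alias_error_deriv \<beta> n A c x) (at x)" for x
    unfolding alias_error_def[abs_def] e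
    by (intro has_vector_derivative_sum has_vector_derivative_mult_right has_vector_derivative_diff has_vector_derivative_moebius_pow b)
  show "continuous_on UNIV (alias_error_deriv \<beta> n A c)"
    unfolding alias_error_deriv_def[abs_def]
    by (intro continuous_intros continuous_circle_weight continuous_moebius_pow b)
  show "continuous_on UNIV (alias_error \<beta> n A c)"
    unfolding alias_error_def[abs_def] by (intro continuous_intros continuous_moebius_pow b)
  have "(alias_error \<beta> n A c \<longlongrightarrow> (\<Sum>m\<in>A. c m * (1 - 1))) F" if "(circle_weight \<beta> \<longlongrightarrow> 0) F" for F
    unfolding alias_error_def[abs_def] by (intro tendsto_intros tendsto_moebius_pow b that)
  then show "(alias_error \<beta> n A c \<longlongrightarrow> 0) at_top" "(alias_error \<beta> n A c \<longlongrightarrow> 0) at_bot"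
    using tendsto_circle_weight[OF b] by auto
qed

text \<open>Lacking orthogonality of the differences M^r - M^m in the unweighted norm, the sum is
  split by a weighted Cauchy-Schwarz inequality, and each difference contributes its exact
  norm.\<close>

lemma sq_norm_alias_error_le:
  assumes b: "\<beta> > 0" and A: "finite A" and a: "\<And>m. m \<in> A \<Longrightarrow> a m > 0"
  shows "sq_norm (alias_error \<beta> n A c) \<le>
    ennreal ((\<Sum>m\<in>A. a m) * (\<Sum>m\<in>A. (cmod (c m))\<^sup>2 / a m * (4 * pi * \<beta> * real_of_int \<bar>alias_mode n m - m\<bar>)))"
proof -
  note [measurable] = moebius_pow_measurable[OF b]
  let ?d = "\<lambda>m x. moebius_pow \<beta> (alias_mode n m) x - moebius_pow \<beta> m x"
  have nn: "(cmod (c m))\<^sup>2 / a m \<ge> 0" if "m \<in> A" for m using a[OF that] by simp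
  have sa: "(\<Sum>m\<in>A. a m) \<ge> 0" using a by (intro sum_nonneg less_imp_le)
  have "sq_norm (alias_error \<beta> n A c) \<le> (\<integral>\<^sup>+x. ennreal (\<Sum>m\<in>A. a m) * (\<Sum>m\<in>A. ennreal ((cmod (c m))\<^sup>2 / a m) * ennreal ((cmod (?d m x))\<^sup>2)) \<partial>lborel)"
    unfolding sq_norm_def
  proof (rule nn_integral_mono)
    fix x
    have "(cmod (alias_error \<beta> n A c x))\<^sup>2 \<le> (\<Sum>m\<in>A. a m) * (\<Sum>m\<in>A. (cmod (c m * ?d m x))\<^sup>2 / a m)"
      unfolding alias_error_def by (rule weighted_Cauchy_Schwarz[OF a])
    also have "(\<Sum>m\<in>A. (cmod (c m * ?d m x))\<^sup>2 / a m) = (\<Sum>m\<in>A. (cmod (c m))\<^sup>2 / a m * (cmod (?d m x))\<^sup>2)"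
      by (simp add: norm_mult power_mult_distrib)
    finally have "ennreal ((cmod (alias_error \<beta> n A c x))\<^sup>2) \<le> ennreal ((\<Sum>m\<in>A. a m) * (\<Sum>m\<in>A. (cmod (c m))\<^sup>2 / a m * (cmod (?d m x))\<^sup>2))"
      by (rule ennreal_leI)
    also have "\<dots> = ennreal (\<Sum>m\<in>A. a m) * ennreal (\<Sum>m\<in>A. (cmod (c m))\<^sup>2 / a m * (cmod (?d m x))\<^sup>2)"
      by (rule ennreal_mult[OF sa]) (intro sum_nonneg mult_nonneg_nonneg nn; simp)
    also have "ennreal (\<Sum>m\<in>A. (cmod (c m))\<^sup>2 / a m * (cmod (?d m x))\<^sup>2) = (\<Sum>m\<in>A. ennreal ((cmod (c m))\<^sup>2 / a m) * ennreal ((cmod (?d m x))\<^sup>2))"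
      by (subst sum_ennreal[symmetric]) (auto intro!: mult_nonneg_nonneg nn sum.cong ennreal_mult simp del: times_divide_eq_left times_divide_eq_right)
    finally show "ennreal ((cmod (alias_error \<beta> n A c x))\<^sup>2) \<le> ennreal (\<Sum>m\<in>A. a m) * (\<Sum>m\<in>A. ennreal ((cmod (c m))\<^sup>2 / a m) * ennreal ((cmod (?d m x))\<^sup>2))" .
  qed
  also have "\<dots> = ennreal (\<Sum>m\<in>A. a m) * (\<Sum>m\<in>A. ennreal ((cmod (c m))\<^sup>2 / a m) * sq_norm (?d m))"
    unfolding sq_norm_def by (simp add: nn_integral_cmult nn_integral_sum)
  also have "(\<Sum>m\<in>A. ennreal ((cmod (c m))\<^sup>2 / a m) * sq_norm (?d m)) = ennreal (\<Sum>m\<in>A. (cmod (c m))\<^sup>2 / a m * (4 * pi * \<beta> * real_of_int \<bar>alias_mode n m - m\<bar>))"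
    unfolding sq_norm_moebius_pow_diff[OF b] using b
    by (subst sum_ennreal[symmetric]) (auto intro!: mult_nonneg_nonneg nn sum.cong ennreal_mult[symmetric] simp del: times_divide_eq_left times_divide_eq_right)
  also have "ennreal (\<Sum>m\<in>A. a m) * \<dots> = ennreal ((\<Sum>m\<in>A. a m) * (\<Sum>m\<in>A. (cmod (c m))\<^sup>2 / a m * (4 * pi * \<beta> * real_of_int \<bar>alias_mode n m - m\<bar>)))"
    using b by (intro ennreal_mult[OF sa, symmetric] sum_nonneg mult_nonneg_nonneg nn) auto
  finally show ?thesis .
qed

text \<open>One factor of the squared weight is bounded by 2/\<beta>, the other is kept for
  Parseval. Several m may alias to the same mode, so their coefficients are collected by residue
  class before orthogonality is used.\<close>

lemma sq_norm_alias_error_deriv_le: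
  assumes b: "\<beta> > 0" and A: "finite A" and n: "n > 0"
  shows "sq_norm (alias_error_deriv \<beta> n A c) \<le>
    ennreal (8 * pi / \<beta> * ((\<Sum>k\<in>interp_modes n. (cmod (of_int k * (\<Sum>m\<in>{m \<in> A. alias_mode n m = k}. c m)))\<^sup>2)
        + (\<Sum>m\<in>A. (cmod (c m * of_int m))\<^sup>2)))"
proof -
  note [measurable] = moebius_pow_measurable[OF b]
  let ?d = "\<lambda>k. of_int k * (\<Sum>m\<in>{m \<in> A. alias_mode n m = k}. c m)"
  let ?Q1 = "\<lambda>x. \<Sum>k\<in>interp_modes n. ?d k * moebius_pow \<beta> k x"
  let ?Q2 = "\<lambda>x. \<Sum>m\<in>A. c m * of_int m * moebius_pow \<beta> m x"
  have Q1: "(\<Sum>m\<in>A. c m * of_int (alias_mode n m) * moebius_pow \<beta> (alias_mode n m) x) = ?Q1 x" for x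
  proof -
    have "(\<Sum>m\<in>A. c m * of_int (alias_mode n m) * moebius_pow \<beta> (alias_mode n m) x) =
       (\<Sum>k\<in>interp_modes n. \<Sum>m\<in>{m \<in> A. alias_mode n m = k}. c m * of_int (alias_mode n m) * moebius_pow \<beta> (alias_mode n m) x)"
      using A alias_mode_in_modes[OF n] by (intro sum.group[symmetric]) auto
    also have "\<dots> = ?Q1 x"
      by (intro sum.cong refl) (simp add: sum_distrib_left sum_distrib_right mult_ac)
    finally show ?thesis .
  qed
  have "sq_norm (alias_error_deriv \<beta> n A c) \<le> (\<integral>\<^sup>+x. ennreal (4 / \<beta>) * (ennreal (circle_weight \<beta> x * (cmod (?Q1 x))\<^sup>2) + ennreal (circle_weight \<beta> x * (cmod (?Q2 x))\<^sup>2)) \<partial>lborel)"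
    unfolding sq_norm_def
  proof (rule nn_integral_mono)
    fix x
    let ?w = "circle_weight \<beta> x"
    have w: "?w \<ge> 0" "?w \<le> 2 / \<beta>" using b circle_weight_le[OF b] by auto
    have "(cmod (alias_error_deriv \<beta> n A c x))\<^sup>2 = ?w\<^sup>2 * (cmod (?Q1 x + - ?Q2 x))\<^sup>2"
      unfolding alias_error_deriv_def Q1 by (simp add: norm_mult power_mult_distrib)
    also have "\<dots> \<le> (2 / \<beta> * ?w) * (2 * (cmod (?Q1 x))\<^sup>2 + 2 * (cmod (- ?Q2 x))\<^sup>2)"
      using w b norm_add_power2_le[of "?Q1 x" "- ?Q2 x"] unfolding power2_eq_square[of ?w]
      by (intro mult_mono mult_right_mono) auto
    also have "\<dots> = 4 / \<beta> * (?w * (cmod (?Q1 x))\<^sup>2 + ?w * (cmod (?Q2 x))\<^sup>2)"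
      by (simp add: field_simps)
    finally have "ennreal ((cmod (alias_error_deriv \<beta> n A c x))\<^sup>2) \<le> ennreal (4 / \<beta> * (?w * (cmod (?Q1 x))\<^sup>2 + ?w * (cmod (?Q2 x))\<^sup>2))"
      by (rule ennreal_leI)
    also have "\<dots> = ennreal (4 / \<beta>) * (ennreal (?w * (cmod (?Q1 x))\<^sup>2) + ennreal (?w * (cmod (?Q2 x))\<^sup>2))"
      unfolding ennreal_plus[OF mult_nonneg_nonneg[OF w(1) zero_le_power2] mult_nonneg_nonneg[OF w(1) zero_le_power2], symmetric]
      using w(1) b by (intro ennreal_mult add_nonneg_nonneg mult_nonneg_nonneg) auto
    finally show "ennreal ((cmod (alias_error_deriv \<beta> n A c x))\<^sup>2) \<le> ennreal (4 / \<beta>) * (ennreal (?w * (cmod (?Q1 x))\<^sup>2) + ennreal (?w * (cmod (?Q2 x))\<^sup>2))" .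
  qed
  also have "\<dots> = ennreal (4 / \<beta>) * ((\<integral>\<^sup>+x. ennreal (circle_weight \<beta> x * (cmod (?Q1 x))\<^sup>2) \<partial>lborel) + (\<integral>\<^sup>+x. ennreal (circle_weight \<beta> x * (cmod (?Q2 x))\<^sup>2) \<partial>lborel))"
    by (simp add: nn_integral_cmult nn_integral_add)
  also have "\<dots> = ennreal (4 / \<beta>) * (ennreal (2 * pi * (\<Sum>k\<in>interp_modes n. (cmod (?d k))\<^sup>2)) + ennreal (2 * pi * (\<Sum>m\<in>A. (cmod (c m * of_int m))\<^sup>2)))"
    unfolding nn_integral_trig_sum[OF b finite_interp_modes] nn_integral_trig_sum[OF b A] ..
  also have "\<dots> = ennreal (4 / \<beta> * (2 * pi * (\<Sum>k\<in>interp_modes n. (cmod (?d k))\<^sup>2) + 2 * pi * (\<Sum>m\<in>A. (cmod (c m * of_int m))\<^sup>2)))"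
  proof -
    have nn: "2 * pi * (\<Sum>k\<in>K. (cmod (u k))\<^sup>2) \<ge> 0" for K :: "int set" and u
      by (intro mult_nonneg_nonneg sum_nonneg) auto
    show ?thesis unfolding ennreal_plus[OF nn nn, symmetric]
      using b nn by (intro ennreal_mult[symmetric] add_nonneg_nonneg) auto
  qed
  also have "4 / \<beta> * (2 * pi * (\<Sum>k\<in>interp_modes n. (cmod (?d k))\<^sup>2) + 2 * pi * (\<Sum>m\<in>A. (cmod (c m * of_int m))\<^sup>2)) =
     8 * pi / \<beta> * ((\<Sum>k\<in>interp_modes n. (cmod (?d k))\<^sup>2) + (\<Sum>m\<in>A. (cmod (c m * of_int m))\<^sup>2))"
    by (simp add: field_simps)
  finally show ?thesis .
qed

text \<open>The error itself needs |m|^(2+2\<epsilon>) against the squared coefficients; outside the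
  retained modes |m| is at least n/2, which converts the excess smoothness into a power of n. The
  aliased part of the derivative gets its decay from the sparsity of each residue class.\<close>

theorem alias_error_bound:
  fixes \<beta> \<epsilon> s :: real
  assumes b: "\<beta> > 0" and e: "\<epsilon> > 0" and s: "s > 1 + \<epsilon>"
  shows "\<exists>C\<ge>0. \<forall>n>1. \<forall>A c. finite A \<longrightarrow> A \<inter> interp_modes n = {} \<longrightarrow>
    sq_norm (alias_error \<beta> n A c) + sq_norm (alias_error_deriv \<beta> n A c) \<le>
      ennreal (C * real n powr (2 * (1 + \<epsilon> - s)) * (\<Sum>m\<in>A. (1 + \<bar>real_of_int m\<bar>) powr (2 * s) * (cmod (c m))\<^sup>2))"
proof -
  define q where "q = 2 * (1 + \<epsilon> - s)"
  have q: "q < 0" using s by (simp add: q_def)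
  obtain Z where Z: "Z \<ge> 0" "\<And>A::int set. finite A \<Longrightarrow> 0 \<notin> A \<Longrightarrow> (\<Sum>m\<in>A. real_of_int \<bar>m\<bar> powr (- (1 + 2 * \<epsilon>))) \<le> Z"
    using powr_sum_bound[of "1 + 2 * \<epsilon>"] e by auto
  obtain Y where Y: "Y \<ge> 0" "\<And>A::int set. finite A \<Longrightarrow> 0 \<notin> A \<Longrightarrow> (\<Sum>m\<in>A. real_of_int \<bar>m\<bar> powr (- (2 * s))) \<le> Y"
    using powr_sum_bound[of "2 * s"] e s by auto
  \<comment> \<open>The 8 is 4, from the norm of M^r - M^m, times 2, from |r - m| <= 2|m|;
    \<open>2 powr (- q)\<close> comes from |m| >= n/2.\<close>
  define C1 where "C1 = Z * (8 * pi * \<beta>) * 2 powr (- q)"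
  define C2 where "C2 = 8 * pi / \<beta> * (2 powr (2 * s) * Y + 2 powr (- q))"
  show ?thesis
  proof (intro exI[of _ "C1 + C2"] conjI allI impI)
    have C0: "C1 \<ge> 0" "C2 \<ge> 0" using b Z(1) Y(1) by (auto simp: C1_def C2_def)
    then show "C1 + C2 \<ge> 0" by simp
    fix n :: nat and A :: "int set" and c :: "int \<Rightarrow> complex"
    assume n: "1 < n" and A: "finite A" and dis: "A \<inter> interp_modes n = {}"
    define S where "S = (\<Sum>m\<in>A. (1 + \<bar>real_of_int m\<bar>) powr (2 * s) * (cmod (c m))\<^sup>2)"
    have S0: "S \<ge> 0" unfolding S_def by (intro sum_nonneg) auto
    have n0: "n > 0" using n by simp
    have mA: "int n \<le> 2 * \<bar>m\<bar>" "m \<noteq> 0" "real_of_int \<bar>m\<bar> \<ge> 1" "real n / 2 \<le> real_of_int \<bar>m\<bar>" if "m \<in> A" for m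
    proof -
      show 1: "int n \<le> 2 * \<bar>m\<bar>" using le_two_abs_notin_interp_modes[of m n] dis that n0 by auto
      then show 2: "m \<noteq> 0" using n by auto
      then show "real_of_int \<bar>m\<bar> \<ge> 1" by linarith
      show "real n / 2 \<le> real_of_int \<bar>m\<bar>" using 1 by linarith
    qed
    have al: "2 * \<bar>alias_mode n m\<bar> \<le> int n" for m
      using two_abs_interp_modes_le[OF alias_mode_in_modes[OF n0]] .
    have zA: "0 \<notin> A" using mA(2) by auto
    have div_powr: "x / real_of_int \<bar>m\<bar> powr (- t) = x * real_of_int \<bar>m\<bar> powr t" for x t m
      by (simp only: powr_minus divide_inverse inverse_inverse_eq)
    \<comment> \<open>The exponent splits as 2 + 2\<epsilon> = q + 2s; since q < 0, the first power
      is at most its value at n/2.\<close>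
    have key: "real_of_int \<bar>m\<bar> powr (2 + 2 * \<epsilon>) \<le> 2 powr (- q) * real n powr q * (1 + \<bar>real_of_int m\<bar>) powr (2 * s)" if m: "m \<in> A" for m
    proof -
      have "real_of_int \<bar>m\<bar> powr (2 + 2 * \<epsilon>) = real_of_int \<bar>m\<bar> powr q * real_of_int \<bar>m\<bar> powr (2 * s)"
        by (simp add: powr_add[symmetric] q_def algebra_simps)
      also have "\<dots> \<le> (real n / 2) powr q * (1 + \<bar>real_of_int m\<bar>) powr (2 * s)"
        using q s e n0 mA(4)[OF m] by (intro mult_mono powr_mono2' powr_mono2) auto
      also have "(real n / 2) powr q = 2 powr (- q) * real n powr q"
        using n0 by (simp add: powr_divide powr_minus field_simps)
      finally show ?thesis .
    qed
    have sumkey: "(\<Sum>m\<in>A. (cmod (c m))\<^sup>2 * real_of_int \<bar>m\<bar> powr (2 + 2 * \<epsilon>)) \<le> 2 powr (- q) * real n powr q * S"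
    proof -
      have "(\<Sum>m\<in>A. (cmod (c m))\<^sup>2 * real_of_int \<bar>m\<bar> powr (2 + 2 * \<epsilon>)) \<le> (\<Sum>m\<in>A. (cmod (c m))\<^sup>2 * (2 powr (- q) * real n powr q * (1 + \<bar>real_of_int m\<bar>) powr (2 * s)))"
        by (intro sum_mono mult_left_mono key) auto
      also have "\<dots> = 2 powr (- q) * real n powr q * S"
        unfolding S_def sum_distrib_left by (simp only: mult_ac)
      finally show ?thesis .
    qed
    have 1: "sq_norm (alias_error \<beta> n A c) \<le> ennreal (C1 * real n powr q * S)"
    proof -
      \<comment> \<open>Making these weights summable is what costs the \<open>\<epsilon>\<close>.\<close>
      let ?a = "\<lambda>m. real_of_int \<bar>m\<bar> powr (- (1 + 2 * \<epsilon>))"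
      have term_le: "(cmod (c m))\<^sup>2 / ?a m * (4 * pi * \<beta> * real_of_int \<bar>alias_mode n m - m\<bar>) \<le> 8 * pi * \<beta> * ((cmod (c m))\<^sup>2 * real_of_int \<bar>m\<bar> powr (2 + 2 * \<epsilon>))" if m: "m \<in> A" for m
      proof -
        \<comment> \<open>From 2|r| <= n <= 2|m|, where r is the alias of m.\<close>
        have "\<bar>alias_mode n m - m\<bar> \<le> 2 * \<bar>m\<bar>" using al[of m] mA(1)[OF m] by linarith
        then have "real_of_int \<bar>alias_mode n m - m\<bar> \<le> 2 * real_of_int \<bar>m\<bar>" by linarith
        then have "(cmod (c m))\<^sup>2 / ?a m * (4 * pi * \<beta> * real_of_int \<bar>alias_mode n m - m\<bar>) \<le> (cmod (c m))\<^sup>2 / ?a m * (4 * pi * \<beta> * (2 * real_of_int \<bar>m\<bar>))"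
          using b by (intro mult_left_mono) auto
        also have "\<dots> = 8 * pi * \<beta> * ((cmod (c m))\<^sup>2 * (real_of_int \<bar>m\<bar> powr (1 + 2 * \<epsilon>) * real_of_int \<bar>m\<bar> powr 1))"
          using mA(3)[OF m] unfolding div_powr by simp
        also have "real_of_int \<bar>m\<bar> powr (1 + 2 * \<epsilon>) * real_of_int \<bar>m\<bar> powr 1 = real_of_int \<bar>m\<bar> powr (2 + 2 * \<epsilon>)"
          unfolding powr_add[symmetric] by (simp add: algebra_simps)
        finally show "(cmod (c m))\<^sup>2 / ?a m * (4 * pi * \<beta> * real_of_int \<bar>alias_mode n m - m\<bar>) \<le> 8 * pi * \<beta> * ((cmod (c m))\<^sup>2 * real_of_int \<bar>m\<bar> powr (2 + 2 * \<epsilon>))" .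
      qed
      have "sq_norm (alias_error \<beta> n A c) \<le> ennreal ((\<Sum>m\<in>A. ?a m) * (\<Sum>m\<in>A. (cmod (c m))\<^sup>2 / ?a m * (4 * pi * \<beta> * real_of_int \<bar>alias_mode n m - m\<bar>)))"
        by (rule sq_norm_alias_error_le[OF b A]) (use mA(2) in auto)
      also have "\<dots> \<le> ennreal (Z * (\<Sum>m\<in>A. 8 * pi * \<beta> * ((cmod (c m))\<^sup>2 * real_of_int \<bar>m\<bar> powr (2 + 2 * \<epsilon>))))"
        using b by (intro ennreal_leI mult_mono[OF Z(2)[OF A zA] sum_mono[OF term_le]] Z(1) sum_nonneg mult_nonneg_nonneg) auto
      also have "\<dots> = ennreal (Z * (8 * pi * \<beta>) * (\<Sum>m\<in>A. (cmod (c m))\<^sup>2 * real_of_int \<bar>m\<bar> powr (2 + 2 * \<epsilon>)))"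
        by (simp only: sum_distrib_left[symmetric] mult.assoc)
      also have "\<dots> \<le> ennreal (Z * (8 * pi * \<beta>) * (2 powr (- q) * real n powr q * S))"
        using b Z(1) by (intro ennreal_leI mult_left_mono sumkey) auto
      also have "\<dots> = ennreal (C1 * real n powr q * S)" by (simp only: C1_def mult_ac)
      finally show ?thesis .
    qed
    have 2: "(\<Sum>m\<in>A. (cmod (c m * of_int m))\<^sup>2) \<le> 2 powr (- q) * real n powr q * S"
    proof (rule order_trans[OF _ sumkey], rule sum_mono)
      fix m assume m: "m \<in> A"
      have "(cmod (c m * of_int m))\<^sup>2 = (cmod (c m))\<^sup>2 * real_of_int \<bar>m\<bar> powr 2"
        using mA(3)[OF m] by (simp add: norm_mult power_mult_distrib)
      also have "\<dots> \<le> (cmod (c m))\<^sup>2 * real_of_int \<bar>m\<bar> powr (2 + 2 * \<epsilon>)"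
        using mA(3)[OF m] e by (intro mult_left_mono powr_mono) auto
      finally show "(cmod (c m * of_int m))\<^sup>2 \<le> (cmod (c m))\<^sup>2 * real_of_int \<bar>m\<bar> powr (2 + 2 * \<epsilon>)" .
    qed
    have 3: "(\<Sum>k\<in>interp_modes n. (cmod (of_int k * (\<Sum>m\<in>{m \<in> A. alias_mode n m = k}. c m)))\<^sup>2) \<le> 2 powr (2 * s) * Y * real n powr q * S"
    proof -
      have kk: "(cmod (of_int k * (\<Sum>m\<in>{m \<in> A. alias_mode n m = k}. c m)))\<^sup>2 \<le>
         2 powr (2 * s) * Y * real n powr q * (\<Sum>m\<in>{m \<in> A. alias_mode n m = k}. (1 + \<bar>real_of_int m\<bar>) powr (2 * s) * (cmod (c m))\<^sup>2)" if k: "k \<in> interp_modes n" for k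
      proof -
        let ?B = "{m \<in> A. alias_mode n m = k}"
        \<comment> \<open>With these weights the second factor of Cauchy-Schwarz is bounded by the
          part of the Sobolev sum in this residue class.\<close>
        let ?a = "\<lambda>m. real_of_int \<bar>m\<bar> powr (- (2 * s))"
        let ?T = "\<Sum>m\<in>?B. (1 + \<bar>real_of_int m\<bar>) powr (2 * s) * (cmod (c m))\<^sup>2"
        have T0: "?T \<ge> 0" by (intro sum_nonneg) auto
        have kn: "2 * \<bar>k\<bar> \<le> int n" by (rule two_abs_interp_modes_le[OF k])
        \<comment> \<open>The index of m within the residue class of k; it is injective there and
          never 0, because k is a retained mode and so not in \<open>A\<close>.\<close>
        define j where "j m = (m - k) div int n" for m
        have jm: "m = k + int n * j m" if "m \<in> ?B" for m
        proof -
          have "int n dvd m - k" using that dvd_diff_alias_mode[of n m] by auto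
          then show ?thesis by (simp add: j_def)
        qed
        have inj: "inj_on j ?B" by (rule inj_onI) (metis jm)
        have j0: "0 \<notin> j ` ?B"
        proof
          assume "0 \<in> j ` ?B"
          then obtain m where "m \<in> ?B" "j m = 0" by auto
          then have "m = k" "m \<in> A" using jm[of m] by auto
          then show False using k dis by auto
        qed
        have sa: "(\<Sum>m\<in>?B. ?a m) \<le> (real n / 2) powr (- (2 * s)) * Y"
        proof -
          have "(\<Sum>m\<in>?B. ?a m) \<le> (\<Sum>m\<in>?B. (real n / 2) powr (- (2 * s)) * real_of_int \<bar>j m\<bar> powr (- (2 * s)))"
          proof (rule sum_mono)
            fix m assume m: "m \<in> ?B"
            have mk: "m - k = int n * j m" using jm[OF m] by linarith
            \<comment> \<open>As 2|k| <= n <= 2|m|, this gives |m| >= (n/2)|j|, so the weights sum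
              to at most a constant times (n/2)^(-2s).\<close>
            have "int n * \<bar>j m\<bar> = \<bar>m - k\<bar>" unfolding mk by (simp add: abs_mult)
            also have "\<dots> \<le> \<bar>m\<bar> + \<bar>k\<bar>" by linarith
            also have "\<dots> \<le> 2 * \<bar>m\<bar>" using kn mA(1)[of m] m by auto
            finally have "real_of_int (int n * \<bar>j m\<bar>) \<le> real_of_int (2 * \<bar>m\<bar>)" by linarith
            then have le: "real n / 2 * real_of_int \<bar>j m\<bar> \<le> real_of_int \<bar>m\<bar>" by simp
            have "j m \<noteq> 0" using j0 m by force
            then have "0 < real n / 2 * real_of_int \<bar>j m\<bar>" using n0 by simp
            then have "?a m \<le> (real n / 2 * real_of_int \<bar>j m\<bar>) powr (- (2 * s))"
              using le s e by (intro powr_mono2') auto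
            also have "\<dots> = (real n / 2) powr (- (2 * s)) * real_of_int \<bar>j m\<bar> powr (- (2 * s))"
              by (rule powr_mult; simp)
            finally show "?a m \<le> (real n / 2) powr (- (2 * s)) * real_of_int \<bar>j m\<bar> powr (- (2 * s))" .
          qed
          also have "\<dots> = (real n / 2) powr (- (2 * s)) * (\<Sum>i\<in>j ` ?B. real_of_int \<bar>i\<bar> powr (- (2 * s)))"
            using inj by (simp add: sum_distrib_left sum.reindex)
          also have "\<dots> \<le> (real n / 2) powr (- (2 * s)) * Y"
            using A j0 by (intro mult_left_mono Y(2)) auto
          finally show ?thesis .
        qed
        have "(cmod (\<Sum>m\<in>?B. c m))\<^sup>2 \<le> (\<Sum>m\<in>?B. ?a m) * (\<Sum>m\<in>?B. (cmod (c m))\<^sup>2 / ?a m)"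
          by (rule weighted_Cauchy_Schwarz) (use mA(2) in auto)
        also have "\<dots> \<le> ((real n / 2) powr (- (2 * s)) * Y) * ?T"
        proof (intro mult_mono sa sum_mono)
          fix m assume m: "m \<in> ?B"
          have "(cmod (c m))\<^sup>2 / ?a m = real_of_int \<bar>m\<bar> powr (2 * s) * (cmod (c m))\<^sup>2"
            unfolding div_powr by simp
          also have "\<dots> \<le> (1 + \<bar>real_of_int m\<bar>) powr (2 * s) * (cmod (c m))\<^sup>2"
            using s e by (intro mult_right_mono powr_mono2) auto
          finally show "(cmod (c m))\<^sup>2 / ?a m \<le> (1 + \<bar>real_of_int m\<bar>) powr (2 * s) * (cmod (c m))\<^sup>2" .
        qed (use Y(1) in \<open>auto intro!: sum_nonneg\<close>)
        finally have cs: "(cmod (\<Sum>m\<in>?B. c m))\<^sup>2 \<le> ((real n / 2) powr (- (2 * s)) * Y) * ?T" .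
        have "(cmod (of_int k * (\<Sum>m\<in>?B. c m)))\<^sup>2 = (real_of_int \<bar>k\<bar>)\<^sup>2 * (cmod (\<Sum>m\<in>?B. c m))\<^sup>2"
          by (simp add: norm_mult power_mult_distrib)
        also have "\<dots> \<le> (real n)\<^sup>2 * (((real n / 2) powr (- (2 * s)) * Y) * ?T)"
          using kn by (intro mult_mono cs power_mono) auto
        also have "\<dots> = (real n powr 2 * (real n / 2) powr (- (2 * s))) * Y * ?T"
          using n0 by simp
        also have "real n powr 2 * (real n / 2) powr (- (2 * s)) = 2 powr (2 * s) * real n powr (2 - 2 * s)"
          using n0 by (simp add: powr_divide powr_minus powr_diff field_simps)
        \<comment> \<open>The exponent 2 - 2s is raised to q, larger by 2\<epsilon>, to match the
          bound for the error itself.\<close>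
        also have "2 powr (2 * s) * real n powr (2 - 2 * s) * Y * ?T \<le> 2 powr (2 * s) * real n powr q * Y * ?T"
          using n e Y(1) T0 by (intro mult_right_mono mult_left_mono powr_mono) (auto simp: q_def)
        finally show ?thesis by (simp only: mult_ac)
      qed
      have "(\<Sum>k\<in>interp_modes n. (cmod (of_int k * (\<Sum>m\<in>{m \<in> A. alias_mode n m = k}. c m)))\<^sup>2) \<le>
         (\<Sum>k\<in>interp_modes n. 2 powr (2 * s) * Y * real n powr q * (\<Sum>m\<in>{m \<in> A. alias_mode n m = k}. (1 + \<bar>real_of_int m\<bar>) powr (2 * s) * (cmod (c m))\<^sup>2))"
        by (intro sum_mono kk)
      also have "\<dots> = 2 powr (2 * s) * Y * real n powr q * S"
        unfolding sum_distrib_left[symmetric] S_def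
        using A alias_mode_in_modes[OF n0] by (subst sum.group) auto
      finally show ?thesis .
    qed
    have 4: "sq_norm (alias_error_deriv \<beta> n A c) \<le> ennreal (C2 * real n powr q * S)"
    proof (rule order_trans[OF sq_norm_alias_error_deriv_le[OF b A n0] ennreal_leI])
      have "8 * pi / \<beta> * ((\<Sum>k\<in>interp_modes n. (cmod (of_int k * (\<Sum>m\<in>{m \<in> A. alias_mode n m = k}. c m)))\<^sup>2) + (\<Sum>m\<in>A. (cmod (c m * of_int m))\<^sup>2))
        \<le> 8 * pi / \<beta> * (2 powr (2 * s) * Y * real n powr q * S + 2 powr (- q) * real n powr q * S)"
        using b by (intro mult_left_mono add_mono 2 3) auto
      also have "\<dots> = C2 * real n powr q * S" unfolding C2_def by (simp only: distrib_right distrib_left mult_ac)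
      finally show "8 * pi / \<beta> * ((\<Sum>k\<in>interp_modes n. (cmod (of_int k * (\<Sum>m\<in>{m \<in> A. alias_mode n m = k}. c m)))\<^sup>2) + (\<Sum>m\<in>A. (cmod (c m * of_int m))\<^sup>2))
        \<le> C2 * real n powr q * S" .
    qed
    have "sq_norm (alias_error \<beta> n A c) + sq_norm (alias_error_deriv \<beta> n A c) \<le> ennreal (C1 * real n powr q * S) + ennreal (C2 * real n powr q * S)"
      by (rule add_mono[OF 1 4])
    also have "\<dots> = ennreal ((C1 + C2) * real n powr q * S)"
      using C0 S0 by (subst ennreal_plus[symmetric]) (auto simp: algebra_simps)
    finally show "sq_norm (alias_error \<beta> n A c) + sq_norm (alias_error_deriv \<beta> n A c) \<le>
      ennreal ((C1 + C2) * real n powr (2 * (1 + \<epsilon> - s)) * (\<Sum>m\<in>A. (1 + \<bar>real_of_int m\<bar>) powr (2 * s) * (cmod (c m))\<^sup>2))"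
      unfolding q_def S_def .
  qed
qed

section \<open>Fourier series on the circle\<close>

definition circle_char :: "int \<Rightarrow> real \<Rightarrow> complex" where
  "circle_char m \<theta> = exp (\<i> * of_int m * complex_of_real \<theta>)"

lemma circle_char_measurable [measurable]: "circle_char m \<in> borel_measurable borel"
  unfolding circle_char_def[abs_def] by measurable

lemma norm_circle_char [simp]: "cmod (circle_char m \<theta>) = 1"
  by (simp add: circle_char_def norm_exp_eq_Re)

lemma circle_char_0 [simp]: "circle_char 0 \<theta> = 1" "circle_char m 0 = 1"
  by (simp_all add: circle_char_def)

lemma circle_char_add: "circle_char (m + l) \<theta> = circle_char m \<theta> * circle_char l \<theta>"
  by (simp add: circle_char_def exp_add[symmetric] algebra_simps)

lemma continuous_on_circle_char [continuous_intros]: "continuous_on A (circle_char m)"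
  unfolding circle_char_def[abs_def] by (intro continuous_intros)

lemma integral_circle_char:
  "(LINT \<theta>|lborel. indicator {0..<2*pi} \<theta> *\<^sub>R circle_char m \<theta>) = (if m = 0 then 2 * complex_of_real pi else 0)"
proof -
  have "(LINT \<theta>|lborel. indicator {0..<2*pi} \<theta> *\<^sub>R circle_char m \<theta>) = (LINT \<theta>|lborel. indicator {0..2*pi} \<theta> *\<^sub>R circle_char m \<theta>)"
  proof (rule integral_cong_AE)
    show "AE \<theta> in lborel. indicator {0..<2*pi} \<theta> *\<^sub>R circle_char m \<theta> = indicator {0..2*pi} \<theta> *\<^sub>R circle_char m \<theta>"
      using AE_lborel_singleton[of "2*pi"] by eventually_elim (auto split: split_indicator)
  qed measurable
  also have "\<dots> = (if m = 0 then 2 * complex_of_real pi else 0)"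
  proof (cases "m = 0")
    case True
    then show ?thesis by (simp add: scaleR_conv_of_real)
  next
    case False
    have "(LINT \<theta>|lborel. indicator {0..2*pi} \<theta> *\<^sub>R circle_char m \<theta>) = circle_char m (2*pi) / (\<i> * of_int m) - circle_char m 0 / (\<i> * of_int m)"
    proof (rule integral_FTC_atLeastAtMost)
      show "((\<lambda>x. circle_char m x / (\<i> * of_int m)) has_vector_derivative circle_char m x) (at x within {0..2*pi})" for x
        unfolding circle_char_def[abs_def] using False
        by (auto intro!: derivative_eq_intros has_vector_derivative_real_field simp: field_simps)
    qed (auto intro!: continuous_intros)
    moreover have "circle_char m (2*pi) = 1"
    proof -
      have "\<i> * of_int m * complex_of_real (2*pi) = complex_of_real (2 * real_of_int m * pi) * \<i>" by simp
      then have "circle_char m (2*pi) = exp (complex_of_real (2 * real_of_int m * pi) * \<i>)" by (simp only: circle_char_def)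
      also have "\<dots> = 1" by (rule exp_integer_2pi) simp
      finally show ?thesis .
    qed
    ultimately show ?thesis using False by simp
  qed
  finally show ?thesis .
qed

lemma integrable_bounded_mult_on_circle:
  fixes D u :: "real \<Rightarrow> complex"
  assumes D: "integrable lborel (\<lambda>\<theta>. indicator {0..<2*pi} \<theta> *\<^sub>R D \<theta>)"
    and u[measurable]: "u \<in> borel_measurable borel" and le: "\<And>\<theta>. cmod (u \<theta>) \<le> B"
  shows "integrable lborel (\<lambda>\<theta>. indicator {0..<2*pi} \<theta> *\<^sub>R (D \<theta> * u \<theta>))"
proof -
  have "integrable lborel (\<lambda>\<theta>. B * cmod (indicator {0..<2*pi} \<theta> *\<^sub>R D \<theta>))"
    by (intro integrable_mult_right integrable_norm D)
  then have "integrable lborel (\<lambda>\<theta>. (indicator {0..<2*pi} \<theta> *\<^sub>R D \<theta>) * u \<theta>)"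
  proof (rule Bochner_Integration.integrable_bound)
    have [measurable]: "(\<lambda>\<theta>. indicator {0..<2*pi} \<theta> *\<^sub>R D \<theta>) \<in> borel_measurable lborel" using D by auto
    show "(\<lambda>\<theta>. (indicator {0..<2*pi} \<theta> *\<^sub>R D \<theta>) * u \<theta>) \<in> borel_measurable lborel" by measurable
    show "AE \<theta> in lborel. norm ((indicator {0..<2*pi} \<theta> *\<^sub>R D \<theta>) * u \<theta>) \<le> norm (B * cmod (indicator {0..<2*pi} \<theta> *\<^sub>R D \<theta>))"
    proof (rule AE_I2)
      fix \<theta>
      have "norm ((indicator {0..<2*pi} \<theta> *\<^sub>R D \<theta>) * u \<theta>) \<le> cmod (indicator {0..<2*pi} \<theta> *\<^sub>R D \<theta>) * B"
        unfolding norm_mult by (rule mult_left_mono[OF le]) simp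
      then show "norm ((indicator {0..<2*pi} \<theta> *\<^sub>R D \<theta>) * u \<theta>) \<le> norm (B * cmod (indicator {0..<2*pi} \<theta> *\<^sub>R D \<theta>))"
        using order_trans[OF norm_ge_zero le[of \<theta>]] by (simp add: mult.commute)
    qed
  qed
  then show ?thesis by simp
qed

lemma circle_char_cos:
  "circle_char m \<theta> * complex_of_real (cos (\<theta> - t)) =
    (circle_char (-1) t / 2) * circle_char (m + 1) \<theta> + (circle_char 1 t / 2) * circle_char (m - 1) \<theta>"
proof -
  have "complex_of_real (cos (\<theta> - t)) = (exp (\<i> * complex_of_real (\<theta> - t)) + exp (- (\<i> * complex_of_real (\<theta> - t)))) / 2"
    unfolding cos_of_real[symmetric] by (rule cos_exp_eq)
  also have "exp (\<i> * complex_of_real (\<theta> - t)) = circle_char 1 \<theta> * circle_char (-1) t"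
    by (simp add: circle_char_def exp_add[symmetric] algebra_simps)
  also have "exp (- (\<i> * complex_of_real (\<theta> - t))) = circle_char (-1) \<theta> * circle_char 1 t"
    by (simp add: circle_char_def exp_add[symmetric] algebra_simps)
  finally have e: "complex_of_real (cos (\<theta> - t)) = (circle_char 1 \<theta> * circle_char (-1) t + circle_char (-1) \<theta> * circle_char 1 t) / 2" .
  have m1: "circle_char (m - 1) \<theta> = circle_char m \<theta> * circle_char (-1) \<theta>"
    using circle_char_add[of m "-1" \<theta>] by simp
  show ?thesis unfolding e m1 circle_char_add[of m 1] by (simp add: field_simps)
qed

text \<open>Induction on the power with m arbitrary: multiplication by a shifted cosine only moves m
  to m + 1 and m - 1, where the induction hypothesis applies.\<close>

lemma integral_trig_power_zero:
  fixes D :: "real \<Rightarrow> complex"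
  assumes D: "integrable lborel (\<lambda>\<theta>. indicator {0..<2*pi} \<theta> *\<^sub>R D \<theta>)"
    and zero: "\<And>m. (LINT \<theta>|lborel. indicator {0..<2*pi} \<theta> *\<^sub>R (D \<theta> * circle_char m \<theta>)) = 0"
  shows "(LINT \<theta>|lborel. indicator {0..<2*pi} \<theta> *\<^sub>R (D \<theta> * (circle_char m \<theta> * complex_of_real ((\<delta> + cos (\<theta> - t)) ^ n)))) = 0"
proof (induction n arbitrary: m)
  case 0
  show ?case using zero by simp
next
  case (Suc n)
  let ?I = "\<lambda>m \<theta>. indicator {0..<2*pi} \<theta> *\<^sub>R (D \<theta> * (circle_char m \<theta> * complex_of_real ((\<delta> + cos (\<theta> - t)) ^ n)))"
  have i: "integrable lborel (?I m)" for m
  proof (rule integrable_bounded_mult_on_circle[OF D])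
    show "cmod (circle_char m \<theta> * complex_of_real ((\<delta> + cos (\<theta> - t)) ^ n)) \<le> (\<bar>\<delta>\<bar> + 1) ^ n" for \<theta>
    proof -
      have "\<bar>\<delta> + cos (\<theta> - t)\<bar> \<le> \<bar>\<delta>\<bar> + 1" using abs_triangle_ineq[of \<delta> "cos (\<theta> - t)"] abs_cos_le_one[of "\<theta> - t"] by linarith
      then show ?thesis unfolding norm_mult norm_circle_char norm_of_real power_abs mult_1 by (rule power_mono) simp
    qed
  qed measurable
  have "indicator {0..<2*pi} \<theta> *\<^sub>R (D \<theta> * (circle_char m \<theta> * complex_of_real ((\<delta> + cos (\<theta> - t)) ^ Suc n))) =
    complex_of_real \<delta> * ?I m \<theta> + ((circle_char (-1) t / 2) * ?I (m + 1) \<theta> + (circle_char 1 t / 2) * ?I (m - 1) \<theta>)" for \<theta>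
  proof -
    have "circle_char m \<theta> * complex_of_real ((\<delta> + cos (\<theta> - t)) ^ Suc n) =
      (complex_of_real \<delta> * circle_char m \<theta> + circle_char m \<theta> * complex_of_real (cos (\<theta> - t))) * complex_of_real ((\<delta> + cos (\<theta> - t)) ^ n)"
      by (simp add: algebra_simps)
    then show ?thesis unfolding circle_char_cos by (simp only: scaleR_conv_of_real algebra_simps)
  qed
  then have "(LINT \<theta>|lborel. indicator {0..<2*pi} \<theta> *\<^sub>R (D \<theta> * (circle_char m \<theta> * complex_of_real ((\<delta> + cos (\<theta> - t)) ^ Suc n)))) =
    complex_of_real \<delta> * (LINT \<theta>|lborel. ?I m \<theta>) + ((circle_char (-1) t / 2) * (LINT \<theta>|lborel. ?I (m + 1) \<theta>) + (circle_char 1 t / 2) * (LINT \<theta>|lborel. ?I (m - 1) \<theta>))"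
    by (simp only: Bochner_Integration.integral_add integrable_mult_right i Bochner_Integration.integrable_add integral_mult_right_zero)
  then show ?case by (simp only: Suc.IH) simp
qed

text \<open>Powers of \<open>1 + cos (\<theta> - t) - cos \<eta>\<close> are trigonometric polynomials that blow up near \<open>t\<close> and
  stay bounded by \<open>1\<close> elsewhere on the circle, so a function orthogonal to all of them vanishes at \<open>t\<close>.\<close>

theorem fourier_uniqueness_continuous_point:
  fixes D :: "real \<Rightarrow> complex"
  assumes D: "integrable lborel (\<lambda>\<theta>. indicator {0..<2*pi} \<theta> *\<^sub>R D \<theta>)"
    and zero: "\<And>m. (LINT \<theta>|lborel. indicator {0..<2*pi} \<theta> *\<^sub>R (D \<theta> * circle_char m \<theta>)) = 0"
    and t: "0 < t" "t < 2 * pi" and cont: "isCont D t"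
  shows "D t = 0"
proof (rule ccontr)
  assume nz: "D t \<noteq> 0"
  define d where "d = (cmod (D t))\<^sup>2"
  have d: "d > 0" using nz by (simp add: d_def)
  \<comment> \<open>Rotating by the conjugate of D(t) reduces the problem to a real function that is
    positive near t.\<close>
  define g where "g \<theta> = Re (cnj (D t) * D \<theta>)" for \<theta>
  have gt: "g t = d" unfolding g_def d_def cmod_power2 by (simp add: power2_eq_square)
  have "isCont g t" unfolding g_def[abs_def] by (intro continuous_Re continuous_mult continuous_const cont)
  then have "\<exists>\<eta>>0. \<forall>\<theta>. \<bar>\<theta> - t\<bar> < \<eta> \<longrightarrow> \<bar>g \<theta> - g t\<bar> < d / 2"
    unfolding continuous_at_eps_delta dist_real_def using d by (metis half_gt_zero)
  then obtain \<eta>0 where \<eta>0: "\<eta>0 > 0" "\<And>\<theta>. \<bar>\<theta> - t\<bar> < \<eta>0 \<Longrightarrow> \<bar>g \<theta> - g t\<bar> < d / 2" by blast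
  \<comment> \<open>Halving keeps the closed window inside (0, 2 pi) and inside the region where
    \<open>g\<close> is controlled; the last two bounds together give \<eta> <= pi, where the cosine
    is monotone.\<close>
  define \<eta> where "\<eta> = min (\<eta>0 / 2) (min (t / 2) ((2 * pi - t) / 2))"
  have \<eta>: "\<eta> > 0" "\<eta> \<le> \<eta>0 / 2" "\<eta> \<le> t / 2" "\<eta> \<le> (2 * pi - t) / 2" using \<eta>0(1) t by (auto simp: \<eta>_def min_def)
  have "\<eta> + \<eta> \<le> t / 2 + (2 * pi - t) / 2" by (rule add_mono[OF \<eta>(3,4)])
  also have "\<dots> = pi" by (simp add: field_simps)
  finally have \<eta>pi: "\<eta> \<le> pi" using \<eta>(1) by simp
  have glow: "g \<theta> \<ge> d / 2" if "\<bar>\<theta> - t\<bar> \<le> \<eta>" for \<theta>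
    using \<eta>0(2)[of \<theta>] that \<eta>(1,2) gt by (auto simp: abs_if split: if_splits)
  define q where "q \<theta> = (1 - cos \<eta>) + cos (\<theta> - t)" for \<theta>
  define \<kappa> where "\<kappa> = cos (\<eta> / 2) - cos \<eta>"
  have \<kappa>: "\<kappa> > 0" unfolding \<kappa>_def using \<eta>(1) \<eta>pi by (simp add: cos_monotone_0_pi)
  have cosabs: "cos (\<theta> - t) = cos \<bar>\<theta> - t\<bar>" for \<theta> by (simp add: abs_if cos_minus[symmetric, of "\<theta> - t"])
  have q1: "q \<theta> \<ge> 1" if "\<bar>\<theta> - t\<bar> \<le> \<eta>" for \<theta>
  proof -
    have "cos \<eta> \<le> cos \<bar>\<theta> - t\<bar>" using that \<eta>pi by (intro cos_monotone_0_pi_le) auto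
    then show ?thesis unfolding q_def cosabs by simp
  qed
  have q2: "q \<theta> \<ge> 1 + \<kappa>" if "\<bar>\<theta> - t\<bar> \<le> \<eta> / 2" for \<theta>
  proof -
    have "cos (\<eta> / 2) \<le> cos \<bar>\<theta> - t\<bar>" using that \<eta>pi \<eta>(1) by (intro cos_monotone_0_pi_le) auto
    then show ?thesis unfolding q_def cosabs \<kappa>_def by simp
  qed
  have q3: "\<bar>q \<theta>\<bar> \<le> 1" if "\<bar>\<theta> - t\<bar> > \<eta>" "0 \<le> \<theta>" "\<theta> < 2 * pi" for \<theta>
  proof -
    have "cos \<bar>\<theta> - t\<bar> \<le> cos \<eta>"
    proof (cases "\<bar>\<theta> - t\<bar> \<le> pi")
      case True
      then show ?thesis using that \<eta>(1) by (intro cos_monotone_0_pi_le) auto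
    next
      case False
      \<comment> \<open>Beyond distance pi the cosine rises again; the distance around the other
        side of the circle replaces |\<theta> - t|.\<close>
      have "\<eta> \<le> 2 * pi - \<bar>\<theta> - t\<bar>" using that \<eta> by (auto simp: abs_if)
      then have "cos (2 * pi - \<bar>\<theta> - t\<bar>) \<le> cos \<eta>" using False \<eta>(1) by (intro cos_monotone_0_pi_le) auto
      then show ?thesis by (simp add: cos_diff)
    qed
    moreover have "-1 \<le> cos (\<theta> - t)" "cos \<eta> \<le> 1" by auto
    ultimately show ?thesis unfolding q_def abs_le_iff cosabs by linarith
  qed
  let ?ind = "\<lambda>\<theta>. indicator {0..<2*pi} \<theta> :: real"
  have ig: "integrable lborel (\<lambda>\<theta>. ?ind \<theta> * g \<theta>)"
  proof -
    have "integrable lborel (\<lambda>\<theta>. Re (cnj (D t) * (?ind \<theta> *\<^sub>R D \<theta>)))" by (intro integrable_Re integrable_mult_right D)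
    then show ?thesis by (simp add: g_def algebra_simps)
  qed
  define G where "G = (LINT \<theta>|lborel. \<bar>?ind \<theta> * g \<theta>\<bar>)"
  have low: "d / 2 * (1 + \<kappa>) ^ n * \<eta> \<le> G" for n
  proof -
    have i1: "integrable lborel (\<lambda>\<theta>. indicator {0..<2*pi} \<theta> *\<^sub>R (D \<theta> * complex_of_real (q \<theta> ^ n)))"
    proof (rule integrable_bounded_mult_on_circle[OF D])
      have "\<bar>q \<theta>\<bar> \<le> 3" for \<theta> unfolding q_def using abs_cos_le_one[of \<eta>] abs_cos_le_one[of "\<theta> - t"] by linarith
      then show "cmod (complex_of_real (q \<theta> ^ n)) \<le> 3 ^ n" for \<theta>
        unfolding norm_of_real power_abs by (intro power_mono) auto
    qed (unfold q_def, measurable)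
    have "(LINT \<theta>|lborel. indicator {0..<2*pi} \<theta> *\<^sub>R (D \<theta> * complex_of_real (q \<theta> ^ n))) = 0"
      using integral_trig_power_zero[OF D zero, of 0 "1 - cos \<eta>" t n] by (simp add: q_def)
    then have "0 = Re (cnj (D t) * (LINT \<theta>|lborel. indicator {0..<2*pi} \<theta> *\<^sub>R (D \<theta> * complex_of_real (q \<theta> ^ n))))" by simp
    also have "\<dots> = (LINT \<theta>|lborel. Re (cnj (D t) * (indicator {0..<2*pi} \<theta> *\<^sub>R (D \<theta> * complex_of_real (q \<theta> ^ n)))))"
      unfolding integral_mult_right_zero[symmetric] by (rule integral_Re[symmetric, OF integrable_mult_right[OF i1]])
    also have "\<dots> = (LINT \<theta>|lborel. ?ind \<theta> * g \<theta> * q \<theta> ^ n)"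
      by (intro Bochner_Integration.integral_cong refl) (simp add: g_def algebra_simps)
    finally have z: "(LINT \<theta>|lborel. ?ind \<theta> * g \<theta> * q \<theta> ^ n) = 0" by simp
    have i2: "integrable lborel (\<lambda>\<theta>. ?ind \<theta> * g \<theta> * q \<theta> ^ n)"
    proof -
      have "integrable lborel (\<lambda>\<theta>. Re (cnj (D t) * (indicator {0..<2*pi} \<theta> *\<^sub>R (D \<theta> * complex_of_real (q \<theta> ^ n)))))"
        by (intro integrable_Re integrable_mult_right i1)
      then show ?thesis by (simp add: g_def algebra_simps)
    qed
    \<comment> \<open>Adding |g| makes the right side nonnegative everywhere: off the window |q| <=
      1, so g q^n is at least -|g|. Its integral is 0 + G, while the inner half of the window alone
      contributes growth like (1 + \<kappa>)^n.\<close>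
    have "(LINT \<theta>|lborel. indicator {t - \<eta> / 2..t + \<eta> / 2} \<theta> * (d / 2 * (1 + \<kappa>) ^ n)) \<le> (LINT \<theta>|lborel. ?ind \<theta> * g \<theta> * q \<theta> ^ n + \<bar>?ind \<theta> * g \<theta>\<bar>)"
    proof (rule integral_mono)
      show "integrable lborel (\<lambda>\<theta>. indicator {t - \<eta> / 2..t + \<eta> / 2} \<theta> * (d / 2 * (1 + \<kappa>) ^ n))"
        by (simp add: emeasure_lborel_Icc_eq)
      show "integrable lborel (\<lambda>\<theta>. ?ind \<theta> * g \<theta> * q \<theta> ^ n + \<bar>?ind \<theta> * g \<theta>\<bar>)"
        by (intro Bochner_Integration.integrable_add i2 integrable_abs ig)
      fix \<theta>
      consider "\<bar>\<theta> - t\<bar> \<le> \<eta> / 2" | "\<eta> / 2 < \<bar>\<theta> - t\<bar>" "\<bar>\<theta> - t\<bar> \<le> \<eta>" | "\<bar>\<theta> - t\<bar> > \<eta>" "0 \<le> \<theta>" "\<theta> < 2 * pi" | "\<not> (0 \<le> \<theta> \<and> \<theta> < 2 * pi)"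
        by linarith
      then show "indicator {t - \<eta> / 2..t + \<eta> / 2} \<theta> * (d / 2 * (1 + \<kappa>) ^ n) \<le> ?ind \<theta> * g \<theta> * q \<theta> ^ n + \<bar>?ind \<theta> * g \<theta>\<bar>"
      proof cases
        case 1
        then have in1: "\<theta> \<in> {t - \<eta> / 2..t + \<eta> / 2}" "\<theta> \<in> {0..<2*pi}" using \<eta> t by (auto simp: abs_if split: if_splits)
        have "d / 2 * (1 + \<kappa>) ^ n \<le> g \<theta> * q \<theta> ^ n"
          using glow[of \<theta>] q2[of \<theta>] 1 \<eta>(1) d \<kappa> by (intro mult_mono power_mono) auto
        then show ?thesis using in1 by simp
      next
        case 2
        then have in1: "\<theta> \<notin> {t - \<eta> / 2..t + \<eta> / 2}" by (auto simp: abs_if split: if_splits)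
        have "0 \<le> g \<theta> * q \<theta> ^ n"
          using glow[of \<theta>] q1[of \<theta>] 2 d by (intro mult_nonneg_nonneg zero_le_power) auto
        then show ?thesis using in1 by (auto split: split_indicator)
      next
        case 3
        then have in1: "\<theta> \<notin> {t - \<eta> / 2..t + \<eta> / 2}" "\<theta> \<in> {0..<2*pi}" using \<eta>(1) by (auto simp: abs_if split: if_splits)
        have "\<bar>q \<theta> ^ n\<bar> \<le> 1" unfolding power_abs using q3[OF 3] by (intro power_le_one) auto
        then have "\<bar>g \<theta> * q \<theta> ^ n\<bar> \<le> \<bar>g \<theta>\<bar> * 1" unfolding abs_mult by (intro mult_left_mono) auto
        then show ?thesis using in1 by simp
      next
        case 4
        then have "\<theta> \<notin> {t - \<eta> / 2..t + \<eta> / 2}" "\<theta> \<notin> {0..<2*pi}" using \<eta> t by auto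
        then show ?thesis by simp
      qed
    qed
    also have "\<dots> = G" unfolding G_def
      by (subst Bochner_Integration.integral_add[OF i2 integrable_abs[OF ig]]) (simp add: z)
    also have "(LINT \<theta>|lborel. indicator {t - \<eta> / 2..t + \<eta> / 2} \<theta> * (d / 2 * (1 + \<kappa>) ^ n)) = d / 2 * (1 + \<kappa>) ^ n * \<eta>"
      using \<eta>(1) by simp
    finally show ?thesis .
  qed
  obtain n where n: "2 * G / (d * \<eta>) < (1 + \<kappa>) ^ n"
    using real_arch_pow[of "1 + \<kappa>" "2 * G / (d * \<eta>)"] \<kappa> by auto
  have "G < d / 2 * (1 + \<kappa>) ^ n * \<eta>"
    using n d \<eta>(1) by (simp add: field_simps)
  with low[of n] show False by simp
qed

text \<open>Unordered summation over the integers is a limit along all finite sets; this specialises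
  it to symmetric partial sums.\<close>

lemma filterlim_symmetric_intervals:
  "filterlim (\<lambda>N. {- int N..int N}) (finite_subsets_at_top UNIV) sequentially"
  unfolding filterlim_finite_subsets_at_top
proof (intro allI impI)
  fix X :: "int set" assume X: "finite X \<and> X \<subseteq> UNIV"
  have "X \<subseteq> {- int N..int N}" if "N \<ge> nat (\<Sum>x\<in>X. \<bar>x\<bar>)" for N
  proof
    fix x assume "x \<in> X"
    then have "\<bar>x\<bar> \<le> (\<Sum>x\<in>X. \<bar>x\<bar>)" using X by (intro member_le_sum) auto
    then show "x \<in> {- int N..int N}" using that by auto
  qed
  then show "\<forall>\<^sub>F N in sequentially. finite {- int N..int N} \<and> X \<subseteq> {- int N..int N} \<and> {- int N..int N} \<subseteq> UNIV"
    by (auto simp: eventually_sequentially)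
qed

lemma summable_on_inverse_powr:
  assumes "a > (1::real)"
  shows "(\<lambda>m::int. (1 + \<bar>real_of_int m\<bar>) powr (- a)) summable_on UNIV"
proof -
  obtain Z where Z: "Z \<ge> 0" "\<And>A::int set. finite A \<Longrightarrow> 0 \<notin> A \<Longrightarrow> (\<Sum>m\<in>A. real_of_int \<bar>m\<bar> powr (- a)) \<le> Z"
    using powr_sum_bound[OF assms] by auto
  show ?thesis
  proof (rule nonneg_bdd_above_summable_on)
    show "bdd_above (sum (\<lambda>m::int. (1 + \<bar>real_of_int m\<bar>) powr (- a)) ` {F. F \<subseteq> UNIV \<and> finite F})"
    proof (rule bdd_aboveI2)
      fix F :: "int set" assume "F \<in> {F. F \<subseteq> UNIV \<and> finite F}"
      then have F: "finite F" by simp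
      have "(\<Sum>m\<in>F. (1 + \<bar>real_of_int m\<bar>) powr (- a)) \<le> (\<Sum>m\<in>insert 0 F. (1 + \<bar>real_of_int m\<bar>) powr (- a))"
        using F by (intro sum_mono2) auto
      also have "\<dots> = 1 + (\<Sum>m\<in>F - {0}. (1 + \<bar>real_of_int m\<bar>) powr (- a))"
        using F by (simp add: sum.insert_remove)
      also have "(\<Sum>m\<in>F - {0}. (1 + \<bar>real_of_int m\<bar>) powr (- a)) \<le> (\<Sum>m\<in>F - {0}. real_of_int \<bar>m\<bar> powr (- a))"
        using assms by (intro sum_mono powr_mono2') auto
      also have "\<dots> \<le> Z" using F by (intro Z(2)) auto
      finally show "(\<Sum>m\<in>F. (1 + \<bar>real_of_int m\<bar>) powr (- a)) \<le> 1 + Z" by simp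
    qed
  qed simp
qed

text \<open>With a = (1 + |m|)^s, the inequality |c| <= a^(-2) + a^2 |c|^2 dominates the series by
  one that converges as 2s > 1, plus the Sobolev sum.\<close>

lemma abs_summable_fourier_coeff:
  fixes c :: "int \<Rightarrow> complex"
  assumes s: "2 * s > 1" and sum: "(\<lambda>m. (1 + \<bar>real_of_int m\<bar>) powr (2 * s) * (cmod (c m))\<^sup>2) summable_on UNIV"
  shows "(\<lambda>m. cmod (c m)) summable_on UNIV"
proof (rule summable_on_comparison_test)
  show "(\<lambda>m. (1 + \<bar>real_of_int m\<bar>) powr (- (2 * s)) + (1 + \<bar>real_of_int m\<bar>) powr (2 * s) * (cmod (c m))\<^sup>2) summable_on UNIV"
    by (intro summable_on_add summable_on_inverse_powr s sum)
  fix m :: int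
  let ?a = "(1 + \<bar>real_of_int m\<bar>) powr s"
  have a: "?a > 0" by auto
  have "2 * (1 / ?a) * (?a * cmod (c m)) \<le> (1 / ?a)\<^sup>2 + (?a * cmod (c m))\<^sup>2" by (rule sum_squares_bound)
  moreover have "(1 / ?a)\<^sup>2 = (1 + \<bar>real_of_int m\<bar>) powr (- (2 * s))"
    by (simp add: power_divide powr_minus powr_power field_simps)
  moreover have "(?a * cmod (c m))\<^sup>2 = (1 + \<bar>real_of_int m\<bar>) powr (2 * s) * (cmod (c m))\<^sup>2"
    by (simp add: power_mult_distrib powr_power mult.commute)
  moreover have "2 * (1 / ?a) * (?a * cmod (c m)) = 2 * cmod (c m)" using a by simp
  ultimately show "cmod (c m) \<le> (1 + \<bar>real_of_int m\<bar>) powr (- (2 * s)) + (1 + \<bar>real_of_int m\<bar>) powr (2 * s) * (cmod (c m))\<^sup>2"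
    using norm_ge_zero[of "c m"] by linarith
qed auto

lemma fourier_coeff_eq:
  "fourier_coeff F k = complex_of_real (1 / (2 * pi)) * (LINT \<theta>|lborel. indicator {0..<2*pi} \<theta> *\<^sub>R (F \<theta> * circle_char (- k) \<theta>))"
  unfolding fourier_coeff_def set_lebesgue_integral_def by (simp add: circle_char_def mult.commute)

text \<open>Absolute summability makes the series converge uniformly to a continuous S with the same
  coefficients as F. Uniqueness at points of continuity then gives F = S on the open interval; the
  endpoint 0, where F is not known to be continuous, has to be settled separately.\<close>

theorem fourier_series_sums:
  assumes F: "Hs_circle_fun s F" and s: "2 * s > 1" and cont: "continuous_on {0<..<2*pi} F"
  obtains S where "continuous_on UNIV S" "\<And>\<theta>. (\<lambda>N. \<Sum>m\<in>{- int N..int N}. fourier_coeff F m * circle_char m \<theta>) \<longlonglongrightarrow> S \<theta>"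
    "\<And>\<theta>. 0 < \<theta> \<Longrightarrow> \<theta> < 2 * pi \<Longrightarrow> F \<theta> = S \<theta>"
proof -
  define c where "c = fourier_coeff F"
  have csum: "(\<lambda>m. cmod (c m)) summable_on UNIV"
    using F unfolding Hs_circle_fun_def c_def by (intro abs_summable_fourier_coeff[OF s]) auto
  define S where "S \<theta> = (\<Sum>\<^sub>\<infinity>m. c m * circle_char m \<theta>)" for \<theta>
  let ?P = "\<lambda>N \<theta>. \<Sum>m\<in>{- int N..int N}. c m * circle_char m \<theta>"
  have "uniform_limit UNIV (\<lambda>X \<theta>. \<Sum>m\<in>X. c m * circle_char m \<theta>) S (finite_subsets_at_top UNIV)"
    unfolding S_def[abs_def] by (rule Weierstrass_m_test_general[OF _ csum]) (simp add: norm_mult)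
  then have ul: "uniform_limit UNIV ?P S sequentially"
    by (rule filterlim_compose[OF _ filterlim_symmetric_intervals])
  have Scont: "continuous_on UNIV S"
    by (rule uniform_limit_theorem[OF _ ul]) (auto intro!: always_eventually continuous_intros)
  have Slim: "(\<lambda>N. ?P N \<theta>) \<longlonglongrightarrow> S \<theta>" for \<theta>
    by (rule tendsto_uniform_limitI[OF ul]) simp
  have [measurable]: "S \<in> borel_measurable borel" by (rule borel_measurable_continuous_onI[OF Scont])
  define B where "B = (\<Sum>\<^sub>\<infinity>m. cmod (c m))"
  have PB: "cmod (?P N \<theta>) \<le> B" for N \<theta>
  proof -
    have "cmod (?P N \<theta>) \<le> (\<Sum>m\<in>{- int N..int N}. cmod (c m))"
      by (rule order_trans[OF norm_sum]) (simp add: norm_mult)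
    also have "\<dots> \<le> B" unfolding B_def by (rule finite_sum_le_infsum[OF csum]) auto
    finally show ?thesis .
  qed
  have SB: "cmod (S \<theta>) \<le> B" for \<theta>
    by (rule LIMSEQ_le_const2[OF tendsto_norm[OF Slim]]) (use PB in auto)
  have i1: "integrable lborel (\<lambda>\<theta>. indicator {0..<2*pi} \<theta> *\<^sub>R (1::complex))"
    by (simp add: integrable_indicator_iff)
  have iS: "integrable lborel (\<lambda>\<theta>. indicator {0..<2*pi} \<theta> *\<^sub>R S \<theta>)"
    using integrable_bounded_mult_on_circle[OF i1 \<open>S \<in> borel_measurable borel\<close> SB] by simp
  have iF: "integrable lborel (\<lambda>\<theta>. indicator {0..<2*pi} \<theta> *\<^sub>R F \<theta>)"
  proof (rule Bochner_Integration.integrable_bound)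
    show "integrable lborel (\<lambda>\<theta>. indicator {0..<2*pi} \<theta> *\<^sub>R (1::real) + indicator {0..<2*pi} \<theta> *\<^sub>R (cmod (F \<theta>))\<^sup>2)"
      using F unfolding Hs_circle_fun_def set_integrable_def by (intro Bochner_Integration.integrable_add) (auto simp: integrable_indicator_iff)
    show "(\<lambda>\<theta>. indicator {0..<2*pi} \<theta> *\<^sub>R F \<theta>) \<in> borel_measurable lborel"
      using F unfolding Hs_circle_fun_def set_borel_measurable_def by simp
    have "cmod z \<le> 1 + (cmod z)\<^sup>2" for z
      using sum_squares_bound[of "cmod z" 1] by (simp add: power2_eq_square) (smt (verit) zero_le_square)
    then show "AE \<theta> in lborel. norm (indicator {0..<2*pi} \<theta> *\<^sub>R F \<theta>) \<le> norm (indicator {0..<2*pi} \<theta> *\<^sub>R (1::real) + indicator {0..<2*pi} \<theta> *\<^sub>R (cmod (F \<theta>))\<^sup>2)"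
      by (auto split: split_indicator)
  qed
  have Scoeff: "(LINT \<theta>|lborel. indicator {0..<2*pi} \<theta> *\<^sub>R (S \<theta> * circle_char m \<theta>)) = 2 * complex_of_real pi * c (- m)" for m
  proof -
    have "(\<lambda>N. LINT \<theta>|lborel. indicator {0..<2*pi} \<theta> *\<^sub>R (?P N \<theta> * circle_char m \<theta>)) \<longlonglongrightarrow> (LINT \<theta>|lborel. indicator {0..<2*pi} \<theta> *\<^sub>R (S \<theta> * circle_char m \<theta>))"
    proof (rule integral_dominated_convergence[where w="\<lambda>\<theta>. indicator {0..<2*pi} \<theta> * B"])
      show "integrable lborel (\<lambda>\<theta>. indicator {0..<2*pi} \<theta> * B :: real)" by (simp add: integrable_indicator_iff)
      show "AE \<theta> in lborel. (\<lambda>N. indicator {0..<2*pi} \<theta> *\<^sub>R (?P N \<theta> * circle_char m \<theta>)) \<longlonglongrightarrow> indicator {0..<2*pi} \<theta> *\<^sub>R (S \<theta> * circle_char m \<theta>)"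
        by (intro AE_I2 tendsto_intros Slim)
      show "AE \<theta> in lborel. norm (indicator {0..<2*pi} \<theta> *\<^sub>R (?P N \<theta> * circle_char m \<theta>)) \<le> indicator {0..<2*pi} \<theta> * B" for N
        using PB[where N=N] by (intro AE_I2) (simp add: norm_mult split: split_indicator)
    qed measurable
    note lim1 = this
    have "\<forall>\<^sub>F N in sequentially. (LINT \<theta>|lborel. indicator {0..<2*pi} \<theta> *\<^sub>R (?P N \<theta> * circle_char m \<theta>)) = 2 * complex_of_real pi * c (- m)"
    proof (rule eventually_sequentiallyI)
      \<comment> \<open>Once N reaches |m| the partial sum contains the mode -m, and orthogonality
        fixes the integral from then on.\<close>
      fix N :: nat assume N: "nat \<bar>m\<bar> \<le> N"
      have i: "integrable lborel (\<lambda>\<theta>. c l * (indicator {0..<2*pi} \<theta> *\<^sub>R circle_char (l + m) \<theta>))" for l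
        using integrable_bounded_mult_on_circle[OF i1 circle_char_measurable, of "l + m" 1] by (intro integrable_mult_right) simp
      have "(LINT \<theta>|lborel. indicator {0..<2*pi} \<theta> *\<^sub>R (?P N \<theta> * circle_char m \<theta>)) = (LINT \<theta>|lborel. (\<Sum>l\<in>{- int N..int N}. c l * (indicator {0..<2*pi} \<theta> *\<^sub>R circle_char (l + m) \<theta>)))"
        by (simp add: sum_distrib_right circle_char_add mult.assoc scaleR_sum_right)
      also have "\<dots> = (\<Sum>l\<in>{- int N..int N}. c l * (if l + m = 0 then 2 * complex_of_real pi else 0))"
        by (subst Bochner_Integration.integral_sum[OF i]) (simp only: integral_mult_right_zero integral_circle_char)
      also have "\<dots> = (\<Sum>l\<in>{- int N..int N}. if l = - m then c (- m) * (2 * complex_of_real pi) else 0)"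
        by (intro sum.cong) auto
      also have "\<dots> = 2 * complex_of_real pi * c (- m)"
        using N by auto
      finally show "(LINT \<theta>|lborel. indicator {0..<2*pi} \<theta> *\<^sub>R (?P N \<theta> * circle_char m \<theta>)) = 2 * complex_of_real pi * c (- m)" .
    qed
    then show ?thesis by (rule LIMSEQ_unique[OF lim1 tendsto_eventually])
  qed
  have Fcoeff: "(LINT \<theta>|lborel. indicator {0..<2*pi} \<theta> *\<^sub>R (F \<theta> * circle_char m \<theta>)) = 2 * complex_of_real pi * c (- m)" for m
    unfolding c_def fourier_coeff_eq by simp
  have "F \<theta> = S \<theta>" if \<theta>: "0 < \<theta>" "\<theta> < 2 * pi" for \<theta>
  proof -
    have "F \<theta> - S \<theta> = 0"
    proof (rule fourier_uniqueness_continuous_point[OF _ _ \<theta>])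
      show "integrable lborel (\<lambda>\<theta>. indicator {0..<2*pi} \<theta> *\<^sub>R (F \<theta> - S \<theta>))"
        unfolding scaleR_diff_right by (rule Bochner_Integration.integrable_diff[OF iF iS])
      show "(LINT \<theta>|lborel. indicator {0..<2*pi} \<theta> *\<^sub>R ((F \<theta> - S \<theta>) * circle_char m \<theta>)) = 0" for m
        unfolding scaleR_diff_right left_diff_distrib
        by (subst Bochner_Integration.integral_diff)
           (auto simp: Fcoeff Scoeff intro!: integrable_bounded_mult_on_circle[OF iF, where B=1] integrable_bounded_mult_on_circle[OF iS, where B=1])
      have "isCont F \<theta>" using cont \<theta> by (simp add: continuous_on_eq_continuous_at)
      moreover have "isCont S \<theta>" using Scont by (simp add: continuous_on_eq_continuous_at)
      ultimately show "isCont (\<lambda>\<theta>. F \<theta> - S \<theta>) \<theta>" by (intro continuous_intros)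
    qed
    then show ?thesis by simp
  qed
  then show ?thesis using that[OF Scont] Slim unfolding c_def by blast
qed

section \<open>The interpolation error\<close>

text \<open>Factoring the half-angle exponential out of the numerator and the denominator of
  \<open>moebius_inv\<close> leaves a cosine and a sine, so T(\<theta>) is -\<beta>
  cot(\<theta>/2).\<close>

lemma circle_to_line_eq:
  assumes "0 < \<theta>" "\<theta> < 2 * pi"
  shows "circle_to_line \<beta> \<theta> = - \<beta> * (cos (\<theta> / 2) / sin (\<theta> / 2))"
proof -
  define e where "e = exp (\<i> * complex_of_real (\<theta> / 2))"
  define C S where "C = complex_of_real (cos (\<theta> / 2))" and "S = complex_of_real (sin (\<theta> / 2))"
  have e0: "e \<noteq> 0" by (simp add: e_def)
  have "sin (\<theta> / 2) > 0" using assms by (intro sin_gt_zero) auto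
  then have S0: "S \<noteq> 0" by (simp add: S_def)
  have ee: "exp (\<i> * complex_of_real \<theta>) = e * e" by (simp add: e_def exp_add[symmetric])
  have eCS: "e = C + \<i> * S" unfolding e_def C_def S_def exp_Euler cos_of_real sin_of_real ..
  have inv: "(C + \<i> * S) * (C - \<i> * S) = 1"
  proof -
    have "(C + \<i> * S) * (C - \<i> * S) = C * C + S * S" by (simp add: algebra_simps)
    also have "\<dots> = complex_of_real ((cos (\<theta> / 2))\<^sup>2 + (sin (\<theta> / 2))\<^sup>2)" by (simp only: C_def S_def power2_eq_square of_real_add of_real_mult)
    finally show ?thesis by simp
  qed
  have p: "e * e + 1 = e * (2 * C)" and m: "e * e - 1 = e * (2 * \<i> * S)"
    using inv unfolding eCS by (simp_all add: algebra_simps)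
  have "moebius_inv \<beta> (exp (\<i> * complex_of_real \<theta>)) = - (complex_of_real \<beta> * (C / S))"
    unfolding moebius_inv_def ee p m using e0 S0 by (simp add: field_simps)
  also have "\<dots> = complex_of_real (- \<beta> * (cos (\<theta> / 2) / sin (\<theta> / 2)))" by (simp add: C_def S_def)
  finally show ?thesis by (simp add: circle_to_line_def)
qed

text \<open>The inverse of \<open>circle_to_line\<close>, obtained from -cot(\<theta>/2) =
  tan((\<theta> - pi)/2).\<close>

definition line_to_circle :: "real \<Rightarrow> real \<Rightarrow> real" where
  "line_to_circle \<beta> x = pi + 2 * arctan (x / \<beta>)"

lemma line_to_circle_bounds: "0 < line_to_circle \<beta> x" "line_to_circle \<beta> x < 2 * pi"
  using arctan_lbound[of "x / \<beta>"] arctan_ubound[of "x / \<beta>"] by (auto simp: line_to_circle_def)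

lemma circle_to_line_line_to_circle:
  assumes "\<beta> > 0"
  shows "circle_to_line \<beta> (line_to_circle \<beta> x) = x"
proof -
  have h: "line_to_circle \<beta> x / 2 = pi / 2 + arctan (x / \<beta>)" by (simp add: line_to_circle_def)
  have "sin (pi / 2 + arctan (x / \<beta>)) = cos (arctan (x / \<beta>))" "cos (pi / 2 + arctan (x / \<beta>)) = - sin (arctan (x / \<beta>))"
    by (simp_all add: sin_add cos_add)
  then have "circle_to_line \<beta> (line_to_circle \<beta> x) = \<beta> * tan (arctan (x / \<beta>))"
    unfolding circle_to_line_eq[OF line_to_circle_bounds] h by (simp add: tan_def)
  then show ?thesis using assms by (simp add: tan_arctan)
qed

lemma pullback_line_to_circle: "\<beta> > 0 \<Longrightarrow> pullback \<beta> f (line_to_circle \<beta> x) = f x"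
  by (simp add: pullback_def line_to_circle_bounds circle_to_line_line_to_circle)

lemma moebius_pow_eq_circle_char:
  assumes "\<beta> > 0"
  shows "moebius_pow \<beta> m x = circle_char m (line_to_circle \<beta> x)"
  using moebius_circle_to_line[OF assms line_to_circle_bounds, of \<beta> x]
  by (simp add: moebius_pow_def circle_to_line_line_to_circle[OF assms] circle_char_def exp_power_int mult_ac)

lemma continuous_pullback:
  assumes "continuous_on UNIV f"
  shows "continuous_on {0<..<2*pi} (pullback \<beta> f)"
proof -
  have "sin (\<theta> / 2) \<noteq> 0" if "\<theta> \<in> {0<..<2*pi}" for \<theta>
  proof -
    have "sin (\<theta> / 2) > 0" using that by (intro sin_gt_zero) auto
    then show ?thesis by simp
  qed
  then have "continuous_on {0<..<2*pi} (\<lambda>\<theta>. f (- \<beta> * (cos (\<theta> / 2) / sin (\<theta> / 2))))"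
    by (intro continuous_on_compose2[OF assms] continuous_intros) auto
  then show ?thesis
    by (rule continuous_on_cong[THEN iffD1, rotated 2]) (auto simp: pullback_def circle_to_line_eq)
qed

text \<open>Otherwise |f| stays above |a|/2 on a half-line, and the integral of its square over
  intervals of length n grows without bound. It serves to find the value of the Fourier series at
  angle 0.\<close>

lemma L2_limit_at_bot_zero:
  assumes f: "L2_fun f" and lim: "(f \<longlongrightarrow> a) at_bot"
  shows "a = 0"
proof (rule ccontr)
  assume a: "a \<noteq> 0"
  have [measurable]: "f \<in> borel_measurable borel" using f by auto
  define d where "d = (cmod a / 2)\<^sup>2"
  have d: "d > 0" using a by (simp add: d_def)
  have "\<forall>\<^sub>F x in at_bot. cmod (f x) > cmod a / 2"
    using order_tendstoD(1)[OF tendsto_norm[OF lim], of "cmod a / 2"] a by simp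
  then obtain X where X: "\<And>x. x \<le> X \<Longrightarrow> cmod (f x) > cmod a / 2"
    by (auto simp: eventually_at_bot_linorder)
  have "ennreal (d * real n) \<le> sq_norm f" for n
  proof -
    have "ennreal (d * real n) = (\<integral>\<^sup>+x. ennreal d * indicator {X - real n..X} x \<partial>lborel)"
      using d by (simp add: nn_integral_cmult ennreal_mult)
    also have "\<dots> \<le> sq_norm f"
      unfolding sq_norm_def
    proof (rule nn_integral_mono)
      fix x
      have "d \<le> (cmod (f x))\<^sup>2" if "x \<le> X"
        unfolding d_def using X[OF that] by (intro power_mono) auto
      then show "ennreal d * indicator {X - real n..X} x \<le> ennreal ((cmod (f x))\<^sup>2)"
        by (auto split: split_indicator intro: ennreal_leI)
    qed
    finally show ?thesis .
  qed
  then have "ennreal (d * real n) \<le> ennreal ((L2_norm f)\<^sup>2)" for n by (simp only: sq_norm_eq_L2_norm[OF f])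
  then have le: "d * real n \<le> (L2_norm f)\<^sup>2" for n by (simp add: ennreal_le_iff)
  obtain n where "(L2_norm f)\<^sup>2 / d < real n" using reals_Archimedean2 by blast
  then show False using le[of n] d by (simp add: field_simps)
qed

lemma sum_roots_of_unity:
  assumes n: "n > 0"
  shows "(\<Sum>l<n. circle_char j (2 * pi * real l / real n)) = (if int n dvd j then of_nat n else 0)"
proof -
  define w where "w = circle_char j (2 * pi / real n)"
  have wl: "circle_char j (2 * pi * real l / real n) = w ^ l" for l
    unfolding w_def circle_char_def exp_of_nat_mult[symmetric] by (simp add: mult_ac)
  have wn: "w ^ n = 1"
  proof -
    have "w ^ n = exp (complex_of_real (2 * real_of_int j * pi) * \<i>)"
      unfolding w_def circle_char_def exp_of_nat_mult[symmetric] using n by (simp add: mult_ac)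
    also have "\<dots> = 1" by (rule exp_integer_2pi) simp
    finally show ?thesis .
  qed
  have w1: "w = 1 \<longleftrightarrow> int n dvd j"
  proof
    assume "w = 1"
    then obtain k :: int where "real_of_int j * (2 * pi / real n) = of_int (2 * k) * pi"
      unfolding w_def circle_char_def exp_eq_1 by auto
    then have "real_of_int j = real n * of_int k" using n by (simp add: field_simps)
    then have "j = int n * k" by (metis of_int_eq_iff of_int_mult of_int_of_nat_eq)
    then show "int n dvd j" by simp
  next
    assume "int n dvd j"
    then obtain k where k: "j = int n * k" by (auto elim: dvdE)
    have "w = exp (complex_of_real (2 * real_of_int k * pi) * \<i>)"
      unfolding w_def circle_char_def k using n by (simp add: field_simps)
    also have "\<dots> = 1" by (rule exp_integer_2pi) simp
    finally show "w = 1" .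
  qed
  have "(\<Sum>l<n. circle_char j (2 * pi * real l / real n)) = (\<Sum>l<n. w ^ l)" by (simp only: wl)
  also have "\<dots> = (if w = 1 then of_nat n else 0)"
    using wn by (simp add: sum_gp_strict)
  finally show ?thesis by (simp only: w1)
qed

text \<open>Sampling at n equally spaced nodes cannot separate modes that agree modulo n, so their
  coefficients are added.\<close>

lemma disc_fourier_coeff_trig_sum:
  assumes n: "n > 0" and B: "finite B"
  shows "disc_fourier_coeff n (\<lambda>\<theta>. \<Sum>m\<in>B. c m * circle_char m \<theta>) k = (\<Sum>m\<in>B. if int n dvd m - k then c m else 0)"
proof -
  let ?t = "\<lambda>l. 2 * pi * real l / real n"
  have "disc_fourier_coeff n (\<lambda>\<theta>. \<Sum>m\<in>B. c m * circle_char m \<theta>) k =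
     1 / of_nat n * (\<Sum>l<n. circle_char (- k) (?t l) * (\<Sum>m\<in>B. c m * circle_char m (?t l)))"
    by (simp add: disc_fourier_coeff_def circle_char_def)
  also have "(\<Sum>l<n. circle_char (- k) (?t l) * (\<Sum>m\<in>B. c m * circle_char m (?t l))) =
     (\<Sum>l<n. \<Sum>m\<in>B. c m * circle_char (m + - k) (?t l))"
    unfolding sum_distrib_left circle_char_add by (simp only: mult_ac)
  also have "\<dots> = (\<Sum>m\<in>B. c m * (\<Sum>l<n. circle_char (m + - k) (?t l)))"
    by (subst sum.swap) (simp only: sum_distrib_left)
  also have "\<dots> = (\<Sum>m\<in>B. of_nat n * (if int n dvd m - k then c m else 0))"
    unfolding sum_roots_of_unity[OF n] by (intro sum.cong) auto
  also have "1 / of_nat n * \<dots> = (\<Sum>m\<in>B. if int n dvd m - k then c m else 0)"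
    unfolding sum_distrib_left[symmetric] using n by simp
  finally show ?thesis .
qed

text \<open>Each m is congruent modulo n to exactly one retained mode, so the double sum
  collapses.\<close>

lemma sum_alias_modes:
  assumes n: "n > 0" and B: "finite B"
  shows "(\<Sum>k\<in>interp_modes n. (\<Sum>m\<in>B. if int n dvd m - k then c m else 0) * u k) = (\<Sum>m\<in>B. c m * (u (alias_mode n m) :: complex))"
proof -
  have "(\<Sum>k\<in>interp_modes n. (\<Sum>m\<in>B. if int n dvd m - k then c m else 0) * u k) = (\<Sum>m\<in>B. \<Sum>k\<in>interp_modes n. (if int n dvd m - k then c m else 0) * u k)"
    unfolding sum_distrib_right by (rule sum.swap)
  also have "\<dots> = (\<Sum>m\<in>B. c m * u (alias_mode n m))"
  proof (rule sum.cong[OF refl])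
    fix m
    have "(\<Sum>k\<in>interp_modes n. (if int n dvd m - k then c m else 0) * u k) = (\<Sum>k\<in>interp_modes n. if k = alias_mode n m then c m * u k else 0)"
    proof (rule sum.cong[OF refl])
      fix k assume "k \<in> interp_modes n"
      then have "int n dvd m - k \<longleftrightarrow> k = alias_mode n m"
        using alias_mode_unique[OF n, of k m] dvd_diff_alias_mode[of n m] by blast
      then show "(if int n dvd m - k then c m else 0) * u k = (if k = alias_mode n m then c m * u k else 0)" by simp
    qed
    also have "\<dots> = c m * u (alias_mode n m)" using alias_mode_in_modes[OF n, of m] by simp
    finally show "(\<Sum>k\<in>interp_modes n. (if int n dvd m - k then c m else 0) * u k) = c m * u (alias_mode n m)" .
  qed
  finally show ?thesis .
qed

text \<open>Interpolation depends only on the n node values, at each of which the Fourier series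
  converges; so interpolating partial sums and letting N grow gives the interpolant of f. Retained
  modes are reproduced exactly and drop out of the difference.\<close>

theorem alias_error_tendsto_interpolation_error:
  assumes b: "\<beta> > 0" and f: "continuous_on UNIV f" "L2_fun f" and F: "Hs_circle_fun s (pullback \<beta> f)" and s: "2 * s > 1" and n: "n > 0"
  shows "(\<lambda>N. alias_error \<beta> n ({- int N..int N} - interp_modes n) (fourier_coeff (pullback \<beta> f)) x) \<longlonglongrightarrow> rat_interp \<beta> n f x - f x"
proof -
  define F where "F = pullback \<beta> f"
  define c where "c = fourier_coeff F"
  obtain S where S: "continuous_on UNIV S" "\<And>\<theta>. (\<lambda>N. \<Sum>m\<in>{- int N..int N}. c m * circle_char m \<theta>) \<longlonglongrightarrow> S \<theta>"
    "\<And>\<theta>. 0 < \<theta> \<Longrightarrow> \<theta> < 2 * pi \<Longrightarrow> F \<theta> = S \<theta>"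
    using fourier_series_sums[OF F s continuous_pullback[OF f(1)]] unfolding F_def c_def by blast
  let ?P = "\<lambda>N \<theta>. \<Sum>m\<in>{- int N..int N}. c m * circle_char m \<theta>"
  have fS: "f x = S (line_to_circle \<beta> x)" for x
    using S(3)[OF line_to_circle_bounds[of \<beta> x]] pullback_line_to_circle[OF b, of f x] by (simp add: F_def)
  \<comment> \<open>The node at angle 0 carries the value 0 by convention. The series agrees with it
    because S(0) is the limit of the L2 function f at minus infinity.\<close>
  have S0: "S 0 = 0"
  proof (rule L2_limit_at_bot_zero[OF f(2)])
    have "filterlim (\<lambda>x. 1 / \<beta> * x) at_bot at_bot"
      using b by (intro filterlim_tendsto_pos_mult_at_bot[OF tendsto_const _ filterlim_ident]) auto
    then have "((\<lambda>x. arctan (x / \<beta>)) \<longlongrightarrow> - (pi / 2)) at_bot"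
      by (intro filterlim_compose[OF tendsto_arctan_at_bot]) simp
    then have "(line_to_circle \<beta> \<longlongrightarrow> pi + 2 * (- (pi / 2))) at_bot"
      unfolding line_to_circle_def[abs_def] by (intro tendsto_intros)
    then have "(line_to_circle \<beta> \<longlongrightarrow> 0) at_bot" by simp
    moreover have "isCont S 0" using S(1) by (simp add: continuous_on_eq_continuous_at)
    ultimately have "((\<lambda>x. S (line_to_circle \<beta> x)) \<longlongrightarrow> S 0) at_bot" by (rule isCont_tendsto_compose[rotated])
    then show "(f \<longlongrightarrow> S 0) at_bot" by (simp add: fS[symmetric])
  qed
  have node: "(\<lambda>N. ?P N (2 * pi * real l / real n)) \<longlonglongrightarrow> F (2 * pi * real l / real n)" if "l < n" for l
  proof (cases "l = 0")
    case True
    then show ?thesis using S(2)[of 0] S0 by (simp add: F_def pullback_def)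
  next
    case False
    have "2 * pi * real l / real n < 2 * pi" using that by (simp add: field_simps)
    then show ?thesis using False that S(2)[of "2 * pi * real l / real n"] S(3)[of "2 * pi * real l / real n"] by simp
  qed
  have d: "(\<lambda>N. disc_fourier_coeff n (?P N) k) \<longlonglongrightarrow> disc_fourier_coeff n F k" for k
    unfolding disc_fourier_coeff_def by (intro tendsto_intros node) auto
  have "(\<lambda>N. \<Sum>k\<in>interp_modes n. disc_fourier_coeff n (?P N) k * moebius_pow \<beta> k x) \<longlonglongrightarrow> (\<Sum>k\<in>interp_modes n. disc_fourier_coeff n F k * moebius_pow \<beta> k x)"
    by (intro tendsto_intros d)
  also have "(\<Sum>k\<in>interp_modes n. disc_fourier_coeff n F k * moebius_pow \<beta> k x) = rat_interp \<beta> n f x"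
    by (simp add: rat_interp_def interp_modes_def F_def moebius_pow_def)
  also have "(\<lambda>N. \<Sum>k\<in>interp_modes n. disc_fourier_coeff n (?P N) k * moebius_pow \<beta> k x) = (\<lambda>N. \<Sum>m\<in>{- int N..int N}. c m * moebius_pow \<beta> (alias_mode n m) x)"
    unfolding disc_fourier_coeff_trig_sum[OF n finite_atLeastAtMost_int] sum_alias_modes[OF n finite_atLeastAtMost_int] ..
  finally have r: "(\<lambda>N. \<Sum>m\<in>{- int N..int N}. c m * moebius_pow \<beta> (alias_mode n m) x) \<longlonglongrightarrow> rat_interp \<beta> n f x" .
  have "(\<lambda>N. \<Sum>m\<in>{- int N..int N}. c m * moebius_pow \<beta> m x) \<longlonglongrightarrow> f x"
    unfolding moebius_pow_eq_circle_char[OF b] fS by (rule S(2))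
  from tendsto_diff[OF r this]
  have "(\<lambda>N. \<Sum>m\<in>{- int N..int N}. c m * (moebius_pow \<beta> (alias_mode n m) x - moebius_pow \<beta> m x)) \<longlonglongrightarrow> rat_interp \<beta> n f x - f x"
    by (simp add: sum_subtractf right_diff_distrib)
  also have "(\<lambda>N. \<Sum>m\<in>{- int N..int N}. c m * (moebius_pow \<beta> (alias_mode n m) x - moebius_pow \<beta> m x)) =
     (\<lambda>N. alias_error \<beta> n ({- int N..int N} - interp_modes n) c x)"
  proof
    fix N
    have "\<forall>m\<in>{- int N..int N} - ({- int N..int N} - interp_modes n). c m * (moebius_pow \<beta> (alias_mode n m) x - moebius_pow \<beta> m x) = 0"
    proof
      fix m assume "m \<in> {- int N..int N} - ({- int N..int N} - interp_modes n)"
      then have "alias_mode n m = m" by (intro alias_mode_unique[OF n]) auto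
      then show "c m * (moebius_pow \<beta> (alias_mode n m) x - moebius_pow \<beta> m x) = 0" by (simp only: diff_self mult_zero_right)
    qed
    from sum.mono_neutral_right[OF finite_atLeastAtMost_int Diff_subset this]
    show "(\<Sum>m\<in>{- int N..int N}. c m * (moebius_pow \<beta> (alias_mode n m) x - moebius_pow \<beta> m x)) = alias_error \<beta> n ({- int N..int N} - interp_modes n) c x"
      unfolding alias_error_def .
  qed
  finally show ?thesis unfolding c_def F_def .
qed

text \<open>The bound for finite sums is used twice: on whole partial sums, for the estimates, and
  on blocks of modes, for L2 convergence to the interpolation error. The passage to the limit on the
  Fourier side requires the latter, as pointwise convergence on the line says nothing directly about
  transforms.\<close>

theorem interpolation_error_bound:
  fixes \<beta> \<epsilon> s :: real
  assumes b: "\<beta> > 0" and e: "\<epsilon> > 0" and s: "s > 1 + \<epsilon>"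
  shows "\<exists>C\<ge>0. \<forall>f n. continuous_on UNIV f \<longrightarrow> L2_fun f \<longrightarrow> Hs_circle_fun s (pullback \<beta> f) \<longrightarrow> n > 1 \<longrightarrow>
    H1_fun (\<lambda>x. rat_interp \<beta> n f x - f x) \<and>
    H1_norm (\<lambda>x. rat_interp \<beta> n f x - f x) \<le> C * real n powr (1 + \<epsilon> - s) * Hs_circle_norm s (pullback \<beta> f) \<and>
    L2_norm (\<lambda>x. rat_interp \<beta> n f x - f x) \<le> C * real n powr (1 + \<epsilon> - s) * Hs_circle_norm s (pullback \<beta> f)"
proof -
  obtain C0 where C0_bound: "C0 \<ge> 0 \<and> (\<forall>n>1. \<forall>A c. finite A \<longrightarrow> A \<inter> interp_modes n = {} \<longrightarrow>
    sq_norm (alias_error \<beta> n A c) + sq_norm (alias_error_deriv \<beta> n A c) \<le>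
      ennreal (C0 * real n powr (2 * (1 + \<epsilon> - s)) * (\<Sum>m\<in>A. (1 + \<bar>real_of_int m\<bar>) powr (2 * s) * (cmod (c m))\<^sup>2)))"
    by (rule exE[OF alias_error_bound[OF b e s]])
  note C0 = C0_bound[THEN conjunct1] and bound = C0_bound[THEN conjunct2, rule_format]
  show ?thesis
  \<comment> \<open>The factor 4 pi is the constant of
    \<open>sq_norm_weighted_le_derivative\<close>; the root appears because the preceding bounds are
    for squared norms.\<close>
  proof (intro exI[of _ "sqrt (4 * pi * C0)"] conjI allI impI)
    show "sqrt (4 * pi * C0) \<ge> 0" using C0 by simp
    fix f :: "real \<Rightarrow> complex" and n :: nat
    assume f: "continuous_on UNIV f" "L2_fun f" and F: "Hs_circle_fun s (pullback \<beta> f)" and n: "n > 1"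
    define g where "g = (\<lambda>x. rat_interp \<beta> n f x - f x)"
    define c where "c = fourier_coeff (pullback \<beta> f)"
    define u where "u m = (1 + \<bar>real_of_int m\<bar>) powr (2 * s) * (cmod (c m))\<^sup>2" for m
    define A where "A N = {- int N..int N} - interp_modes n" for N
    define p where "p N = alias_error \<beta> n (A N) c" for N
    define K where "K = C0 * real n powr (2 * (1 + \<epsilon> - s))"
    define U where "U = (\<Sum>\<^sub>\<infinity>m. u m)"
    define V where "V N = (\<Sum>m\<in>{- int N..int N}. u m)" for N
    have s2: "2 * s > 1" and n0: "n > 0" using s e n by auto
    have K0: "K \<ge> 0" using C0 by (simp add: K_def)
    have u0: "u m \<ge> 0" for m by (simp add: u_def)
    have usum: "u summable_on UNIV" using F unfolding Hs_circle_fun_def u_def c_def by simp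
    have U0: "U \<ge> 0" unfolding U_def by (rule infsum_nonneg) (rule u0)
    have plim: "(\<lambda>N. p N x) \<longlonglongrightarrow> g x" for x
      unfolding p_def A_def c_def g_def by (rule alias_error_tendsto_interpolation_error[OF b f F s2 n0])
    have meas: "alias_error \<beta> n B c \<in> borel_measurable borel" "alias_error_deriv \<beta> n B c \<in> borel_measurable borel" for B
      by (rule borel_measurable_continuous_onI[OF alias_error_properties(3)[OF b]] borel_measurable_continuous_onI[OF alias_error_properties(2)[OF b]])+
    have [measurable]: "p N \<in> borel_measurable borel" for N unfolding p_def by (rule meas)
    have [measurable]: "g \<in> borel_measurable borel" by (rule borel_measurable_LIMSEQ_metric[OF _ plim]) measurable
    have Vlim: "V \<longlonglongrightarrow> U"
      using filterlim_compose[OF has_sum_infsum[OF usum, unfolded has_sum_def] filterlim_symmetric_intervals]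
      unfolding V_def U_def by simp
    have sumA: "(\<Sum>m\<in>B. u m) \<le> U" if "finite B" for B
      unfolding U_def by (rule finite_sum_le_infsum[OF usum that]) (auto simp: u0)
    have both: "sq_norm (p N) + sq_norm (alias_error_deriv \<beta> n (A N) c) \<le> ennreal (K * U)" for N
    proof -
      have "sq_norm (p N) + sq_norm (alias_error_deriv \<beta> n (A N) c) \<le> ennreal (K * (\<Sum>m\<in>A N. u m))"
        unfolding p_def K_def u_def by (rule bound[OF n]) (auto simp: A_def)
      also have "\<dots> \<le> ennreal (K * U)" using K0 by (intro ennreal_leI mult_left_mono sumA) (auto simp: A_def)
      finally show ?thesis .
    qed
    have pb: "sq_norm (p N) \<le> ennreal (K * U)" "sq_norm (alias_error_deriv \<beta> n (A N) c) \<le> ennreal (K * U)" for N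
      using both[of N] by (auto intro: order_trans[rotated])
    have pL: "L2_fun (p N)" for N
      unfolding L2_fun_iff_sq_norm using pb(1)[of N] by (auto intro: le_less_trans)
    have dL: "L2_fun (alias_error_deriv \<beta> n (A N) c)" for N
      unfolding L2_fun_iff_sq_norm using pb(2)[of N] meas(2) by (auto intro: le_less_trans)
    have gb: "sq_norm g \<le> ennreal (K * U)"
      unfolding sq_norm_def
    proof (rule nn_integral_limit_le)
      show "AE x in lborel. (\<lambda>N. ennreal ((cmod (p N x))\<^sup>2)) \<longlonglongrightarrow> ennreal ((cmod (g x))\<^sup>2)"
        by (intro AE_I2 tendsto_ennrealI tendsto_intros plim)
      show "\<forall>\<^sub>F N in sequentially. (\<integral>\<^sup>+x. ennreal ((cmod (p N x))\<^sup>2) \<partial>lborel) \<le> ennreal (K * U)"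
        using pb(1) by (auto simp: sq_norm_def)
    qed measurable
    then have gL: "L2_fun g" unfolding L2_fun_iff_sq_norm by (auto intro: le_less_trans)
    \<comment> \<open>The difference of two partial errors is the error of the block of modes
      between them, and its Sobolev sum is at most what remains of \<open>U\<close> beyond
      \<open>V N\<close>.\<close>
    have tail: "sq_norm (\<lambda>x. g x - p N x) \<le> ennreal (K * (U - V N))" for N
      unfolding sq_norm_def
    proof (rule nn_integral_limit_le)
      show "AE x in lborel. (\<lambda>M. ennreal ((cmod (p M x - p N x))\<^sup>2)) \<longlonglongrightarrow> ennreal ((cmod (g x - p N x))\<^sup>2)"
        by (intro AE_I2 tendsto_ennrealI tendsto_intros plim)
      have "(\<integral>\<^sup>+x. ennreal ((cmod (p M x - p N x))\<^sup>2) \<partial>lborel) \<le> ennreal (K * (U - V N))" if "N \<le> M" for M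
      proof -
        have sub: "A N \<subseteq> A M" using that by (auto simp: A_def)
        have "p M x - p N x = alias_error \<beta> n (A M - A N) c x" for x
          unfolding p_def alias_error_def using sub by (subst sum_diff) (auto simp: A_def)
        then have "(\<integral>\<^sup>+x. ennreal ((cmod (p M x - p N x))\<^sup>2) \<partial>lborel) = sq_norm (alias_error \<beta> n (A M - A N) c)"
          by (simp add: sq_norm_def)
        also have "\<dots> \<le> sq_norm (alias_error \<beta> n (A M - A N) c) + sq_norm (alias_error_deriv \<beta> n (A M - A N) c)" by simp
        also have "\<dots> \<le> ennreal (K * (\<Sum>m\<in>A M - A N. u m))"
          unfolding K_def u_def by (rule bound[OF n]) (auto simp: A_def)
        also have "\<dots> \<le> ennreal (K * (U - V N))"
        proof (intro ennreal_leI mult_left_mono K0)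
          have "(\<Sum>m\<in>A M - A N. u m) + V N = (\<Sum>m\<in>(A M - A N) \<union> {- int N..int N}. u m)"
            unfolding V_def by (subst sum.union_disjoint) (auto simp: A_def)
          also have "\<dots> \<le> U" by (rule sumA) (auto simp: A_def)
          finally show "(\<Sum>m\<in>A M - A N. u m) \<le> U - V N" by simp
        qed
        finally show ?thesis .
      qed
      then show "\<forall>\<^sub>F M in sequentially. (\<integral>\<^sup>+x. ennreal ((cmod (p M x - p N x))\<^sup>2) \<partial>lborel) \<le> ennreal (K * (U - V N))"
        by (auto simp: eventually_sequentially)
    qed measurable
    have gp: "(\<lambda>N. sq_norm (\<lambda>x. g x - p N x)) \<longlonglongrightarrow> 0"
    proof (rule tendsto_sandwich[OF _ _ tendsto_const])
      have "(\<lambda>N. ennreal (K * (U - V N))) \<longlonglongrightarrow> ennreal (K * (U - U))"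
        by (intro tendsto_ennrealI tendsto_intros Vlim)
      then show "(\<lambda>N. ennreal (K * (U - V N))) \<longlonglongrightarrow> 0" by simp
    qed (auto intro!: always_eventually tail)
    have W: "sq_norm (weighted (fourier_L2 g)) \<le> ennreal (4 * pi) * ennreal (K * U)"
    proof (rule sq_norm_weighted_limit_le[OF pL gL gp])
      have "sq_norm (weighted (fourier_L2 (p N))) \<le> ennreal (4 * pi) * (sq_norm (p N) + sq_norm (alias_error_deriv \<beta> n (A N) c))" for N
        using pL[of N] dL[of N] unfolding p_def
        by (intro sq_norm_weighted_le_derivative alias_error_properties b)
      also have "\<dots> N \<le> ennreal (4 * pi) * ennreal (K * U)" for N by (intro mult_left_mono both) simp
      finally show "\<forall>\<^sub>F N in sequentially. sq_norm (weighted (fourier_L2 (p N))) \<le> ennreal (4 * pi) * ennreal (K * U)" by simp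
    qed
    then have H: "H1_fun g" unfolding H1_fun_iff using gL by (auto intro!: le_less_trans[OF W] simp: ennreal_mult_less_top)
    then show "H1_fun (\<lambda>x. rat_interp \<beta> n f x - f x)" unfolding g_def .
    have HU: "(Hs_circle_norm s (pullback \<beta> f))\<^sup>2 = U"
      using U0 by (simp add: Hs_circle_norm_def U_def u_def[abs_def] c_def)
    have Hs0: "Hs_circle_norm s (pullback \<beta> f) \<ge> 0"
      unfolding Hs_circle_norm_def by (intro real_sqrt_ge_zero infsum_nonneg) auto
    let ?R = "sqrt (4 * pi * C0) * real n powr (1 + \<epsilon> - s) * Hs_circle_norm s (pullback \<beta> f)"
    have R0: "?R \<ge> 0" using C0 Hs0 by (intro mult_nonneg_nonneg) auto
    have R: "?R\<^sup>2 = 4 * pi * (K * U)"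
    proof -
      have "(real n powr (1 + \<epsilon> - s))\<^sup>2 = real n powr (2 * (1 + \<epsilon> - s))"
        by (simp only: power2_eq_square powr_add[symmetric] mult_2)
      then show ?thesis using C0 unfolding power_mult_distrib HU by (simp add: K_def)
    qed
    have "ennreal ((H1_norm g)\<^sup>2) \<le> ennreal (?R\<^sup>2)"
      using W K0 U0 unfolding sq_norm_weighted_eq_H1_norm[OF H] R by (simp add: ennreal_mult[symmetric])
    then have "(H1_norm g)\<^sup>2 \<le> ?R\<^sup>2" by (subst (asm) ennreal_le_iff) auto
    then show "H1_norm (\<lambda>x. rat_interp \<beta> n f x - f x) \<le> ?R"
      unfolding g_def[symmetric] using R0 by (rule power2_le_imp_le)
    have "ennreal ((L2_norm g)\<^sup>2) \<le> ennreal (K * U)" using gb unfolding sq_norm_eq_L2_norm[OF gL] .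
    then have "(L2_norm g)\<^sup>2 \<le> 1 * (K * U)" using K0 U0 by (subst (asm) ennreal_le_iff) auto
    \<comment> \<open>The L2 bound is enlarged by 4 pi so that one constant serves both
      norms.\<close>
    also have "\<dots> \<le> 4 * pi * (K * U)" using K0 U0 pi_gt3 by (intro mult_right_mono) auto
    finally have "(L2_norm g)\<^sup>2 \<le> ?R\<^sup>2" unfolding R .
    then show "L2_norm (\<lambda>x. rat_interp \<beta> n f x - f x) \<le> ?R"
      unfolding g_def[symmetric] using R0 by (rule power2_le_imp_le)
  qed
qed

text \<open>Continuity of f is a separate hypothesis because \<open>H1_fun\<close> does not select
  the continuous representative, whose values are sampled at the nodes. Membership in H1 and L2 is
  asserted together with the norms, since a norm given by a divergent integral would be 0 by
  convention; the supremum is taken in the extended reals, where it always exists.\<close>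

theorem mainTheorem3:
  fixes \<beta> \<epsilon> s :: real
  assumes "\<beta> > 0" and "\<epsilon> > 0" and "s > 1 + \<epsilon>"
  shows "\<exists>C::real. \<forall>(f :: real \<Rightarrow> complex) (k::real) (n::nat).
    continuous_on UNIV f \<longrightarrow> H1_fun f \<longrightarrow> Hs_circle_fun s (pullback \<beta> f) \<longrightarrow> n > 1 \<longrightarrow>
      (\<forall>\<delta>\<ge>0.
         H1_fun (osc_cauchy_error \<beta> k n f \<delta>) \<and>
         H1_fun (\<lambda>x. rat_interp \<beta> n f x - f x) \<and>
         H1_norm (osc_cauchy_error \<beta> k n f \<delta>)
           \<le> (1 + \<bar>k\<bar>) * H1_norm (\<lambda>x. rat_interp \<beta> n f x - f x) \<and>
         (1 + \<bar>k\<bar>) * H1_norm (\<lambda>x. rat_interp \<beta> n f x - f x)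
           \<le> C * (1 + \<bar>k\<bar>) * real n powr (1 + \<epsilon> - s) * Hs_circle_norm s (pullback \<beta> f)) \<and>
      (\<forall>\<delta>\<ge>0.
         L2_fun (osc_cauchy_error \<beta> k n f \<delta>) \<and>
         L2_fun (\<lambda>x. rat_interp \<beta> n f x - f x) \<and>
         L2_norm (osc_cauchy_error \<beta> k n f \<delta>)
           \<le> L2_norm (\<lambda>x. rat_interp \<beta> n f x - f x) \<and>
         L2_norm (\<lambda>x. rat_interp \<beta> n f x - f x)
           \<le> C * real n powr (1 + \<epsilon> - s) * Hs_circle_norm s (pullback \<beta> f)) \<and>
      (\<forall>\<delta>>0. \<forall>\<sigma>\<in>{1, -1}.
         (SUP x::real. ereal (cmod
             (osc_cauchy k f (complex_of_real x + \<sigma> * \<i> * complex_of_real \<delta>)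
              - osc_cauchy_approx \<beta> k n f (complex_of_real x + \<sigma> * \<i> * complex_of_real \<delta>))))
           \<le> ereal (C * (1 + \<bar>k\<bar>) * real n powr (1 + \<epsilon> - s) * Hs_circle_norm s (pullback \<beta> f)))"
proof -
  obtain C where C: "C \<ge> 0" and bound: "\<And>f n. continuous_on UNIV f \<Longrightarrow> L2_fun f \<Longrightarrow> Hs_circle_fun s (pullback \<beta> f) \<Longrightarrow> n > 1 \<Longrightarrow>
    H1_fun (\<lambda>x. rat_interp \<beta> n f x - f x) \<and>
    H1_norm (\<lambda>x. rat_interp \<beta> n f x - f x) \<le> C * real n powr (1 + \<epsilon> - s) * Hs_circle_norm s (pullback \<beta> f) \<and>
    L2_norm (\<lambda>x. rat_interp \<beta> n f x - f x) \<le> C * real n powr (1 + \<epsilon> - s) * Hs_circle_norm s (pullback \<beta> f)"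
    using interpolation_error_bound[OF assms] by blast
  show ?thesis
  proof (rule exI[of _ C], intro allI impI)
    fix f :: "real \<Rightarrow> complex" and k :: real and n :: nat
    assume fc: "continuous_on UNIV f" and f: "H1_fun f" and F: "Hs_circle_fun s (pullback \<beta> f)" and n: "n > 1"
    let ?g = "\<lambda>x. rat_interp \<beta> n f x - f x"
    let ?R = "real n powr (1 + \<epsilon> - s) * Hs_circle_norm s (pullback \<beta> f)"
    have fL: "L2_fun f" using f by (simp add: H1_fun_def)
    have g: "H1_fun ?g" "H1_norm ?g \<le> C * ?R" "L2_norm ?g \<le> C * ?R"
      using bound[OF fc fL F n] by (simp_all add: mult.assoc)
    have gL: "L2_fun ?g" using g(1) by (simp add: H1_fun_def)
    have rL: "L2_fun (rat_interp \<beta> n f)" using L2_fun_add[OF gL fL] by simp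
    have err: "L2_fun (osc_cauchy_error \<beta> k n f \<delta>)" "L2_norm (osc_cauchy_error \<beta> k n f \<delta>) \<le> L2_norm ?g"
      "H1_fun (osc_cauchy_error \<beta> k n f \<delta>)" "H1_norm (osc_cauchy_error \<beta> k n f \<delta>) \<le> (1 + \<bar>k\<bar>) * H1_norm ?g" if "\<delta> \<ge> 0" for \<delta>
    proof -
      have [measurable]: "fourier_L2 ?g \<in> borel_measurable borel" using gL by (rule fourier_L2_measurable)
      have m: "(\<lambda>\<xi>. - shifted_transform k ?g \<delta> \<xi>) \<in> borel_measurable borel"
        unfolding shifted_transform_def[abs_def] by measurable
      have le: "cmod (- shifted_transform k ?g \<delta> \<xi>) \<le> cmod (fourier_L2 ?g (\<xi> + k))" for \<xi>
        using that by (auto simp: shifted_transform_def indicator_def mult_left_le_one_le)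
      note b = inv_ft_bounds[OF g(1) m le]
      note eq = osc_cauchy_error_eq_inv_ft[OF f g(1) that, of k]
      show "L2_fun (osc_cauchy_error \<beta> k n f \<delta>)" "L2_norm (osc_cauchy_error \<beta> k n f \<delta>) \<le> L2_norm ?g"
        "H1_fun (osc_cauchy_error \<beta> k n f \<delta>)" "H1_norm (osc_cauchy_error \<beta> k n f \<delta>) \<le> (1 + \<bar>k\<bar>) * H1_norm ?g"
        unfolding eq by (rule b)+
    qed
    have kR: "(1 + \<bar>k\<bar>) * H1_norm ?g \<le> C * (1 + \<bar>k\<bar>) * real n powr (1 + \<epsilon> - s) * Hs_circle_norm s (pullback \<beta> f)"
      using mult_left_mono[OF g(2), of "1 + \<bar>k\<bar>"] by (simp add: mult_ac)
    have sup: "(SUP x::real. ereal (cmod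
             (osc_cauchy k f (complex_of_real x + \<sigma> * \<i> * complex_of_real \<delta>)
              - osc_cauchy_approx \<beta> k n f (complex_of_real x + \<sigma> * \<i> * complex_of_real \<delta>))))
           \<le> ereal (C * (1 + \<bar>k\<bar>) * real n powr (1 + \<epsilon> - s) * Hs_circle_norm s (pullback \<beta> f))"
      if \<delta>: "\<delta> > 0" and \<sigma>: "\<sigma> \<in> {1, -1}" for \<delta> :: real and \<sigma> :: complex
    proof (rule SUP_least)
      fix x :: real
      let ?z = "complex_of_real x + \<sigma> * \<i> * complex_of_real \<delta>"
      have z: "Im ?z \<noteq> 0" using \<delta> \<sigma> by auto
      have "cmod (osc_cauchy k f ?z - osc_cauchy_approx \<beta> k n f ?z) = cmod (osc_cauchy k ?g ?z)"
        unfolding osc_cauchy_diff[OF rL fL z] osc_cauchy_approx_def by (rule norm_minus_commute)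
      also have "\<dots> \<le> H1_norm ?g" by (rule norm_osc_cauchy_le_H1_norm[OF g(1) z])
      also have "\<dots> \<le> (1 + \<bar>k\<bar>) * H1_norm ?g" using mult_right_mono[of 1 "1 + \<bar>k\<bar>" "H1_norm ?g"] by simp
      also note kR
      finally show "ereal (cmod (osc_cauchy k f ?z - osc_cauchy_approx \<beta> k n f ?z))
         \<le> ereal (C * (1 + \<bar>k\<bar>) * real n powr (1 + \<epsilon> - s) * Hs_circle_norm s (pullback \<beta> f))" by simp
    qed
    show "(\<forall>\<delta>\<ge>0.
         H1_fun (osc_cauchy_error \<beta> k n f \<delta>) \<and>
         H1_fun (\<lambda>x. rat_interp \<beta> n f x - f x) \<and>
         H1_norm (osc_cauchy_error \<beta> k n f \<delta>)
           \<le> (1 + \<bar>k\<bar>) * H1_norm (\<lambda>x. rat_interp \<beta> n f x - f x) \<and>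
         (1 + \<bar>k\<bar>) * H1_norm (\<lambda>x. rat_interp \<beta> n f x - f x)
           \<le> C * (1 + \<bar>k\<bar>) * real n powr (1 + \<epsilon> - s) * Hs_circle_norm s (pullback \<beta> f)) \<and>
      (\<forall>\<delta>\<ge>0.
         L2_fun (osc_cauchy_error \<beta> k n f \<delta>) \<and>
         L2_fun (\<lambda>x. rat_interp \<beta> n f x - f x) \<and>
         L2_norm (osc_cauchy_error \<beta> k n f \<delta>)
           \<le> L2_norm (\<lambda>x. rat_interp \<beta> n f x - f x) \<and>
         L2_norm (\<lambda>x. rat_interp \<beta> n f x - f x)
           \<le> C * real n powr (1 + \<epsilon> - s) * Hs_circle_norm s (pullback \<beta> f)) \<and>
      (\<forall>\<delta>>0. \<forall>\<sigma>\<in>{1, -1}.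
         (SUP x::real. ereal (cmod
             (osc_cauchy k f (complex_of_real x + \<sigma> * \<i> * complex_of_real \<delta>)
              - osc_cauchy_approx \<beta> k n f (complex_of_real x + \<sigma> * \<i> * complex_of_real \<delta>))))
           \<le> ereal (C * (1 + \<bar>k\<bar>) * real n powr (1 + \<epsilon> - s) * Hs_circle_norm s (pullback \<beta> f)))"
      using err g(1) gL kR g(3) sup by (intro conjI allI impI ballI) (simp_all only: mult.assoc)
  qed
qed

end
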